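(* For every integer $l\ge1$ the limit $$p_l=\lim_{n\to\infty}\frac{n^{2l-2}K_l^{(2)}}{(l-1)!}$$ exists and is an integer. The sequence $(p_l)_{l\ge1}$ satisfies the recurrence relation $$(l+1)p_{l+1}=2(2l-1)p_l+2\sum_{i=0}^{l-1}(3i+1)(l-i)p_{i+1}p_{l-i}\qquad(l\ge1),$$ with initial condition $p_1=1$. Furthermore, the generating function $F(z)=\sum_{i=1}^\infty p_iz^i$ is $$F(z)=\tfrac32-\tfrac32\Omega(z)+2z\Omega(z)^3+3z\Omega(z)^2+2z\Omega(z),$$ where $\Omega(z)$ admits the power series expansion $\Omega(z)=1+\sum_{k=1}^\infty\zeta_kz^k$ with $$\zeta_k=\frac4k\sum_{i=0}^{k-1}\binom{2k-i-2}{k-1}\left(\sum_{p=0}^i\binom{2k}{p}\binom{2k}{i-p}2^{i+p}\right)(-3)^{k-1-i}.$$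
   Context: For an integer $n\ge1$, let $K_l^{(2)}$ denote the $l$-th cumulant of the Wigner delay time with $n$ channels and $\beta=2$. Explicitly, with $b=3n$ let $$M_n^{(2)}(z)=\frac1{m_n^{(2)}}\int_{\mathbb R_+^n}\prod_{j=1}^n\lambda_j^{-b}\exp\left(-\frac1{\lambda_j}+z\lambda_j\right)\prod_{1\le j<k\le n}|\lambda_k-\lambda_j|^2\,d\lambda_1\cdots d\lambda_n\qquad(z\le 0),$$ with $m_n^{(2)}$ the constant such that $M_n^{(2)}(0)=1$. Then the $K_l^{(2)}$ (depending on $n$) are defined by the asymptotic expansion $$\log M_n^{(2)}(z)=\sum_{l=1}^{q}\frac{K_l^{(2)}}{l!}z^l+o(z^q),\qquad z\to0^-,$$ where $q=\lfloor b-2-2(n-1)\rfloor=n$. (Thus for fixed $l$, $K_l^{(2)}$ is defined for all $n\ge l$; equivalently $K_l^{(2)}$ is the $l$-th cumulant of $\sum_j\lambda_j$ under the density proportional to $\prod_j\lambda_j^{-b}e^{-1/\lambda_j}\prod_{j<k}|\lambda_k-\lambda_j|^2$.) *)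

theory Defs
  imports "HOL-Analysis.Analysis" "HOL-Library.Landau_Symbols"
    "HOL-Computational_Algebra.Formal_Power_Series"
begin

definition positive_orthant :: "nat \<Rightarrow> (nat \<Rightarrow> real) set" where
  "positive_orthant n = (\<Pi>\<^sub>E j\<in>{1..n}. {0<..})"

definition delay_weight :: "nat \<Rightarrow> real \<Rightarrow> (nat \<Rightarrow> real) \<Rightarrow> real" where
  "delay_weight n z x =
     (\<Prod>j\<in>{1..n}. x j powi (- (3 * int n)) * exp (- 1 / x j + z * x j)) *
     (\<Prod>k\<in>{1..n}. \<Prod>j\<in>{1..<k}. \<bar>x k - x j\<bar> ^ 2)"

definition delay_integral :: "nat \<Rightarrow> real \<Rightarrow> real" where
  "delay_integral n z =
     set_lebesgue_integral (Pi\<^sub>M {1..n} (\<lambda>_. lborel)) (positive_orthant n) (delay_weight n z)"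

definition delay_mgf :: "nat \<Rightarrow> real \<Rightarrow> real" where
  "delay_mgf n z = delay_integral n z / delay_integral n 0"

text \<open>Moments of the delay time exist up to order $b - 2 - 2(n-1) = n$ for $b = 3n$, so the
  expansion is taken up to order $n$, and only the values \<open>K l\<close> with \<open>1 \<le> l \<le> n\<close> matter.
  The integral diverges for $z > 0$, hence the one-sided filter.\<close>

definition log_mgf_expansion :: "nat \<Rightarrow> (nat \<Rightarrow> real) \<Rightarrow> bool" where
  "log_mgf_expansion n K \<longleftrightarrow>
     (\<lambda>z. ln (delay_mgf n z) - (\<Sum>l=1..n. K l / fact l * z ^ l)) \<in> o[at_left 0](\<lambda>z. z ^ n)"

text \<open>Meaningful only for \<open>1 \<le> l \<le> n\<close>; an unspecified value otherwise.\<close>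

definition delay_cumulant :: "nat \<Rightarrow> nat \<Rightarrow> real" where
  "delay_cumulant n l = (THE c. \<exists>K. log_mgf_expansion n K \<and> K l = c)"

definition scaled_cumulant :: "nat \<Rightarrow> nat \<Rightarrow> real" where
  "scaled_cumulant l n = real n ^ (2 * l - 2) * delay_cumulant n l / fact (l - 1)"

definition limit_cumulant :: "nat \<Rightarrow> real" where
  "limit_cumulant l = lim (scaled_cumulant l)"

definition limit_cumulant_gf :: "real fps" where
  "limit_cumulant_gf = Abs_fps (\<lambda>i. if i = 0 then 0 else limit_cumulant i)"

text \<open>For \<open>i < k\<close> the truncated subtractions on \<^typ>\<open>nat\<close> below agree with the integer ones.\<close>

definition omega_coeff :: "nat \<Rightarrow> real" where
  "omega_coeff k = 4 / real k *
     (\<Sum>i<k. real ((2 * k - i - 2) choose (k - 1)) *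
        (\<Sum>p\<le>i. real ((2 * k) choose p) * real ((2 * k) choose (i - p)) * 2 ^ (i + p)) *
        (- 3) ^ (k - 1 - i))"

definition omega_series :: "real fps" where
  "omega_series = Abs_fps (\<lambda>k. if k = 0 then 1 else omega_coeff k)"

end

theory Submission
  imports Defs "HOL-Computational_Algebra.Polynomial" "HOL-Probability.Sinc_Integral"
    "Jordan_Normal_Form.Determinant"
begin

hide_const (open) Module.smult

text \<open>Fix \<open>b = 3 n\<close>. By Andreief's identity the partition function is \<open>n!\<close> times the product of
  the squared norms \<open>h\<^sub>0, \<dots>, h\<^bsub>n-1\<^esub>\<close> of the monic orthogonal polynomials for the weight
  \<open>x\<^bsup>-b\<^esup> exp (-1/x + z x)\<close>. Varying \<open>z\<close> makes the Jacobi coefficients \<open>\<alpha>\<^sub>j, \<beta>\<^sub>j\<close> a solution of the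
  Toda lattice, and integration by parts against the weight adds a string equation. With
  \<open>\<sigma> = (log M)' = \<beta>\<^sub>0 + \<dots> + \<beta>\<^bsub>n-1\<^esub>\<close> these two facts close up to a third-order differential equation
  for \<open>\<sigma>\<close> (a Painleve III equation before its last integration), once a first integral has been
  evaluated at \<open>z = 0\<close>.

  All moments that enter are smooth up to \<open>z = 0\<close> to the order allowed by \<open>b\<close>, so the equation
  passes to the Taylor coefficients of \<open>\<sigma>\<close>, which are the cumulants. After rescaling it reads
  \<open>2 (j - 1) (1 - j\<^sup>2/n\<^sup>2) p\<^sub>2 p\<^bsub>j+1\<^esub> = \<dots>\<close> with only lower cumulants on the right, so that all
  scaled cumulants converge because the first two do; these come from the string equation at
  \<open>z = 0\<close>. The limits are determined by the limiting equation. The series \<open>F\<close> in the statement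
  satisfies \<open>F' = \<Omega>\<close>, where Lagrange inversion identifies \<open>\<Omega>\<close> as the root of
  \<open>(\<Omega> - 1) (3 \<Omega> + 1) = 4 z \<Omega>\<^sup>2 (\<Omega> + 1)\<^sup>2\<close>; from this \<open>F\<close> solves both the limiting equation and the
  first-order equation that encodes the recurrence. Integrality holds because \<open>\<Omega> = 1 + 4 W\<close> with
  \<open>W = z (1 + 4 W)\<^sup>2 (1 + 2 W)\<^sup>2 - 3 W\<^sup>2\<close>.\<close>

section \<open>Orthogonal polynomials of a moment sequence\<close>

text \<open>At z = 0 the weight decays only like a power of x, so just finitely many moments survive
  and nothing is analytic at the origin. The lattice identities are therefore proved for z < 0,
  where every moment exists, and only limits and one-sided Taylor coefficients are carried to 0. The
  choice b = 3 n leaves exactly n orders for the logarithm of the partition function, and the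
  third-order equation consumes four of them. The third-order form suits coefficient extraction.
  Apart from a cubic part with smaller indices, each term is a product of two series without
  constant term, so in degree j + 1 the coefficient of index j meets only the one of index 1 and
  enters linearly. The recurrence of the statement is not reached through finite n: it and the
  limiting equation both follow from the algebraic equation for \<Omega>, and the limits are
  identified because the limiting equation has only one solution with the given first two
  coefficients.\<close>

definition mfun :: "(nat \<Rightarrow> real) \<Rightarrow> real poly \<Rightarrow> real" where
  "mfun \<mu> p = (\<Sum>i\<le>degree p. coeff p i * \<mu> i)"

lemma mfun_altdef:
  assumes "\<And>i. i > n \<Longrightarrow> coeff p i = 0"
  shows "mfun \<mu> p = (\<Sum>i\<le>n. coeff p i * \<mu> i)"
proof -
  have "degree p \<le> n" using assms by (intro degree_le) auto
  then show ?thesis unfolding mfun_def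
    by (intro sum.mono_neutral_left) (auto simp: coeff_eq_0)
qed

lemma mfun_add: "mfun \<mu> (p + q) = mfun \<mu> p + mfun \<mu> q"
proof -
  let ?n = "max (degree p) (degree q)"
  have "mfun \<mu> (p + q) = (\<Sum>i\<le>?n. coeff (p + q) i * \<mu> i)"
    by (rule mfun_altdef) (simp add: coeff_eq_0)
  moreover have "mfun \<mu> p = (\<Sum>i\<le>?n. coeff p i * \<mu> i)" "mfun \<mu> q = (\<Sum>i\<le>?n. coeff q i * \<mu> i)"
    by (rule mfun_altdef; simp add: coeff_eq_0)+
  ultimately show ?thesis by (simp add: sum.distrib distrib_right)
qed

lemma mfun_smult: "mfun \<mu> (smult c p) = c * mfun \<mu> p"
proof -
  have "mfun \<mu> (smult c p) = (\<Sum>i\<le>degree p. coeff (smult c p) i * \<mu> i)"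
    by (rule mfun_altdef) (simp add: coeff_eq_0)
  then show ?thesis by (simp add: mfun_def sum_distrib_left mult.assoc)
qed

lemma mfun_0 [simp]: "mfun \<mu> 0 = 0" by (simp add: mfun_def)

lemma mfun_diff: "mfun \<mu> (p - q) = mfun \<mu> p - mfun \<mu> q"
  using mfun_add[of \<mu> "p - q" q] by simp

text \<open>The three-term recurrence serves as the definition, so that orthogonality becomes a
  theorem and the coefficients can be differentiated step by step. Since x / 0 = 0 the recursion is
  total; nonvanishing norms first matter in \<open>opoly_orthogonal\<close>.\<close>

fun opoly :: "(nat \<Rightarrow> real) \<Rightarrow> nat \<Rightarrow> real poly" where
  "opoly \<mu> 0 = 1"
| "opoly \<mu> (Suc 0) = pCons 0 1 - smult (mfun \<mu> (pCons 0 1) / mfun \<mu> 1) 1"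
| "opoly \<mu> (Suc (Suc n)) =
     pCons 0 (opoly \<mu> (Suc n))
     - smult (mfun \<mu> (pCons 0 (opoly \<mu> (Suc n) * opoly \<mu> (Suc n)))
              / mfun \<mu> (opoly \<mu> (Suc n) * opoly \<mu> (Suc n))) (opoly \<mu> (Suc n))
     - smult (mfun \<mu> (opoly \<mu> (Suc n) * opoly \<mu> (Suc n)) / mfun \<mu> (opoly \<mu> n * opoly \<mu> n)) (opoly \<mu> n)"

declare opoly.simps(2,3) [simp del]

definition sqnorm :: "(nat \<Rightarrow> real) \<Rightarrow> nat \<Rightarrow> real" where
  "sqnorm \<mu> n = mfun \<mu> (opoly \<mu> n * opoly \<mu> n)"

definition jac_b :: "(nat \<Rightarrow> real) \<Rightarrow> nat \<Rightarrow> real" where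
  "jac_b \<mu> n = mfun \<mu> (pCons 0 (opoly \<mu> n * opoly \<mu> n)) / sqnorm \<mu> n"

text \<open>The value 0 at index 0 removes the spurious \<open>opoly \<mu> (0 - 1)\<close> from the
  uniform recurrence \<open>opoly_Suc\<close>.\<close>

definition jac_a :: "(nat \<Rightarrow> real) \<Rightarrow> nat \<Rightarrow> real" where
  "jac_a \<mu> n = (if n = 0 then 0 else sqnorm \<mu> n / sqnorm \<mu> (n - 1))"

lemma opoly_Suc:
  "opoly \<mu> (Suc n) = pCons 0 (opoly \<mu> n) - smult (jac_b \<mu> n) (opoly \<mu> n)
     - smult (jac_a \<mu> n) (opoly \<mu> (n - 1))"
  by (cases n) (simp_all add: jac_b_def jac_a_def sqnorm_def opoly.simps)

lemma opoly_monic: "coeff (opoly \<mu> n) n = 1 \<and> (\<forall>i>n. coeff (opoly \<mu> n) i = 0)"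
proof (induction n rule: less_induct)
  case (less n)
  show ?case
  proof (cases n)
    case 0 then show ?thesis by auto
  next
    case (Suc m)
    have A: "coeff (opoly \<mu> m) m = 1" "\<And>i. i > m \<Longrightarrow> coeff (opoly \<mu> m) i = 0" using less[of m] Suc by auto
    have B: "i > m \<Longrightarrow> jac_a \<mu> m * coeff (opoly \<mu> (m - 1)) i = 0" for i
      using less[of "m - 1"] Suc by (cases m) (auto simp: jac_a_def)
    show ?thesis unfolding Suc opoly_Suc
      using A B by (auto simp: coeff_pCons split: nat.splits)
  qed
qed

lemma coeff_opoly_self [simp]: "coeff (opoly \<mu> n) n = 1"
  and coeff_opoly_gt: "i > n \<Longrightarrow> coeff (opoly \<mu> n) i = 0"
  using opoly_monic by auto

lemma opoly_nonzero: "opoly \<mu> n \<noteq> 0"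
  using coeff_opoly_self[of \<mu> n] by (metis coeff_0 zero_neq_one)

lemma degree_opoly [simp]: "degree (opoly \<mu> n) = n"
  by (intro antisym degree_le le_degree) (auto simp: coeff_opoly_gt)

text \<open>Subtracting the right multiple of the monic \<open>opoly \<mu> n\<close> lowers the
  degree of q. Orthogonality is a hypothesis here so that the lemma can be used inside the induction
  that proves it.\<close>

lemma mfun_opoly_top_aux:
  assumes "\<And>p. (\<forall>i\<ge>n. coeff p i = 0) \<Longrightarrow> mfun \<mu> (opoly \<mu> n * p) = 0"
    and "\<And>i. i > n \<Longrightarrow> coeff q i = 0"
  shows "mfun \<mu> (opoly \<mu> n * q) = coeff q n * sqnorm \<mu> n"
proof -
  let ?r = "q - smult (coeff q n) (opoly \<mu> n)"
  have "\<forall>i\<ge>n. coeff ?r i = 0" using assms(2)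
    by (auto simp: le_less coeff_opoly_gt)
  then have "mfun \<mu> (opoly \<mu> n * ?r) = 0" by (rule assms(1))
  then show ?thesis by (simp add: right_diff_distrib mfun_diff mfun_smult sqnorm_def)
qed

text \<open>Strong induction along the recurrence. A test polynomial splits into a multiple of the
  previous orthogonal polynomial, annihilated by the choice of \<open>jac_b\<close>, and a remainder
  of lower degree, annihilated by the choice of \<open>jac_a\<close>.\<close>

lemma opoly_orthogonal:
  assumes "\<And>j. j < n \<Longrightarrow> sqnorm \<mu> j \<noteq> 0" and "\<forall>i\<ge>n. coeff p i = 0"
  shows "mfun \<mu> (opoly \<mu> n * p) = 0"
  using assms
proof (induction n arbitrary: p rule: less_induct)
  case (less n)
  show ?case
  proof (cases n)
    case 0
    then have "p = 0" using less.prems by (simp add: poly_eq_iff)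
    then show ?thesis by simp
  next
    case (Suc m)
    have O: "mfun \<mu> (opoly \<mu> j * q) = 0" if "j \<le> m" "\<forall>i\<ge>j. coeff q i = 0" for j q
      using less.IH[of j q] less.prems that Suc by auto
    have T: "mfun \<mu> (opoly \<mu> j * q) = coeff q j * sqnorm \<mu> j" if "j \<le> m" "\<And>i. i > j \<Longrightarrow> coeff q i = 0" for j q
      using mfun_opoly_top_aux[of j \<mu> q] O that by blast
    have E: "mfun \<mu> (opoly \<mu> (Suc m) * q) = mfun \<mu> (opoly \<mu> m * pCons 0 q) - jac_b \<mu> m * mfun \<mu> (opoly \<mu> m * q)
         - jac_a \<mu> m * mfun \<mu> (opoly \<mu> (m - 1) * q)" for q
      unfolding opoly_Suc by (simp add: left_diff_distrib mfun_diff mfun_smult)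
    let ?c = "coeff p m"
    define r where "r = p - smult ?c (opoly \<mu> m)"
    have r0: "\<forall>i\<ge>m. coeff r i = 0"
    proof (intro allI impI)
      fix i assume "m \<le> i"
      show "coeff r i = 0"
      proof (cases "i = m")
        case False
        then show ?thesis using less.prems(2) Suc \<open>m \<le> i\<close> by (simp add: r_def coeff_opoly_gt)
      qed (simp add: r_def)
    qed
    have hm: "sqnorm \<mu> m \<noteq> 0" using less.prems Suc by auto
    have 1: "mfun \<mu> (opoly \<mu> (Suc m) * opoly \<mu> m) = 0"
    proof -
      have "mfun \<mu> (opoly \<mu> m * pCons 0 (opoly \<mu> m)) = jac_b \<mu> m * sqnorm \<mu> m"
        using hm by (simp add: jac_b_def)
      moreover have "jac_a \<mu> m * mfun \<mu> (opoly \<mu> (m - 1) * opoly \<mu> m) = 0"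
      proof (cases m)
        case 0 then show ?thesis by (simp add: jac_a_def)
      next
        case (Suc k)
        have "mfun \<mu> (opoly \<mu> m * opoly \<mu> k) = 0" by (rule O) (auto simp: Suc coeff_opoly_gt)
        then show ?thesis by (simp add: Suc mult.commute)
      qed
      ultimately show ?thesis unfolding E by (simp add: sqnorm_def)
    qed
    \<comment> \<open>For m = Suc k only the coefficient of degree k of r survives: x r pairs with
      polynomial m, r pairs with polynomial k, and \<open>jac_a\<close> is the quotient of the two
      norms.\<close>
    have 2: "mfun \<mu> (opoly \<mu> (Suc m) * r) = 0"
    proof (cases m)
      case 0
      then have "r = 0" using r0 by (simp add: poly_eq_iff)
      then show ?thesis by simp
    next
      case (Suc k)
      have "mfun \<mu> (opoly \<mu> m * pCons 0 r) = coeff r k * sqnorm \<mu> m"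
        using T[of m "pCons 0 r"] r0 Suc by (auto simp: coeff_pCons split: nat.splits)
      moreover have "mfun \<mu> (opoly \<mu> m * r) = 0" using r0 by (intro O) auto
      moreover have "mfun \<mu> (opoly \<mu> (m - 1) * r) = coeff r k * sqnorm \<mu> k"
        using T[of k r] r0 Suc by auto
      moreover have "sqnorm \<mu> k \<noteq> 0" using less.prems Suc \<open>n = Suc m\<close> by auto
      ultimately show ?thesis unfolding E by (simp add: jac_a_def Suc)
    qed
    have "p = r + smult ?c (opoly \<mu> m)" by (simp add: r_def)
    then have "mfun \<mu> (opoly \<mu> n * p) = mfun \<mu> (opoly \<mu> n * r) + ?c * mfun \<mu> (opoly \<mu> n * opoly \<mu> m)"
      by (metis distrib_left mfun_add mfun_smult mult_smult_right)
    with 1 2 Suc show ?thesis by simp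
  qed
qed

lemma mfun_opoly_top:
  assumes "\<And>j. j < n \<Longrightarrow> sqnorm \<mu> j \<noteq> 0" and "\<And>i. i > n \<Longrightarrow> coeff q i = 0"
  shows "mfun \<mu> (opoly \<mu> n * q) = coeff q n * sqnorm \<mu> n"
  by (rule mfun_opoly_top_aux) (use assms opoly_orthogonal in blast)+

text \<open>The trace of the truncated Jacobi matrix, equivalently minus the coefficient just below
  the leading one. For the delay weight it is the logarithmic derivative of the partition
  function.\<close>

definition sub_coeff :: "(nat \<Rightarrow> real) \<Rightarrow> nat \<Rightarrow> real" where
  "sub_coeff \<mu> n = (\<Sum>j<n. jac_b \<mu> j)"

lemma coeff_opoly_subleading: "coeff (opoly \<mu> (Suc n)) n = - sub_coeff \<mu> (Suc n)"
proof (induction n)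
  case 0 show ?case unfolding opoly_Suc by (simp add: sub_coeff_def jac_a_def)
next
  case (Suc n)
  show ?case unfolding opoly_Suc[of _ "Suc n"]
    using Suc by (simp add: sub_coeff_def coeff_opoly_gt)
qed

text \<open>The hypothesis is the case of a monomial. It expresses that the integral of (x^2 w p)'
  vanishes for a weight with (x^2 w)' = ((2 - b) x + 1 + z x^2) w; linearity does the rest.\<close>

lemma mfun_pearson:
  assumes "\<And>m. (real m + 2 - b) * \<mu> (m + 1) + \<mu> m + z * \<mu> (m + 2) = 0"
  shows "mfun \<mu> (pCons 0 (pCons 0 (pderiv p))) + (2 - b) * mfun \<mu> (pCons 0 p) + mfun \<mu> p
           + z * mfun \<mu> (pCons 0 (pCons 0 p)) = 0"
proof -
  let ?n = "degree p"
  have c: "coeff (pCons 0 (pderiv p)) i = real i * coeff p i" for i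
    by (cases i) (auto simp: coeff_pderiv)
  have s: "mfun \<mu> (pCons 0 q) = (\<Sum>i\<le>n. coeff q i * \<mu> (i + 1))" if "\<And>i. i > n \<Longrightarrow> coeff q i = 0" for q n and \<mu> :: "nat \<Rightarrow> real"
  proof -
    have "mfun \<mu> (pCons 0 q) = (\<Sum>i\<le>Suc n. coeff (pCons 0 q) i * \<mu> i)"
      by (rule mfun_altdef) (use that in \<open>auto simp: coeff_pCons split: nat.splits\<close>)
    then show ?thesis by (simp add: sum.atMost_Suc_shift del: sum.atMost_Suc)
  qed
  have 1: "mfun \<mu> (pCons 0 (pCons 0 (pderiv p))) = (\<Sum>i\<le>?n. real i * coeff p i * \<mu> (i + 1))"
    by (subst s[where n = ?n]) (auto simp: c coeff_eq_0)
  have 2: "mfun \<mu> (pCons 0 p) = (\<Sum>i\<le>?n. coeff p i * \<mu> (i + 1))"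
    by (rule s) (auto simp: coeff_eq_0)
  have 3: "mfun \<mu> (pCons 0 (pCons 0 p)) = (\<Sum>i\<le>?n. coeff p i * \<mu> (i + 2))"
  proof -
    have "mfun \<mu> (pCons 0 (pCons 0 p)) = (\<Sum>i\<le>Suc ?n. coeff (pCons 0 p) i * \<mu> (i + 1))"
      by (rule s) (auto simp: coeff_eq_0 coeff_pCons split: nat.splits)
    then show ?thesis by (simp add: sum.atMost_Suc_shift del: sum.atMost_Suc)
  qed
  have "mfun \<mu> (pCons 0 (pCons 0 (pderiv p))) + (2 - b) * mfun \<mu> (pCons 0 p) + mfun \<mu> p
           + z * mfun \<mu> (pCons 0 (pCons 0 p))
      = (\<Sum>i\<le>?n. coeff p i * ((real i + 2 - b) * \<mu> (i + 1) + \<mu> i + z * \<mu> (i + 2)))"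
    unfolding 1 2 3 unfolding mfun_def sum_distrib_left sum.distrib[symmetric]
    by (intro sum.cong) (auto simp: algebra_simps)
  then show ?thesis by (simp only: assms) simp
qed

lemma mfun_opoly_shift2:
  assumes "\<And>j. j \<le> Suc n \<Longrightarrow> sqnorm \<mu> j \<noteq> 0"
  shows "mfun \<mu> (pCons 0 (pCons 0 (opoly \<mu> n * opoly \<mu> n)))
    = (jac_a \<mu> (Suc n) + (jac_b \<mu> n)\<^sup>2 + jac_a \<mu> n) * sqnorm \<mu> n"
proof -
  let ?P = "opoly \<mu> (Suc n)" and ?Q = "opoly \<mu> n" and ?R = "opoly \<mu> (n - 1)"
  let ?a = "jac_a \<mu> n" and ?b = "jac_b \<mu> n"
  have e: "pCons 0 ?Q = ?P + smult ?b ?Q + smult ?a ?R"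
    using opoly_Suc[of \<mu> n] by (simp add: algebra_simps)
  have "pCons 0 (pCons 0 (?Q * ?Q)) = pCons 0 ?Q * pCons 0 ?Q" by simp
  also have "mfun \<mu> (pCons 0 ?Q * pCons 0 ?Q)
      = mfun \<mu> (?P * pCons 0 ?Q) + ?b * mfun \<mu> (?Q * pCons 0 ?Q) + ?a * mfun \<mu> (?R * pCons 0 ?Q)"
    using arg_cong[OF e, of "\<lambda>t. mfun \<mu> (t * pCons 0 ?Q)"]
    by (simp only: distrib_right mfun_add mfun_smult mult_smult_left)
  also have "mfun \<mu> (?P * pCons 0 ?Q) = sqnorm \<mu> (Suc n)"
    using mfun_opoly_top[of "Suc n" \<mu> "pCons 0 ?Q"] assms
    by (auto simp: coeff_pCons coeff_opoly_gt split: nat.splits)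
  also have "mfun \<mu> (?Q * pCons 0 ?Q) = ?b * sqnorm \<mu> n"
    using assms[of n] by (simp add: jac_b_def)
  also have "?a * mfun \<mu> (?R * pCons 0 ?Q) = ?a * sqnorm \<mu> n"
  proof (cases n)
    case 0 then show ?thesis by (simp add: jac_a_def)
  next
    case (Suc k)
    have "mfun \<mu> (?Q * pCons 0 ?R) = sqnorm \<mu> n"
      using mfun_opoly_top[of n \<mu> "pCons 0 ?R"] assms Suc
      by (auto simp: coeff_pCons coeff_opoly_gt split: nat.splits)
    then show ?thesis by (simp add: mult.commute)
  qed
  finally show ?thesis using assms[of n] by (simp add: jac_a_def power2_eq_square algebra_simps)
qed

text \<open>The Pearson relation for the square of \<open>opoly \<mu> n\<close>: every term turns
  out to be a multiple of the norm, which is then cancelled.\<close>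

lemma string_equation:
  assumes "\<And>m. (real m + 2 - b) * \<mu> (m + 1) + \<mu> m + z * \<mu> (m + 2) = 0"
    and nz: "\<And>j. sqnorm \<mu> j \<noteq> 0"
  shows "2 * (real n * jac_b \<mu> n + sub_coeff \<mu> n) + 1 + (2 - b) * jac_b \<mu> n
    + z * (jac_a \<mu> (Suc n) + (jac_b \<mu> n)\<^sup>2 + jac_a \<mu> n) = 0"
proof -
  let ?Q = "opoly \<mu> n"
  \<comment> \<open>x^2 P' has degree n + 1; subtracting n x P leaves degree n, with top coefficient
    minus the subleading coefficient of P, that is \<open>sub_coeff\<close>.\<close>
  let ?S = "pCons 0 (pCons 0 (pderiv ?Q)) - smult (real n) (pCons 0 ?Q)"
  have cS: "coeff ?S i = (if i = 0 then 0 else (real i - 1 - real n) * coeff ?Q (i - 1))" for i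
    by (cases i; cases "i - 1") (auto simp: coeff_pderiv algebra_simps)
  have "mfun \<mu> (?Q * ?S) = coeff ?S n * sqnorm \<mu> n"
  proof (rule mfun_opoly_top)
    show "coeff ?S i = 0" if "i > n" for i
    proof (cases "i = Suc n")
      case False
      then have "coeff ?Q (i - 1) = 0" using that by (intro coeff_opoly_gt) simp
      then show ?thesis by (simp only: cS) simp
    qed (simp only: cS, simp)
  qed (rule nz)
  also have "coeff ?S n = sub_coeff \<mu> n"
    unfolding cS by (cases n) (simp_all add: coeff_opoly_subleading, simp add: sub_coeff_def)
  finally have 1: "mfun \<mu> (?Q * pCons 0 (pCons 0 (pderiv ?Q))) = (real n * jac_b \<mu> n + sub_coeff \<mu> n) * sqnorm \<mu> n"
  proof -
    assume *: "mfun \<mu> (?Q * ?S) = sub_coeff \<mu> n * sqnorm \<mu> n"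
    have "?Q * ?S = ?Q * pCons 0 (pCons 0 (pderiv ?Q)) - smult (real n) (pCons 0 (?Q * ?Q))"
      by (simp only: right_diff_distrib mult_smult_right mult_pCons_right) simp
    then have "mfun \<mu> (?Q * ?S) = mfun \<mu> (?Q * pCons 0 (pCons 0 (pderiv ?Q))) - real n * mfun \<mu> (pCons 0 (?Q * ?Q))"
      by (simp only: mfun_diff mfun_smult)
    with * show ?thesis using nz[of n] by (simp add: jac_b_def algebra_simps)
  qed
  have "pCons 0 (pCons 0 (pderiv (?Q * ?Q))) = smult 2 (?Q * pCons 0 (pCons 0 (pderiv ?Q)))"
  proof -
    have "smult 2 p = 2 * p" for p :: "real poly"
      by (metis mult_2 one_add_one smult_1_left smult_add_left)
    then show ?thesis by (simp add: pderiv_mult mult.commute)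
  qed
  then have 2: "mfun \<mu> (pCons 0 (pCons 0 (pderiv (?Q * ?Q)))) = 2 * (real n * jac_b \<mu> n + sub_coeff \<mu> n) * sqnorm \<mu> n"
    using 1 by (simp only: mfun_smult)
  have 3: "mfun \<mu> (pCons 0 (?Q * ?Q)) = jac_b \<mu> n * sqnorm \<mu> n" using nz[of n] by (simp add: jac_b_def)
  have 4: "mfun \<mu> (?Q * ?Q) = sqnorm \<mu> n" by (simp add: sqnorm_def)
  have "(2 * (real n * jac_b \<mu> n + sub_coeff \<mu> n) + 1 + (2 - b) * jac_b \<mu> n
    + z * (jac_a \<mu> (Suc n) + (jac_b \<mu> n)\<^sup>2 + jac_a \<mu> n)) * sqnorm \<mu> n = 0"
    using mfun_pearson[OF assms(1), of "?Q * ?Q"]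
    unfolding 2 3 4 mfun_opoly_shift2[OF nz] by (simp add: algebra_simps)
  then show ?thesis using nz by simp
qed

section \<open>Toda lattice\<close>

definition has_coeff_deriv :: "(real \<Rightarrow> real poly) \<Rightarrow> real poly \<Rightarrow> real \<Rightarrow> bool" where
  "has_coeff_deriv P P' z \<longleftrightarrow> (\<forall>i. ((\<lambda>z. coeff (P z) i) has_real_derivative coeff P' i) (at z))"

lemma has_coeff_deriv_const: "has_coeff_deriv (\<lambda>_. p) 0 z"
  by (simp add: has_coeff_deriv_def)

lemma has_coeff_deriv_diff:
  "has_coeff_deriv P P' z \<Longrightarrow> has_coeff_deriv Q Q' z \<Longrightarrow> has_coeff_deriv (\<lambda>z. P z - Q z) (P' - Q') z"
  by (auto simp: has_coeff_deriv_def intro!: DERIV_diff)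

lemma has_coeff_deriv_pCons:
  "has_coeff_deriv P P' z \<Longrightarrow> has_coeff_deriv (\<lambda>z. pCons 0 (P z)) (pCons 0 P') z"
  by (auto simp: has_coeff_deriv_def coeff_pCons split: nat.splits)

lemma has_coeff_deriv_smult:
  "(c has_real_derivative c') (at z) \<Longrightarrow> has_coeff_deriv P P' z
    \<Longrightarrow> has_coeff_deriv (\<lambda>z. smult (c z) (P z)) (smult c' (P z) + smult (c z) P') z"
  by (auto simp: has_coeff_deriv_def intro!: derivative_eq_intros)

lemma has_coeff_deriv_mult:
  assumes "has_coeff_deriv P P' z" "has_coeff_deriv Q Q' z"
  shows "has_coeff_deriv (\<lambda>z. P z * Q z) (P' * Q z + P z * Q') z"
  unfolding has_coeff_deriv_def coeff_mult coeff_add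
proof
  fix n
  have "((\<lambda>z. coeff (P z) i * coeff (Q z) (n - i)) has_real_derivative
      coeff P' i * coeff (Q z) (n - i) + coeff (P z) i * coeff Q' (n - i)) (at z)" for i
    using assms unfolding has_coeff_deriv_def
    by (auto intro!: derivative_eq_intros)
  then show "((\<lambda>z. \<Sum>i\<le>n. coeff (P z) i * coeff (Q z) (n - i)) has_real_derivative
    (\<Sum>i\<le>n. coeff P' i * coeff (Q z) (n - i)) + (\<Sum>i\<le>n. coeff (P z) i * coeff Q' (n - i))) (at z)"
    unfolding sum.distrib[symmetric] by (intro DERIV_sum) auto
qed

lemma has_coeff_deriv_eq_0:
  assumes "has_coeff_deriv P P' z" "\<And>z. coeff (P z) i = c"
  shows "coeff P' i = 0"
proof -
  have "((\<lambda>z. c) has_real_derivative coeff P' i) (at z)"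
    using assms unfolding has_coeff_deriv_def by (metis (no_types, lifting) ext)
  then show ?thesis using DERIV_const DERIV_unique by blast
qed

text \<open>Differentiating exp (z x) produces a factor x, hence the shift of the moment
  index.\<close>

locale toda_moments =
  fixes \<mu> :: "real \<Rightarrow> nat \<Rightarrow> real"
  assumes deriv_moment: "z < 0 \<Longrightarrow> ((\<lambda>z. \<mu> z m) has_real_derivative \<mu> z (Suc m)) (at z)"
    and sqnorm_nonzero: "z < 0 \<Longrightarrow> sqnorm (\<mu> z) n \<noteq> 0"
begin

lemma deriv_mfun:
  assumes "z < 0" "has_coeff_deriv P P' z" "\<And>z i. i > d \<Longrightarrow> coeff (P z) i = 0"
  shows "((\<lambda>z. mfun (\<mu> z) (P z)) has_real_derivative mfun (\<mu> z) (pCons 0 (P z)) + mfun (\<mu> z) P') (at z)"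
proof -
  have 1: "mfun (\<mu> y) (P y) = (\<Sum>i\<le>d. coeff (P y) i * \<mu> y i)" for y
    by (rule mfun_altdef) (rule assms)
  have 2: "mfun (\<mu> z) P' = (\<Sum>i\<le>d. coeff P' i * \<mu> z i)"
    by (rule mfun_altdef) (use has_coeff_deriv_eq_0[OF assms(2)] assms(3) in blast)
  have "mfun (\<mu> z) (pCons 0 (P z)) = (\<Sum>i\<le>Suc d. coeff (pCons 0 (P z)) i * \<mu> z i)"
    by (rule mfun_altdef) (use assms(3) in \<open>auto simp: coeff_pCons split: nat.splits\<close>)
  then have 3: "mfun (\<mu> z) (pCons 0 (P z)) = (\<Sum>i\<le>d. coeff (P z) i * \<mu> z (Suc i))"
    by (simp add: sum.atMost_Suc_shift del: sum.atMost_Suc)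
  have "((\<lambda>y. \<Sum>i\<le>d. coeff (P y) i * \<mu> y i) has_real_derivative
     (\<Sum>i\<le>d. coeff (P z) i * \<mu> z (Suc i) + coeff P' i * \<mu> z i)) (at z)"
    using assms(2) deriv_moment[OF assms(1)] unfolding has_coeff_deriv_def
    by (auto intro!: derivative_eq_intros sum.cong simp: algebra_simps)
  then show ?thesis unfolding 1 2 3 by (simp add: sum.distrib)
qed

lemma coeff_opoly_mult_gt: "i > n + n \<Longrightarrow> coeff (opoly (\<mu> z) n * opoly (\<mu> z) n) i = 0"
  by (rule coeff_eq_0) (simp add: degree_mult_eq opoly_nonzero)

text \<open>Only existence is recorded: monicity forces the derivative to have lower degree, so
  orthogonality removes it from the formulas below or leaves just its top coefficient.\<close>

lemma ex_deriv_opoly: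
  assumes "z < 0"
  shows "\<exists>P'. has_coeff_deriv (\<lambda>z. opoly (\<mu> z) n) P' z"
proof (induction n rule: less_induct)
  case (less n)
  show ?case
  proof (cases n)
    case 0 then show ?thesis using has_coeff_deriv_const by auto
  next
    case (Suc m)
    have sq: "\<exists>D. ((\<lambda>z. sqnorm (\<mu> z) k) has_real_derivative D) (at z)" if "k \<le> m" for k
    proof -
      obtain P' where "has_coeff_deriv (\<lambda>z. opoly (\<mu> z) k) P' z" using less[of k] Suc \<open>k \<le> m\<close> by auto
      from deriv_mfun[where d = "k + k", OF assms has_coeff_deriv_mult[OF this this] coeff_opoly_mult_gt]
      show ?thesis unfolding sqnorm_def by blast
    qed
    obtain P' where P': "has_coeff_deriv (\<lambda>z. opoly (\<mu> z) m) P' z" using less[of m] Suc by auto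
    obtain R' where R': "has_coeff_deriv (\<lambda>z. opoly (\<mu> z) (m - 1)) R' z" using less[of "m - 1"] Suc by (metis diff_le_self le_imp_less_Suc)
    have "\<exists>D. ((\<lambda>z. mfun (\<mu> z) (pCons 0 (opoly (\<mu> z) m * opoly (\<mu> z) m))) has_real_derivative D) (at z)"
    proof -
      have "coeff (pCons 0 (opoly (\<mu> z) m * opoly (\<mu> z) m)) i = 0" if "i > Suc (m + m)" for z i
        using that coeff_opoly_mult_gt by (auto simp: coeff_pCons split: nat.splits)
      from deriv_mfun[OF assms has_coeff_deriv_pCons[OF has_coeff_deriv_mult[OF P' P']] this]
      show ?thesis by blast
    qed
    then have b: "\<exists>D. ((\<lambda>z. jac_b (\<mu> z) m) has_real_derivative D) (at z)"
      unfolding jac_b_def using sq[of m] sqnorm_nonzero[OF assms, of m] DERIV_divide by blast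
    have a: "\<exists>D. ((\<lambda>z. jac_a (\<mu> z) m) has_real_derivative D) (at z)"
    proof (cases "m = 0")
      case True then show ?thesis by (auto simp: jac_a_def intro!: exI[of _ 0])
    next
      case False
      then show ?thesis
        unfolding jac_a_def using sq[of m] sq[of "m - 1"] sqnorm_nonzero[OF assms, of "m - 1"]
          DERIV_divide by simp blast
    qed
    from a b obtain a' b' where a': "((\<lambda>z. jac_a (\<mu> z) m) has_real_derivative a') (at z)"
      and b': "((\<lambda>z. jac_b (\<mu> z) m) has_real_derivative b') (at z)" by blast
    show ?thesis unfolding Suc opoly_Suc
      using has_coeff_deriv_diff[OF has_coeff_deriv_diff[OF has_coeff_deriv_pCons[OF P']
        has_coeff_deriv_smult[OF b' P']] has_coeff_deriv_smult[OF a' R']] by blast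
  qed
qed

lemma deriv_opoly_coeff_ge:
  assumes "has_coeff_deriv (\<lambda>z. opoly (\<mu> z) n) P' z" "i \<ge> n"
  shows "coeff P' i = 0"
  using assms(2) by (cases "i = n") (auto intro!: has_coeff_deriv_eq_0[OF assms(1)] coeff_opoly_gt)

text \<open>The derivative of the polynomial has degree below n and is orthogonal to it, so only the
  factor x coming from the moments contributes.\<close>

theorem deriv_sqnorm:
  assumes "z < 0"
  shows "((\<lambda>z. sqnorm (\<mu> z) n) has_real_derivative jac_b (\<mu> z) n * sqnorm (\<mu> z) n) (at z)"
proof -
  obtain P' where P': "has_coeff_deriv (\<lambda>z. opoly (\<mu> z) n) P' z" using ex_deriv_opoly[OF assms] by blast
  have "mfun (\<mu> z) (opoly (\<mu> z) n * P') = 0"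
    by (rule opoly_orthogonal) (use sqnorm_nonzero[OF assms] deriv_opoly_coeff_ge[OF P'] in auto)
  then have "mfun (\<mu> z) (P' * opoly (\<mu> z) n + opoly (\<mu> z) n * P') = 0"
    by (simp only: mfun_add mult.commute[of P'])
  moreover have "mfun (\<mu> z) (pCons 0 (opoly (\<mu> z) n * opoly (\<mu> z) n)) = jac_b (\<mu> z) n * sqnorm (\<mu> z) n"
    using sqnorm_nonzero[OF assms] by (simp add: jac_b_def)
  ultimately show ?thesis
    using deriv_mfun[where d = "n + n", OF assms has_coeff_deriv_mult[OF P' P'] coeff_opoly_mult_gt]
    unfolding sqnorm_def by simp
qed

text \<open>Differentiate the orthogonality of two consecutive polynomials. The shift of the moments
  gives the norm of index n, and the derivative of the larger polynomial gives its coefficient of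
  degree n - 1 times the norm of index n - 1.\<close>

theorem deriv_sub_coeff:
  assumes "z < 0"
  shows "((\<lambda>z. sub_coeff (\<mu> z) n) has_real_derivative jac_a (\<mu> z) n) (at z)"
proof (cases n)
  case 0 then show ?thesis by (simp add: sub_coeff_def jac_a_def)
next
  case (Suc m)
  obtain P' where P': "has_coeff_deriv (\<lambda>z. opoly (\<mu> z) n) P' z" using ex_deriv_opoly[OF assms] by blast
  obtain R' where R': "has_coeff_deriv (\<lambda>z. opoly (\<mu> z) m) R' z" using ex_deriv_opoly[OF assms] by blast
  note nz = sqnorm_nonzero[OF assms]
  let ?P = "opoly (\<mu> z) n" and ?R = "opoly (\<mu> z) m"
  have P'0: "coeff P' i = 0" if "i \<ge> n" for i using deriv_opoly_coeff_ge[OF P' that] .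
  have R'0: "coeff R' i = 0" if "i \<ge> m" for i using deriv_opoly_coeff_ge[OF R' that] .
  have "coeff (opoly (\<mu> z) n * opoly (\<mu> z) m) i = 0" if "i > n + m" for z i
    using that by (intro coeff_eq_0) (simp add: degree_mult_eq opoly_nonzero)
  note D = deriv_mfun[OF assms has_coeff_deriv_mult[OF P' R'] this]
  have z: "mfun (\<mu> y) (opoly (\<mu> y) n * opoly (\<mu> y) m) = 0" if "y < 0" for y
    by (rule opoly_orthogonal) (use sqnorm_nonzero[OF that] Suc in \<open>auto simp: coeff_opoly_gt\<close>)
  have "((\<lambda>z. mfun (\<mu> z) (opoly (\<mu> z) n * opoly (\<mu> z) m)) has_real_derivative 0) (at z)"
    by (rule DERIV_cong_ev[THEN iffD2, OF refl _ refl DERIV_const[of 0]])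
       (use assms z in \<open>auto intro!: eventually_nhds_in_open[of "{..<0}", THEN eventually_mono]\<close>)
  from DERIV_unique[OF D this]
  have e: "mfun (\<mu> z) (pCons 0 (?P * ?R)) + (mfun (\<mu> z) (P' * ?R) + mfun (\<mu> z) (?P * R')) = 0"
    by (simp add: mfun_add)
  have 1: "mfun (\<mu> z) (pCons 0 (?P * ?R)) = sqnorm (\<mu> z) n"
    using mfun_opoly_top[OF nz, of n "pCons 0 ?R"] Suc
    by (auto simp: coeff_pCons coeff_opoly_gt split: nat.splits)
  have 2: "mfun (\<mu> z) (?P * R') = 0"
    by (rule opoly_orthogonal[OF nz]) (use R'0 Suc in auto)
  have 3: "mfun (\<mu> z) (P' * ?R) = coeff P' m * sqnorm (\<mu> z) m"
    using mfun_opoly_top[OF nz, of m P'] P'0 Suc by (simp add: mult.commute)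
  have "coeff P' m = - jac_a (\<mu> z) n"
    using e nz[of m] unfolding 1 2 3 by (simp add: jac_a_def Suc field_simps)
  moreover have "((\<lambda>z. coeff (opoly (\<mu> z) n) m) has_real_derivative coeff P' m) (at z)"
    using P' by (simp add: has_coeff_deriv_def)
  then have "((\<lambda>z. - sub_coeff (\<mu> z) n) has_real_derivative coeff P' m) (at z)"
    by (simp add: Suc coeff_opoly_subleading)
  from DERIV_minus[OF this] have "((\<lambda>z. sub_coeff (\<mu> z) n) has_real_derivative - coeff P' m) (at z)" by simp
  ultimately show ?thesis by simp
qed

lemma jac_b_eq: "jac_b \<nu> n = sub_coeff \<nu> (Suc n) - sub_coeff \<nu> n"
  by (simp add: sub_coeff_def)

theorem deriv_jac_b:
  assumes "z < 0"
  shows "((\<lambda>z. jac_b (\<mu> z) n) has_real_derivative jac_a (\<mu> z) (Suc n) - jac_a (\<mu> z) n) (at z)"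
  unfolding jac_b_eq by (intro DERIV_diff deriv_sub_coeff assms)

theorem deriv_jac_a:
  assumes "z < 0"
  shows "((\<lambda>z. jac_a (\<mu> z) n) has_real_derivative
     jac_a (\<mu> z) n * (jac_b (\<mu> z) n - jac_b (\<mu> z) (n - 1))) (at z)"
proof (cases n)
  case 0 then show ?thesis by (simp add: jac_a_def)
next
  case (Suc m)
  show ?thesis unfolding jac_a_def using Suc sqnorm_nonzero[OF assms, of m]
    by (auto intro!: derivative_eq_intros deriv_sqnorm assms simp: field_simps)
qed

end

section \<open>Taylor expansions at the left of the origin\<close>

text \<open>Only the coefficients of \<open>A\<close> up to order \<open>r\<close> are constrained. Unlike a mere expansion with
  remainder \<open>o(z ^ r)\<close>, this notion may be differentiated.\<close>

primrec smooth_exp :: "nat \<Rightarrow> (real \<Rightarrow> real) \<Rightarrow> real fps \<Rightarrow> bool" where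
  "smooth_exp 0 f A \<longleftrightarrow> (f \<longlongrightarrow> fps_nth A 0) (at_left 0)"
| "smooth_exp (Suc r) f A \<longleftrightarrow> (f \<longlongrightarrow> fps_nth A 0) (at_left 0) \<and>
     (\<exists>g. (\<forall>z<0. (f has_real_derivative g z) (at z)) \<and> smooth_exp r g (fps_deriv A))"

lemma eventually_neg: "eventually (\<lambda>z::real. z < 0) (at_left 0)"
  by (simp add: eventually_at_filter)

lemma DERIV_cong_neg:
  fixes f g :: "real \<Rightarrow> real"
  assumes "\<And>z. z < 0 \<Longrightarrow> f z = g z" "z < 0"
  shows "(f has_real_derivative D) (at z) \<longleftrightarrow> (g has_real_derivative D) (at z)"
  by (rule DERIV_cong_ev)
     (use assms in \<open>auto intro!: eventually_nhds_in_open[of "{..<0}", THEN eventually_mono]\<close>)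

lemma smooth_exp_tendsto: "smooth_exp r f A \<Longrightarrow> (f \<longlongrightarrow> fps_nth A 0) (at_left 0)"
  by (cases r) auto

lemma smooth_exp_cong:
  assumes "smooth_exp r f A" "\<And>z. z < 0 \<Longrightarrow> f z = g z"
  shows "smooth_exp r g A"
proof -
  have "(f \<longlongrightarrow> l) (at_left 0) \<longleftrightarrow> (g \<longlongrightarrow> l) (at_left 0)" for l
    by (rule tendsto_cong) (use eventually_neg in eventually_elim, use assms in auto)
  moreover have "(f has_real_derivative D) (at z) \<longleftrightarrow> (g has_real_derivative D) (at z)" if "z < 0" for z D
    using DERIV_cong_neg[OF assms(2) that] .
  ultimately show ?thesis using assms(1) by (cases r) auto
qed

lemma smooth_exp_SucI:
  assumes "(f \<longlongrightarrow> fps_nth A 0) (at_left 0)" "\<And>z. z < 0 \<Longrightarrow> (f has_real_derivative g z) (at z)"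
    "smooth_exp r g (fps_deriv A)"
  shows "smooth_exp (Suc r) f A"
  using assms by auto

lemma smooth_exp_Suc_D: "smooth_exp (Suc r) f A \<Longrightarrow> smooth_exp r f A"
proof (induction r arbitrary: f A)
  case (Suc r)
  then obtain g where "\<forall>z<0. (f has_real_derivative g z) (at z)" "smooth_exp (Suc r) g (fps_deriv A)"
    by (auto simp del: smooth_exp.simps(2) simp add: smooth_exp.simps(2)[of "Suc r"])
  then show ?case
    using smooth_exp_tendsto[OF Suc.prems] Suc.IH[of g] by (metis smooth_exp_SucI)
qed auto

lemma smooth_exp_mono: "smooth_exp r f A \<Longrightarrow> s \<le> r \<Longrightarrow> smooth_exp s f A"
proof (induction r)
  case (Suc r)
  then show ?case using smooth_exp_Suc_D[of r f A] by (cases "s = Suc r") simp_all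
qed simp

lemma smooth_exp_deriv:
  assumes "smooth_exp (Suc r) f A" "\<And>z. z < 0 \<Longrightarrow> (f has_real_derivative g z) (at z)"
  shows "smooth_exp r g (fps_deriv A)"
proof -
  obtain h where h: "\<forall>z<0. (f has_real_derivative h z) (at z)" "smooth_exp r h (fps_deriv A)"
    using assms(1) by auto
  show ?thesis by (rule smooth_exp_cong[OF h(2)]) (use h(1) assms(2) in \<open>metis DERIV_unique\<close>)
qed

lemma smooth_exp_const: "smooth_exp r (\<lambda>_. c) (fps_const c)"
proof (induction r arbitrary: c)
  case (Suc r)
  then show ?case by (intro smooth_exp_SucI[where g = "\<lambda>_. 0"]) (auto simp: Suc[of 0, simplified])
qed auto

lemma smooth_exp_X: "smooth_exp r (\<lambda>z. z) fps_X"
proof (cases r)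
  case (Suc s)
  show ?thesis unfolding Suc
    by (rule smooth_exp_SucI[where g = "\<lambda>_. 1"]) (use smooth_exp_const[of s 1] in auto)
qed auto

lemma smooth_exp_add:
  "smooth_exp r f A \<Longrightarrow> smooth_exp r g B \<Longrightarrow> smooth_exp r (\<lambda>z. f z + g z) (A + B)"
proof (induction r arbitrary: f g A B)
  case 0 then show ?case by (auto intro: tendsto_add)
next
  case (Suc r)
  from Suc.prems obtain f' g' where
    "\<And>z. z < 0 \<Longrightarrow> (f has_real_derivative f' z) (at z)" "smooth_exp r f' (fps_deriv A)"
    "\<And>z. z < 0 \<Longrightarrow> (g has_real_derivative g' z) (at z)" "smooth_exp r g' (fps_deriv B)" by auto
  moreover from Suc.prems have "((\<lambda>z. f z + g z) \<longlongrightarrow> fps_nth (A + B) 0) (at_left 0)"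
    by (auto intro: tendsto_add)
  ultimately show ?case
    by (intro smooth_exp_SucI[where g = "\<lambda>z. f' z + g' z"]) (auto intro!: DERIV_add Suc.IH)
qed

lemma smooth_exp_mult:
  "smooth_exp r f A \<Longrightarrow> smooth_exp r g B \<Longrightarrow> smooth_exp r (\<lambda>z. f z * g z) (A * B)"
proof (induction r arbitrary: f g A B)
  case 0 then show ?case by (auto intro: tendsto_mult)
next
  case (Suc r)
  from Suc.prems obtain f' g' where
    d: "\<And>z. z < 0 \<Longrightarrow> (f has_real_derivative f' z) (at z)" "smooth_exp r f' (fps_deriv A)"
    "\<And>z. z < 0 \<Longrightarrow> (g has_real_derivative g' z) (at z)" "smooth_exp r g' (fps_deriv B)" by auto
  have "((\<lambda>z. f z * g z) \<longlongrightarrow> fps_nth (A * B) 0) (at_left 0)"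
    using Suc.prems by (auto intro: tendsto_mult)
  moreover have "smooth_exp r (\<lambda>z. f' z * g z + f z * g' z) (fps_deriv A * B + A * fps_deriv B)"
    using d Suc.prems[THEN smooth_exp_Suc_D] by (intro smooth_exp_add Suc.IH)
  ultimately show ?case
    by (intro smooth_exp_SucI[where g = "\<lambda>z. f' z * g z + f z * g' z"])
       (auto intro!: derivative_eq_intros d simp: algebra_simps)
qed

lemma smooth_exp_cmult: "smooth_exp r f A \<Longrightarrow> smooth_exp r (\<lambda>z. c * f z) (fps_const c * A)"
  by (intro smooth_exp_mult smooth_exp_const)

lemma smooth_exp_diff:
  assumes "smooth_exp r f A" "smooth_exp r g B"
  shows "smooth_exp r (\<lambda>z. f z - g z) (A - B)"
  using smooth_exp_add[OF assms(1) smooth_exp_cmult[OF assms(2), of "-1"]]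
  by (simp add: fps_const_neg[symmetric] del: fps_const_neg)

lemma smooth_exp_power: "smooth_exp r f A \<Longrightarrow> smooth_exp r (\<lambda>z. f z ^ n) (A ^ n)"
  by (induction n) (auto intro: smooth_exp_mult smooth_exp_const[of r 1, simplified] simp del: smooth_exp.simps)

lemma smooth_exp_inverse:
  "smooth_exp r f A \<Longrightarrow> (\<And>z. z < 0 \<Longrightarrow> f z \<noteq> 0) \<Longrightarrow> fps_nth A 0 \<noteq> 0
    \<Longrightarrow> smooth_exp r (\<lambda>z. inverse (f z)) (inverse A)"
proof (induction r)
  case 0 then show ?case by (auto intro: tendsto_inverse)
next
  case (Suc r)
  from Suc.prems obtain f' where
    d: "\<And>z. z < 0 \<Longrightarrow> (f has_real_derivative f' z) (at z)" "smooth_exp r f' (fps_deriv A)" by auto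
  have i: "smooth_exp r (\<lambda>z. inverse (f z)) (inverse A)"
    using Suc.IH[OF smooth_exp_Suc_D[OF Suc.prems(1)] Suc.prems(2,3)] .
  have "((\<lambda>z. inverse (f z)) \<longlongrightarrow> fps_nth (inverse A) 0) (at_left 0)"
    using Suc.prems by (auto intro: tendsto_inverse)
  moreover have "smooth_exp r (\<lambda>z. - 1 * (f' z * inverse (f z) ^ 2)) (fps_const (-1) * (fps_deriv A * inverse A ^ 2))"
    using d i by (intro smooth_exp_cmult smooth_exp_mult smooth_exp_power)
  moreover have "fps_const (-1) * (fps_deriv A * inverse A ^ 2) = fps_deriv (inverse A)"
    using Suc.prems(3) by (simp add: fps_inverse_deriv fps_const_neg[symmetric] del: fps_const_neg)
  ultimately show ?case using Suc.prems(2)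
    by (intro smooth_exp_SucI[where g = "\<lambda>z. - 1 * (f' z * inverse (f z) ^ 2)"])
       (auto intro!: derivative_eq_intros d simp: power2_eq_square)
qed

lemma smooth_exp_divide:
  assumes "smooth_exp r f A" "smooth_exp r g B" "\<And>z. z < 0 \<Longrightarrow> g z \<noteq> 0" "fps_nth B 0 \<noteq> 0"
  shows "smooth_exp r (\<lambda>z. f z / g z) (A * inverse B)"
  unfolding divide_inverse by (intro smooth_exp_mult smooth_exp_inverse assms)

lemma smooth_exp_ln:
  assumes "smooth_exp r f A" "\<And>z. z < 0 \<Longrightarrow> f z > 0" "fps_nth A 0 > 0"
  shows "smooth_exp r (\<lambda>z. ln (f z)) (fps_integral (fps_deriv A * inverse A) (ln (fps_nth A 0)))"
proof (cases r)
  case 0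
  then show ?thesis using assms by (auto intro!: tendsto_ln)
next
  case (Suc s)
  with assms(1) obtain f' where
    d: "\<And>z. z < 0 \<Longrightarrow> (f has_real_derivative f' z) (at z)" "smooth_exp s f' (fps_deriv A)" by auto
  have nz: "z < 0 \<Longrightarrow> f z \<noteq> 0" for z using assms(2)[of z] by auto
  have "smooth_exp s f A" using assms(1) Suc smooth_exp_Suc_D by blast
  with d assms(3) nz have "smooth_exp s (\<lambda>z. f' z / f z) (fps_deriv A * inverse A)"
    by (intro smooth_exp_divide) auto
  moreover have "((\<lambda>z. ln (f z)) \<longlongrightarrow> ln (fps_nth A 0)) (at_left 0)"
    using assms smooth_exp_tendsto[OF assms(1)] by (intro tendsto_ln) auto
  ultimately show ?thesis unfolding Suc using assms(2)
    by (intro smooth_exp_SucI[where g = "\<lambda>z. f' z / f z"])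
       (auto intro!: derivative_eq_intros d simp: fps_deriv_fps_integral field_simps)
qed

lemma smooth_exp_unique:
  "smooth_exp r f A \<Longrightarrow> smooth_exp r f B \<Longrightarrow> i \<le> r \<Longrightarrow> fps_nth A i = fps_nth B i"
proof (induction r arbitrary: f A B i)
  case 0
  then show ?case using tendsto_unique[of "at_left (0::real)"] by auto
next
  case (Suc r)
  show ?case
  proof (cases i)
    case 0
    then show ?thesis using Suc.prems(1,2)[THEN smooth_exp_tendsto] tendsto_unique[of "at_left (0::real)"] by auto
  next
    case (Suc j)
    obtain g where g: "\<And>z. z < 0 \<Longrightarrow> (f has_real_derivative g z) (at z)" using Suc.prems(1) by auto
    have "fps_nth (fps_deriv A) j = fps_nth (fps_deriv B) j"
      using Suc.prems Suc by (intro Suc.IH[of g] smooth_exp_deriv[of r f] g) auto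
    then show ?thesis using Suc by simp
  qed
qed

text \<open>Induction by l'Hopital: the derivative of the remainder is the remainder of the
  derivative, one order lower.\<close>

lemma smooth_exp_taylor:
  "smooth_exp r f A \<Longrightarrow> (\<lambda>z. f z - (\<Sum>i\<le>r. fps_nth A i * z ^ i)) \<in> o[at_left 0](\<lambda>z. z ^ r)"
proof (induction r arbitrary: f A)
  case 0
  then have "((\<lambda>z. f z - fps_nth A 0) \<longlongrightarrow> 0) (at_left 0)" using LIM_zero by auto
  then show ?case by (auto intro!: smalloI_tendsto)
next
  case (Suc r)
  obtain g where g: "\<And>z. z < 0 \<Longrightarrow> (f has_real_derivative g z) (at z)" using Suc.prems(1) by auto
  let ?F = "\<lambda>z. f z - (\<Sum>i\<le>Suc r. fps_nth A i * z ^ i)"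
  let ?G = "\<lambda>z. g z - (\<Sum>i\<le>r. fps_nth (fps_deriv A) i * z ^ i)"
  have "?G \<in> o[at_left 0](\<lambda>z. z ^ r)"
    by (rule Suc.IH[OF smooth_exp_deriv[OF Suc.prems g]])
  then have "((\<lambda>z. ?G z / z ^ r) \<longlongrightarrow> 0) (at_left 0)" by (rule smalloD_tendsto)
  then have "((\<lambda>z. inverse (real (Suc r)) * (?G z / z ^ r)) \<longlongrightarrow> inverse (real (Suc r)) * 0) (at_left 0)"
    by (intro tendsto_mult tendsto_const)
  then have lim: "((\<lambda>z. ?G z / (real (Suc r) * z ^ r)) \<longlongrightarrow> 0) (at_left 0)"
    by (simp add: divide_inverse mult_ac)
  have dF: "(?F has_real_derivative ?G z) (at z)" if "z < 0" for z
  proof -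
    have "((\<lambda>z. \<Sum>i\<le>Suc r. fps_nth A i * z ^ i) has_real_derivative
       (\<Sum>i\<le>Suc r. fps_nth A i * (real i * z ^ (i - 1)))) (at z)"
      by (intro DERIV_sum DERIV_cmult) (metis DERIV_pow One_nat_def)
    also have "(\<Sum>i\<le>Suc r. fps_nth A i * (real i * z ^ (i - 1))) = (\<Sum>i\<le>r. fps_nth (fps_deriv A) i * z ^ i)"
      by (simp add: sum.atMost_Suc_shift mult_ac del: sum.atMost_Suc)
    finally show ?thesis using g[OF that] by (intro DERIV_diff)
  qed
  have F0: "(?F \<longlongrightarrow> 0) (at_left 0)"
  proof -
    have "((\<lambda>z. \<Sum>i\<le>Suc r. fps_nth A i * z ^ i) \<longlongrightarrow> (\<Sum>i\<le>Suc r. fps_nth A i * 0 ^ i)) (at_left 0)"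
      by (intro tendsto_intros)
    also have "(\<Sum>i\<le>Suc r. fps_nth A i * 0 ^ i) = fps_nth A 0"
      by (simp add: sum.atMost_Suc_shift del: sum.atMost_Suc)
    finally show ?thesis using tendsto_diff[OF smooth_exp_tendsto[OF Suc.prems]] by fastforce
  qed
  have Z0: "((\<lambda>z. z ^ Suc r) \<longlongrightarrow> (0::real)) (at_left 0)"
    by (rule tendsto_eq_intros refl | simp)+
  have dZ: "((\<lambda>z. z ^ Suc r) has_real_derivative real (Suc r) * z ^ r) (at z)" for z :: real
    using DERIV_pow[of "Suc r" z UNIV] by simp
  have "((\<lambda>z. ?F z / z ^ Suc r) \<longlongrightarrow> 0) (at_left 0)"
  proof (rule lhopital_left[OF F0 Z0 _ _ _ _ lim])
    show "\<forall>\<^sub>F z in at_left 0. (z::real) ^ Suc r \<noteq> 0" "\<forall>\<^sub>F z in at_left 0. real (Suc r) * z ^ r \<noteq> 0"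
      by (rule eventually_mono[OF eventually_neg]; simp)+
    show "\<forall>\<^sub>F z in at_left 0. (?F has_real_derivative ?G z) (at z)"
      by (rule eventually_mono[OF eventually_neg]) (rule dF)
    show "\<forall>\<^sub>F z in at_left 0. ((\<lambda>z. z ^ Suc r) has_real_derivative real (Suc r) * z ^ r) (at z)"
      by (intro always_eventually allI dZ)
  qed
  then show ?case
    by (rule smalloI_tendsto) (rule eventually_mono[OF eventually_neg], simp)
qed

section \<open>Moments of the delay time weight\<close>

definition delay_kernel :: "nat \<Rightarrow> real \<Rightarrow> real \<Rightarrow> real" where
  "delay_kernel b z x = (if x > 0 then x powi (- int b) * exp (- 1 / x + z * x) else 0)"

text \<open>For \<open>z = 0\<close> and \<open>m + 2 > b\<close> the integral diverges and the moment has the junk value 0.\<close>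

definition delay_moment :: "nat \<Rightarrow> real \<Rightarrow> nat \<Rightarrow> real" where
  "delay_moment b z m = (\<integral>x. x ^ m * delay_kernel b z x \<partial>lborel)"

abbreviation moment_finite :: "nat \<Rightarrow> real \<Rightarrow> nat \<Rightarrow> bool" where
  "moment_finite b z m \<equiv> z < 0 \<or> z = 0 \<and> m + 2 \<le> b"

section \<open>Integrability and positivity of the moments\<close>

lemma power_le_fact_exp:
  assumes "(0::real) \<le> x" shows "x ^ n \<le> fact n * exp x"
proof -
  have "(\<Sum>k\<in>{n}. x ^ k /\<^sub>R fact k) \<le> (\<Sum>k. x ^ k /\<^sub>R fact k)"
    using assms by (intro sum_le_suminf summable_exp_generic) auto
  then have "x ^ n / fact n \<le> exp x" by (simp add: exp_def divide_inverse mult.commute)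
  then show ?thesis by (simp add: field_simps)
qed

lemma delay_kernel_nonneg [simp]: "0 \<le> delay_kernel b z x"
  by (simp add: delay_kernel_def)

lemma delay_kernel_pos: "x > 0 \<Longrightarrow> 0 < delay_kernel b z x"
  by (simp add: delay_kernel_def)

lemma delay_kernel_measurable [measurable]: "delay_kernel b z \<in> borel_measurable borel"
proof -
  have "delay_kernel b z = (\<lambda>x. if x > 0 then inverse (x ^ b) * exp (- 1 / x + z * x) else 0)"
    by (auto simp: delay_kernel_def power_int_minus)
  then show ?thesis by simp
qed

text \<open>One majorant serves twice: it gives integrability, and it controls the boundary terms
  when integrating by parts. Near 0 the factor exp (- 1 / x) beats the pole, by t^b \<le> b! exp t
  at t = 1 / x.\<close>

lemma delay_kernel_bound:
  assumes "moment_finite b z m"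
  shows "\<exists>C\<ge>0. \<forall>x. x ^ m * delay_kernel b z x \<le> C * (indicator {0<..} x * (1 / (1 + x\<^sup>2)))"
proof -
  \<comment> \<open>D bounds \<open>x ^ (m + 2) * delay_kernel b z x\<close> on x \<ge> 1: for z < 0
    through (- z x)^(m+2) \<le> (m+2)! exp (- z x), for z = 0 through m + 2 \<le> b. The factor 2
    below absorbs 1 + x^2, which is at most 2 for x \<le> 1 and at most 2 x^2 for x \<ge> 1.\<close>
  define D where "D = (if z = 0 then 1 else fact (m + 2) / (- z) ^ (m + 2) :: real)"
  have D0: "D \<ge> 0"
    unfolding D_def by (cases "z = 0") (use assms in \<open>auto intro!: divide_nonneg_nonneg zero_le_power simp del: power_Suc add_2_eq_Suc'\<close>)
  have z: "z \<le> 0" using assms by auto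
  show ?thesis
  proof (intro exI[of _ "2 * (fact b + D)"] conjI allI)
    show "2 * (fact b + D) \<ge> 0" using D0 by simp
    fix x :: real
    show "x ^ m * delay_kernel b z x \<le> 2 * (fact b + D) * (indicator {0<..} x * (1 / (1 + x\<^sup>2)))"
    proof (cases "x > 0")
      case True
      have k: "delay_kernel b z x = exp (- 1 / x) * exp (z * x) / x ^ b"
        using True by (simp add: delay_kernel_def power_int_minus mult_exp_exp divide_simps)
      have ez: "exp (z * x) \<le> 1" using True z by (simp add: mult_le_0_iff)
      have ei: "exp (- 1 / x) \<le> 1" using True by simp
      have "x ^ m * delay_kernel b z x * (1 + x\<^sup>2) \<le> 2 * (fact b + D)"
      proof (cases "x \<le> 1")
        case le: True
        have "(1 / x) ^ b \<le> fact b * exp (1 / x)" using True by (intro power_le_fact_exp) simp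
        then have "(1 / x) ^ b * exp (- (1 / x)) \<le> fact b * exp (1 / x) * exp (- (1 / x))"
          by (rule mult_right_mono) simp
        then have "exp (- 1 / x) / x ^ b \<le> fact b"
          by (simp add: mult_exp_exp power_one_over power_inverse divide_inverse mult.commute mult.left_commute)
        then have "exp (- 1 / x) / x ^ b * exp (z * x) \<le> fact b * 1"
          using ez by (intro mult_mono) auto
        then have "delay_kernel b z x \<le> fact b" unfolding k by (simp add: mult_ac)
        moreover have "x ^ m \<le> 1" using True le by (simp add: power_le_one)
        ultimately have "x ^ m * delay_kernel b z x \<le> 1 * fact b"
          using True by (intro mult_mono) auto
        moreover have "1 + x\<^sup>2 \<le> 2" using True le by (simp add: power_le_one)
        ultimately have "x ^ m * delay_kernel b z x * (1 + x\<^sup>2) \<le> (1 * fact b) * 2"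
          by (rule mult_mono) (use True in auto)
        then show ?thesis using D0 by simp
      next
        case False
        then have x1: "x \<ge> 1" by simp
        have "x ^ (m + 2) * delay_kernel b z x \<le> D"
        proof (cases "z = 0")
          case True
          then have "m + 2 \<le> b" using assms by auto
          then have "x ^ (m + 2) \<le> x ^ b" using x1 by (rule power_increasing)
          then have "x ^ (m + 2) / x ^ b \<le> 1" using x1 by simp
          then have "exp (- 1 / x) * (x ^ (m + 2) / x ^ b) \<le> 1 * 1"
            using ei x1 by (intro mult_mono) auto
          then show ?thesis unfolding k using True by (simp add: D_def mult_ac)
        next
          case False
          with z have "z < 0" by simp
          have "((- z) * x) ^ (m + 2) \<le> fact (m + 2) * exp ((- z) * x)"
            using \<open>z < 0\<close> x1 by (intro power_le_fact_exp) (simp add: mult_nonpos_nonneg)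
          then have "((- z) * x) ^ (m + 2) * exp (z * x) \<le> fact (m + 2) * exp ((- z) * x) * exp (z * x)"
            by (rule mult_right_mono) simp
          then have "(- z) ^ (m + 2) * (x ^ (m + 2) * exp (z * x)) \<le> fact (m + 2)"
            by (simp only: power_mult_distrib mult.assoc mult_exp_exp) simp
          moreover have "(- z) ^ (m + 2) > 0" using \<open>z < 0\<close> by (intro zero_less_power) simp
          ultimately have "x ^ (m + 2) * exp (z * x) \<le> fact (m + 2) / (- z) ^ (m + 2)"
            by (metis pos_le_divide_eq mult.commute)
          then have "x ^ (m + 2) * exp (z * x) \<le> D"
            using \<open>z < 0\<close> unfolding D_def by (simp only: if_False less_imp_neq)
          moreover have "exp (- 1 / x) / x ^ b \<le> 1"
          proof -
            have "exp (- 1 / x) \<le> x ^ b" using ei one_le_power[OF x1, of b] by linarith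
            then show ?thesis using x1 by (simp add: divide_le_eq)
          qed
          ultimately have "(x ^ (m + 2) * exp (z * x)) * (exp (- 1 / x) / x ^ b) \<le> D * 1"
            using x1 D0 by (intro mult_mono) auto
          then show ?thesis unfolding k by (simp add: mult_ac)
        qed
        moreover have "x ^ m * delay_kernel b z x * (1 + x\<^sup>2) \<le> x ^ m * delay_kernel b z x * (2 * x\<^sup>2)"
          using x1 by (intro mult_left_mono) (auto simp: one_le_power)
        moreover have "x ^ m * delay_kernel b z x * (2 * x\<^sup>2) = 2 * (x ^ (m + 2) * delay_kernel b z x)"
          by (simp add: power_add power2_eq_square)
        ultimately show ?thesis by (simp add: add_increasing)
      qed
      moreover have "1 + x\<^sup>2 > 0" by (simp add: add_pos_nonneg)
      ultimately show ?thesis using True by (simp add: pos_le_divide_eq)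
    qed (simp add: delay_kernel_def)
  qed
qed

lemma integrable_inverse_1_plus_square:
  "integrable lborel (\<lambda>x. indicator {0<..} x * (1 / (1 + x\<^sup>2)) :: real)"
proof -
  have "einterval 0 \<infinity> = {0::real<..}" by (auto simp: einterval_def)
  then show ?thesis using integrable_I0i_1_div_plus_square
    by (simp add: interval_lebesgue_integrable_def set_integrable_def)
qed

lemma integrable_delay_kernel:
  assumes "moment_finite b z m"
  shows "integrable lborel (\<lambda>x. x ^ m * delay_kernel b z x)"
proof -
  obtain C where "C \<ge> 0" and C: "\<And>x. x ^ m * delay_kernel b z x \<le> C * (indicator {0<..} x * (1 / (1 + x\<^sup>2)))"
    using delay_kernel_bound[OF assms] by blast
  have *: "norm (x ^ m * delay_kernel b z x) \<le> norm (C * (indicator {0<..} x * (1 / (1 + x\<^sup>2))))" for x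
  proof (cases "x > 0")
    case True
    then have "0 \<le> x ^ m * delay_kernel b z x" by simp
    then show ?thesis using C[of x] \<open>C \<ge> 0\<close> by (simp add: abs_mult)
  qed (simp add: delay_kernel_def)
  show ?thesis
    by (rule Bochner_Integration.integrable_bound[OF integrable_mult_right[OF integrable_inverse_1_plus_square, of C]])
       (use * in auto)
qed

lemma mfun_delay_moment:
  assumes "moment_finite b z (degree p)"
  shows "mfun (delay_moment b z) p = (\<integral>x. poly p x * delay_kernel b z x \<partial>lborel)"
    and "integrable lborel (\<lambda>x. poly p x * delay_kernel b z x)"
proof -
  have I: "integrable lborel (\<lambda>x. coeff p i * (x ^ i * delay_kernel b z x))" if "i \<le> degree p" for i
    using assms that by (intro integrable_mult_right integrable_delay_kernel) auto
  have e: "poly p x * delay_kernel b z x = (\<Sum>i\<le>degree p. coeff p i * (x ^ i * delay_kernel b z x))" for x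
    by (simp add: poly_altdef sum_distrib_right mult.assoc)
  show "integrable lborel (\<lambda>x. poly p x * delay_kernel b z x)"
    unfolding e by (intro Bochner_Integration.integrable_sum I) simp
  show "mfun (delay_moment b z) p = (\<integral>x. poly p x * delay_kernel b z x \<partial>lborel)"
    unfolding e mfun_def delay_moment_def by (subst Bochner_Integration.integral_sum) (use I in auto)
qed

text \<open>If the integral vanished, the nonnegative integrand would be zero almost everywhere; as
  the kernel is positive and p has finitely many roots, the interval (0, 1) would be a null
  set.\<close>

lemma mfun_delay_moment_square_pos:
  assumes "moment_finite b z (2 * degree p)" "p \<noteq> 0"
  shows "0 < mfun (delay_moment b z) (p * p)"
proof -
  have d: "moment_finite b z (degree (p * p))" using assms by (simp add: degree_mult_eq mult_2)
  note m = mfun_delay_moment[OF d]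
  have "(\<integral>x. poly (p * p) x * delay_kernel b z x \<partial>lborel) \<noteq> 0"
  proof
    assume "(\<integral>x. poly (p * p) x * delay_kernel b z x \<partial>lborel) = 0"
    then have "AE x in lborel. poly (p * p) x * delay_kernel b z x = 0"
      using m(2) by (subst (asm) integral_nonneg_eq_0_iff_AE) auto
    moreover have "AE x in lborel. x \<notin> {x. poly p x = 0}"
      by (intro AE_not_in finite_imp_null_set_lborel poly_roots_finite assms)
    ultimately have "AE x in lborel. x \<notin> {0<..<1::real}"
      by eventually_elim (use delay_kernel_pos[of _ b z] in force)
    then have "{0<..<1::real} \<in> null_sets lborel"
      by (subst (asm) AE_iff_null_sets[symmetric]) auto
    then show False by auto
  qed
  moreover have "(\<integral>x. poly (p * p) x * delay_kernel b z x \<partial>lborel) \<ge> 0"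
    by (intro Bochner_Integration.integral_nonneg) simp
  ultimately show ?thesis unfolding m(1) by linarith
qed

text \<open>For z < 0 the integrand is dominated by the one at z = 0, which is integrable in the
  stated range.\<close>

lemma delay_moment_tendsto:
  assumes "m + 2 \<le> b"
  shows "((\<lambda>z. delay_moment b z m) \<longlongrightarrow> delay_moment b 0 m) (at_left 0)"
proof (rule tendsto_at_left_sequentially[of "-1"])
  fix S :: "nat \<Rightarrow> real"
  assume S: "\<And>n. S n < 0" "S \<longlonglongrightarrow> 0"
  show "(\<lambda>n. delay_moment b (S n) m) \<longlonglongrightarrow> delay_moment b 0 m"
    unfolding delay_moment_def
  proof (rule integral_dominated_convergence)
    show "integrable lborel (\<lambda>x. x ^ m * delay_kernel b 0 x)"
      using assms by (intro integrable_delay_kernel) auto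
    show "AE x in lborel. (\<lambda>n. x ^ m * delay_kernel b (S n) x) \<longlonglongrightarrow> x ^ m * delay_kernel b 0 x"
      unfolding delay_kernel_def by (intro AE_I2) (auto intro!: tendsto_eq_intros S(2))
    show "AE x in lborel. norm (x ^ m * delay_kernel b (S n) x) \<le> x ^ m * delay_kernel b 0 x" for n
      using S(1)[of n] by (intro AE_I2) (auto simp: delay_kernel_def abs_mult mult_le_0_iff intro!: mult_left_mono)
  qed auto
qed simp

section \<open>Differentiation under the integral and integration by parts\<close>

lemma exp_quadratic_remainder: "\<bar>exp x - 1 - x\<bar> \<le> x\<^sup>2 * exp \<bar>x\<bar>" for x :: real
proof -
  obtain t where t: "\<bar>t\<bar> \<le> \<bar>x\<bar>" "exp x = (\<Sum>m<2. (x ^ m) / fact m) + (exp t / fact 2) * x ^ 2"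
    using Maclaurin_exp_le[of x 2] by blast
  have "\<bar>exp x - 1 - x\<bar> = (exp t / 2) * x\<^sup>2"
    unfolding t(2) by (simp add: numeral_2_eq_2 abs_mult)
  also have "\<dots> \<le> exp \<bar>x\<bar> * x\<^sup>2"
  proof (rule mult_right_mono)
    have "exp t \<le> exp \<bar>x\<bar>" using t(1) by simp
    then show "exp t / 2 \<le> exp \<bar>x\<bar>" using exp_gt_zero[of t] by linarith
  qed simp
  finally show ?thesis by (simp add: mult.commute)
qed

lemma DERIV_if_quadratic_remainder:
  fixes f :: "real \<Rightarrow> real"
  assumes "r > 0" "\<And>h. \<bar>h\<bar> \<le> r \<Longrightarrow> \<bar>f (z + h) - f z - h * D\<bar> \<le> C * h\<^sup>2"
  shows "(f has_real_derivative D) (at z)"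
  unfolding DERIV_def
proof (rule LIM_zero_cancel, rule Lim_null_comparison)
  have "\<forall>\<^sub>F h in at 0. \<bar>h\<bar> < r \<and> h \<noteq> 0"
    using assms(1) by (auto simp: eventually_at dist_real_def intro!: exI[of _ r])
  then show "\<forall>\<^sub>F h in at 0. norm ((f (z + h) - f z) / h - D) \<le> C * \<bar>h\<bar>"
  proof eventually_elim
    case (elim h)
    have "norm ((f (z + h) - f z) / h - D) = \<bar>f (z + h) - f z - h * D\<bar> / \<bar>h\<bar>"
      using elim by (simp add: field_simps flip: abs_divide)
    also have "\<dots> \<le> C * h\<^sup>2 / \<bar>h\<bar>" using assms(2)[of h] elim by (intro divide_right_mono) auto
    also have "\<dots> = C * \<bar>h\<bar>" using elim by (simp add: power2_eq_square abs_if)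
    finally show ?case .
  qed
  show "((\<lambda>h. C * \<bar>h\<bar>) \<longlongrightarrow> 0) (at 0)"
    by (auto intro!: tendsto_eq_intros)
qed

text \<open>For h of size at most - z / 2 the second-order remainder of exp (h x) costs a factor h^2
  x^2 exp (- z x / 2), so the error is at most h^2 times a moment at z / 2, which is finite.\<close>

lemma delay_moment_deriv:
  assumes "z < 0"
  shows "((\<lambda>z. delay_moment b z m) has_real_derivative delay_moment b z (Suc m)) (at z)"
proof (rule DERIV_if_quadratic_remainder)
  show "- z / 2 > 0" using assms by simp
  fix h :: real assume h: "\<bar>h\<bar> \<le> - z / 2"
  have I: "integrable lborel (\<lambda>x. x ^ k * delay_kernel b y x)" if "y < 0" for y k
    using that by (intro integrable_delay_kernel) simp
  have zh: "z + h < 0" "z / 2 < 0" using assms h by auto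
  have pw: "\<bar>x ^ m * delay_kernel b (z + h) x - x ^ m * delay_kernel b z x - h * (x ^ Suc m * delay_kernel b z x)\<bar>
      \<le> h\<^sup>2 * (x ^ (m + 2) * delay_kernel b (z / 2) x)" for x
  proof (cases "x > 0")
    case True
    let ?w = "x powi (- int b) * exp (- 1 / x)"
    have k: "delay_kernel b y x = ?w * exp (y * x)" for y
      using True by (simp add: delay_kernel_def mult_exp_exp)
    have "x ^ m * delay_kernel b (z + h) x - x ^ m * delay_kernel b z x - h * (x ^ Suc m * delay_kernel b z x)
        = (x ^ m * ?w * exp (z * x)) * (exp (h * x) - 1 - h * x)"
      unfolding k by (simp only: distrib_right exp_add) (simp add: algebra_simps)
    also have "\<bar>\<dots>\<bar> = (x ^ m * ?w * exp (z * x)) * \<bar>exp (h * x) - 1 - h * x\<bar>"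
      using True by (simp add: abs_mult)
    also have "\<dots> \<le> (x ^ m * ?w * exp (z * x)) * ((h * x)\<^sup>2 * exp \<bar>h * x\<bar>)"
      using True by (intro mult_left_mono exp_quadratic_remainder) auto
    also have "\<dots> = (x ^ m * ?w * (h * x)\<^sup>2) * exp (z * x + \<bar>h * x\<bar>)"
      by (simp add: exp_add mult_ac)
    also have "\<dots> \<le> (x ^ m * ?w * (h * x)\<^sup>2) * exp (z / 2 * x)"
    proof (rule mult_left_mono)
      have "\<bar>h * x\<bar> \<le> - z / 2 * x" using h True by (simp only: abs_mult) (intro mult_mono, auto)
      then have "z * x + \<bar>h * x\<bar> \<le> z / 2 * x" by linarith
      then show "exp (z * x + \<bar>h * x\<bar>) \<le> exp (z / 2 * x)" by simp
    qed (use True in simp)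
    also have "\<dots> = h\<^sup>2 * (x ^ (m + 2) * delay_kernel b (z / 2) x)"
      unfolding k by (simp add: power_add power_mult_distrib power2_eq_square mult_ac)
    finally show ?thesis .
  qed (simp add: delay_kernel_def)
  have eq: "delay_moment b (z + h) m - delay_moment b z m - h * delay_moment b z (Suc m)
     = (\<integral>x. x ^ m * delay_kernel b (z + h) x - x ^ m * delay_kernel b z x - h * (x ^ Suc m * delay_kernel b z x) \<partial>lborel)"
    unfolding delay_moment_def using I[OF zh(1), of m] I[OF assms, of m] I[OF assms, of "Suc m"]
    by (simp del: power_Suc)
  have le: "\<bar>\<integral>x. x ^ m * delay_kernel b (z + h) x - x ^ m * delay_kernel b z x - h * (x ^ Suc m * delay_kernel b z x) \<partial>lborel\<bar>
      \<le> (\<integral>x. h\<^sup>2 * (x ^ (m + 2) * delay_kernel b (z / 2) x) \<partial>lborel)"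
  proof -
    have "integrable lborel (\<lambda>x. x ^ m * delay_kernel b (z + h) x - x ^ m * delay_kernel b z x - h * (x ^ Suc m * delay_kernel b z x))"
      using I[OF zh(1), of m] I[OF assms, of m] I[OF assms, of "Suc m"]
      by (intro Bochner_Integration.integrable_diff integrable_mult_right)
    moreover have "integrable lborel (\<lambda>x. h\<^sup>2 * (x ^ (m + 2) * delay_kernel b (z / 2) x))"
      using I[OF zh(2)] by (intro integrable_mult_right)
    ultimately have "(\<integral>x. \<bar>x ^ m * delay_kernel b (z + h) x - x ^ m * delay_kernel b z x - h * (x ^ Suc m * delay_kernel b z x)\<bar> \<partial>lborel)
      \<le> (\<integral>x. h\<^sup>2 * (x ^ (m + 2) * delay_kernel b (z / 2) x) \<partial>lborel)"
      by (rule integral_mono[OF integrable_abs]) (rule pw)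
    with integral_abs_bound show ?thesis by (rule order_trans)
  qed
  have "(\<integral>x. h\<^sup>2 * (x ^ (m + 2) * delay_kernel b (z / 2) x) \<partial>lborel) = delay_moment b (z / 2) (m + 2) * h\<^sup>2"
    unfolding delay_moment_def by (subst integral_mult_right_zero) (rule mult.commute)
  with le show "\<bar>delay_moment b (z + h) m - delay_moment b z m - h * delay_moment b z (Suc m)\<bar>
      \<le> delay_moment b (z / 2) (m + 2) * h\<^sup>2" unfolding eq by (simp only:)
qed

text \<open>The fundamental theorem of calculus on the half-line for
  \<open>x ^ (m + 2) * delay_kernel b z x\<close>, which tends to 0 at both ends.\<close>

lemma delay_moment_pearson:
  assumes "z < 0"
  shows "(real m + 2 - real b) * delay_moment b z (m + 1) + delay_moment b z m + z * delay_moment b z (m + 2) = 0"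
proof -
  let ?K = "delay_kernel b z"
  let ?F = "\<lambda>x. x ^ (m + 2) * ?K x"
  let ?f = "\<lambda>x. (real m + 2 - real b) * (x ^ (m + 1) * ?K x) + x ^ m * ?K x + z * (x ^ (m + 2) * ?K x)"
  have I: "integrable lborel (\<lambda>x. x ^ k * ?K x)" for k
    using assms by (intro integrable_delay_kernel) simp
  have If: "integrable lborel ?f"
    by (intro Bochner_Integration.integrable_add integrable_mult_right I)
  have ein: "einterval 0 \<infinity> = {0::real<..}" by (auto simp: einterval_def)
  have f0: "?f x = 0" if "x \<notin> {0<..}" for x using that by (simp add: delay_kernel_def)
  have ind: "(\<lambda>x. indicator {0<..} x *\<^sub>R ?f x) = ?f"
  proof (rule ext)
    fix x show "indicator {0<..} x *\<^sub>R ?f x = ?f x"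
    proof (cases "x \<in> {0<..}")
      case True then show ?thesis by (simp only: indicator_simps scaleR_one)
    next
      case False then show ?thesis by (simp only: f0[OF False] scaleR_zero_right)
    qed
  qed
  have "(LBINT x=0..\<infinity>. ?f x) = 0 - 0"
  proof (rule interval_integral_FTC_integrable)
    fix x :: real assume "0 < ereal x"
    then have x: "x > 0" by simp
    let ?k = "int m + 2 - int b" and ?e = "\<lambda>y. exp (- 1 / y + z * y)"
    have pw: "y ^ j * ?K y = y powi (int j - int b) * ?e y" if "y > 0" for y j
      using that by (simp add: delay_kernel_def power_int_diff power_int_minus divide_inverse)
    have ev: "\<forall>\<^sub>F y in nhds x. ?F y = y powi ?k * ?e y"
      by (rule eventually_mono[OF eventually_nhds_in_open[of "{0<..}"]])
         (use x pw[of _ "m + 2"] in \<open>auto simp: add.commute simp del: power_Suc add_2_eq_Suc'\<close>)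
    have "((\<lambda>y. y powi ?k * ?e y) has_real_derivative
       of_int ?k * x powi (?k - 1) * ?e x + x powi ?k * (?e x * (1 / x\<^sup>2 + z))) (at x)"
      using x by (auto intro!: derivative_eq_intros simp: power2_eq_square algebra_simps)
    also have "of_int ?k * x powi (?k - 1) * ?e x + x powi ?k * (?e x * (1 / x\<^sup>2 + z)) = ?f x"
    proof -
      have "x powi ?k * (1 / x\<^sup>2) = x powi (int m - int b)"
        using x power_int_diff[of x ?k 2] by simp
      then have "x powi ?k * (?e x * (1 / x\<^sup>2 + z)) = x ^ m * ?K x + z * (x ^ (m + 2) * ?K x)"
      proof -
        assume *: "x powi ?k * (1 / x\<^sup>2) = x powi (int m - int b)"
        have "x powi ?k * (?e x * (1 / x\<^sup>2 + z)) = (x powi ?k * (1 / x\<^sup>2)) * ?e x + z * (x powi ?k * ?e x)"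
          by (simp add: algebra_simps)
        then show ?thesis unfolding * pw[OF x] by (simp add: add.commute)
      qed
      moreover have "of_int ?k * x powi (?k - 1) * ?e x = (real m + 2 - real b) * (x ^ (m + 1) * ?K x)"
        unfolding pw[OF x] by (simp add: algebra_simps)
      ultimately show ?thesis by simp
    qed
    finally have "((\<lambda>y. y powi ?k * ?e y) has_real_derivative ?f x) (at x)" .
    then have "(?F has_real_derivative ?f x) (at x)"
      using DERIV_cong_ev[OF refl ev refl] by blast
    then show "(?F has_vector_derivative ?f x) (at x)"
      by (simp add: has_real_derivative_iff_has_vector_derivative)
    have evK: "\<forall>\<^sub>F y in nhds x. ?K y = y powi (- int b) * exp (- 1 / y + z * y)"
      by (rule eventually_mono[OF eventually_nhds_in_open[of "{0<..}"]])
         (use x in \<open>auto simp: delay_kernel_def\<close>)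
    have "isCont ?K x"
      unfolding isCont_cong[OF evK] using x by (intro continuous_intros) auto
    then show "isCont ?f x" by (intro continuous_intros)
  next
    show "set_integrable lborel (einterval 0 \<infinity>) ?f"
      unfolding ein set_integrable_def ind by (rule If)
    \<comment> \<open>Both boundary values come from the integrable majorant: used for index m it
      bounds the primitive by C x^2 near 0, used for index m + 2 it forces decay at
      infinity.\<close>
    have mf: "moment_finite b z k" for k using assms by simp
    obtain C where C: "C \<ge> 0" "\<And>x. x ^ m * ?K x \<le> C * (indicator {0<..} x * (1 / (1 + x\<^sup>2)))"
      using delay_kernel_bound[OF mf[of m]] by blast
    have b1: "norm (?F x) \<le> C * x\<^sup>2" for x
    proof (cases "x > 0")
      case True
      then have "x ^ m * ?K x \<le> C * (1 / (1 + x\<^sup>2))" using C(2)[of x] by simp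
      also have "\<dots> \<le> C * 1" using C(1) by (intro mult_left_mono) (simp_all add: divide_le_eq add_pos_nonneg)
      finally have "x ^ m * ?K x \<le> C" by simp
      then have "x\<^sup>2 * (x ^ m * ?K x) \<le> x\<^sup>2 * C" by (rule mult_left_mono) simp
      moreover have "x\<^sup>2 * (x ^ m * ?K x) = ?F x" by (simp only: power_add mult_ac)
      moreover have "norm (?F x) = ?F x" using True by simp
      ultimately show ?thesis by (simp only: mult.commute)
    qed (use C(1) in \<open>simp add: delay_kernel_def\<close>)
    have "(?F \<longlongrightarrow> 0) (at_right 0)"
    proof (rule Lim_null_comparison)
      show "((\<lambda>x. C * x\<^sup>2) \<longlongrightarrow> 0) (at_right 0)" by (auto intro!: tendsto_eq_intros)
    qed (use b1 in auto)
    then show "((?F \<circ> real_of_ereal) \<longlongrightarrow> 0) (at_right 0)"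
      unfolding zero_ereal_def by (simp only: ereal_tendsto_simps1)
    obtain B where B: "B \<ge> 0" "\<And>x. x ^ (m + 2) * ?K x \<le> B * (indicator {0<..} x * (1 / (1 + x\<^sup>2)))"
      using delay_kernel_bound[OF mf[of "m + 2"]] by blast
    have "(?F \<longlongrightarrow> 0) at_top"
    proof (rule Lim_null_comparison)
      have "((\<lambda>x::real. 1 / (1 + x\<^sup>2)) \<longlongrightarrow> 0) at_top"
        by real_asymp
      from tendsto_mult[OF tendsto_const[of B] this]
      show "((\<lambda>x. B * (1 / (1 + x\<^sup>2))) \<longlongrightarrow> 0) at_top" by simp
      show "\<forall>\<^sub>F x in at_top. norm (?F x) \<le> B * (1 / (1 + x\<^sup>2))"
        using eventually_gt_at_top[of "0::real"]
      proof eventually_elim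
        case (elim x)
        then show ?case using B(2)[of x] by (simp add: abs_mult)
      qed
    qed
    then show "((?F \<circ> real_of_ereal) \<longlongrightarrow> 0) (at_left \<infinity>)"
      by (simp only: ereal_tendsto_simps1)
  qed simp
  moreover have "(LBINT x=0..\<infinity>. ?f x) = (\<integral>x. ?f x \<partial>lborel)"
    unfolding interval_lebesgue_integral_def ein set_lebesgue_integral_def ind by simp
  moreover have "(\<integral>x. ?f x \<partial>lborel) = (real m + 2 - real b) * delay_moment b z (m + 1) + delay_moment b z m
     + z * delay_moment b z (m + 2)"
    unfolding delay_moment_def using I[of m] I[of "m + 1"] I[of "m + 2"] by (simp del: power_Suc add_2_eq_Suc')
  ultimately show ?thesis by simp
qed

text \<open>Each derivative raises the moment index by one, and the bound keeps the indices up to m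
  + r among the moments finite at 0. Later coefficients may be junk values, which
  \<open>smooth_exp r\<close> ignores.\<close>

lemma smooth_exp_delay_moment:
  "m + r + 2 \<le> b \<Longrightarrow> smooth_exp r (\<lambda>z. delay_moment b z m) (Abs_fps (\<lambda>i. delay_moment b 0 (m + i) / fact i))"
proof (induction r arbitrary: m)
  case 0 then show ?case using delay_moment_tendsto[of m b] by simp
next
  case (Suc r)
  have e: "fps_deriv (Abs_fps (\<lambda>i. delay_moment b 0 (m + i) / fact i)) = Abs_fps (\<lambda>i. delay_moment b 0 (Suc m + i) / fact i)"
  proof (rule fps_ext)
    fix n
    have "real (Suc n) * (delay_moment b 0 (m + Suc n) / fact (Suc n)) = delay_moment b 0 (m + Suc n) / fact n"
      by (simp add: fact_Suc del: of_nat_Suc)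
    then show "fps_nth (fps_deriv (Abs_fps (\<lambda>i. delay_moment b 0 (m + i) / fact i))) n
       = fps_nth (Abs_fps (\<lambda>i. delay_moment b 0 (Suc m + i) / fact i)) n" by simp
  qed
  show ?case
    by (rule smooth_exp_SucI[OF _ delay_moment_deriv])
       (use Suc.IH[of "Suc m"] Suc.prems delay_moment_tendsto[of m b] in \<open>simp_all add: e\<close>)
qed

section \<open>The partition function as a product of norms\<close>

lemma degree_newton_basis: "degree (\<Prod>j<l. [:- x j, 1:]) = l" for x :: "nat \<Rightarrow> real"
proof (induction l)
  case (Suc l)
  have "(\<Prod>j<l. [:- x j, 1:]) \<noteq> 0" by simp
  with Suc show ?case by (simp add: degree_mult_eq del: mult_pCons_right)
qed simp

lemma coeff_newton_basis: "coeff (\<Prod>j<l. [:- x j, 1:]) l = 1" for x :: "nat \<Rightarrow> real"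
proof (induction l)
  case (Suc l)
  have "coeff (\<Prod>j<l. [:- x j, 1:]) (Suc l) = 0" by (rule coeff_eq_0) (simp add: degree_newton_basis)
  with Suc show ?case by simp
qed simp

lemma newton_expansion:
  fixes x :: "nat \<Rightarrow> real"
  assumes "\<forall>i\<ge>m. coeff p i = 0"
  shows "\<exists>c. p = (\<Sum>l<m. smult (c l) (\<Prod>j<l. [:- x j, 1:]))"
  using assms
proof (induction m arbitrary: p)
  case 0 then show ?case by (simp add: poly_eq_iff)
next
  case (Suc m)
  let ?N = "\<lambda>l. \<Prod>j<l. [:- x j, 1:]"
  note deg = degree_newton_basis[of x] and lead = coeff_newton_basis[of x]
  let ?r = "p - smult (coeff p m) (?N m)"
  have "coeff ?r i = 0" if "i \<ge> m" for i
  proof (cases "i = m")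
    case False
    then have "coeff (?N m) i = 0" using that by (intro coeff_eq_0) (simp add: deg)
    then show ?thesis using Suc.prems that False by simp
  qed (simp add: lead)
  then obtain c where c: "?r = (\<Sum>l<m. smult (c l) (?N l))" using Suc.IH by blast
  have "p = ?r + smult (coeff p m) (?N m)" by simp
  also have "\<dots> = (\<Sum>l<Suc m. smult ((c(m := coeff p m)) l) (?N l))"
    unfolding c by simp
  finally show ?case by blast
qed

text \<open>Passing to the Newton basis at the nodes factors the matrix into a lower triangular one, whose
  diagonal gives the product, and an upper unitriangular one.\<close>

lemma vandermonde_monic:
  fixes x :: "nat \<Rightarrow> real" and Q :: "nat \<Rightarrow> real poly"
  assumes monic: "\<And>j. coeff (Q j) j = 1" "\<And>i j. i > j \<Longrightarrow> coeff (Q j) i = 0"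
  shows "(\<Sum>p | p permutes {0..<n}. signof p * (\<Prod>i = 0..<n. poly (Q (p i)) (x i)))
    = (\<Prod>k<n. \<Prod>j<k. x k - x j)"
proof -
  let ?N = "\<lambda>l. \<Prod>j<l. [:- x j, 1:]"
  note deg = degree_newton_basis[of x] and lead = coeff_newton_basis[of x]
  have ex: "\<exists>c. Q i - ?N i = (\<Sum>l<i. smult (c l) (?N l))" for i
  proof (rule newton_expansion, intro allI impI)
    fix j assume "i \<le> j"
    show "coeff (Q i - ?N i) j = 0"
    proof (cases "i = j")
      case False
      then have "coeff (?N i) j = 0" "coeff (Q i) j = 0" using monic \<open>i \<le> j\<close>
        by (auto intro!: coeff_eq_0 simp: deg)
      then show ?thesis by simp
    qed (simp add: monic lead)
  qed
  have "\<exists>c. \<forall>i. Q i - ?N i = (\<Sum>l<i. smult (c i l) (?N l))"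
    by (rule choice) (rule allI, rule ex)
  then obtain c where c: "\<And>i. Q i - ?N i = (\<Sum>l<i. smult (c i l) (?N l))" by blast
  define A where "A = Matrix.mat n n (\<lambda>(k, i). poly (Q i) (x k))"
  define N where "N = Matrix.mat n n (\<lambda>(k, l). poly (?N l) (x k))"
  define T where "T = Matrix.mat n n (\<lambda>(l, i). if l = i then 1 else if l < i then c i l else 0)"
  have carr: "A \<in> carrier_mat n n" "N \<in> carrier_mat n n" "T \<in> carrier_mat n n"
    by (simp_all add: A_def N_def T_def)
  have "A = N * T"
  proof (rule eq_matI)
    fix k i assume ki: "k < dim_row (N * T)" "i < dim_col (N * T)"
    then have k: "k < n" and i: "i < n" by (simp_all add: N_def T_def)
    have "(N * T) $$ (k, i) = (\<Sum>l = 0..<n. N $$ (k, l) * T $$ (l, i))"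
      using k i by (simp add: N_def T_def scalar_prod_def)
    also have "\<dots> = (\<Sum>l = 0..<n. poly (?N l) (x k) * (if l = i then 1 else if l < i then c i l else 0))"
      using k i by (intro sum.cong) (simp_all add: N_def T_def)
    also have "\<dots> = (\<Sum>l\<le>i. poly (?N l) (x k) * (if l = i then 1 else if l < i then c i l else 0))"
      by (rule sum.mono_neutral_right) (use i in auto)
    also have "\<dots> = (\<Sum>l<i. poly (?N l) (x k) * c i l) + poly (?N i) (x k)"
      by (simp add: lessThan_Suc_atMost[symmetric])
    also have "\<dots> = poly (\<Sum>l<i. smult (c i l) (?N l)) (x k) + poly (?N i) (x k)"
      by (simp add: poly_sum mult.commute)
    also have "\<dots> = poly (Q i) (x k)" unfolding c[symmetric] by simp
    finally show "A $$ (k, i) = (N * T) $$ (k, i)" using k i by (simp add: A_def)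
  qed (simp_all add: A_def N_def T_def)
  then have "Determinant.det A = Determinant.det N * Determinant.det T"
    using det_mult carr by blast
  also have "Determinant.det T = prod_list (diag_mat T)"
    by (rule det_upper_triangular) (auto simp: T_def)
  also have "\<dots> = 1"
    unfolding prod_list_diag_prod by (simp add: T_def)
  also have "Determinant.det N = prod_list (diag_mat N)"
  proof (rule det_lower_triangular)
    fix k l assume "k < l" "l < n"
    then have "poly (?N l) (x k) = 0" by (auto simp: poly_prod)
    then show "N $$ (k, l) = 0" using \<open>k < l\<close> \<open>l < n\<close> by (simp add: N_def)
  qed (simp add: carr)
  also have "\<dots> = (\<Prod>k<n. \<Prod>j<k. x k - x j)"
    unfolding prod_list_diag_prod by (simp add: N_def poly_prod atLeast0LessThan)
  finally have "Determinant.det A = (\<Prod>k<n. \<Prod>j<k. x k - x j)" by simp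
  moreover have "Determinant.det A
      = (\<Sum>p | p permutes {0..<n}. signof p * (\<Prod>i = 0..<n. poly (Q (p i)) (x i)))"
    unfolding det_def'[OF carr(1)]
  proof (intro sum.cong refl arg_cong2[where f = "(*)"] prod.cong)
    fix p i assume "p \<in> {p. p permutes {0..<n}}" "i \<in> {0..<n}"
    then have "p i < n" "i < n" by (auto dest: permutes_in_image)
    then show "A $$ (i, p i) = poly (Q (p i)) (x i)" by (simp add: A_def)
  qed
  ultimately show ?thesis by simp
qed

section \<open>Andreief's identity for the delay weight\<close>

lemma mfun_opoly_mult:
  assumes "\<And>k. k < n \<Longrightarrow> sqnorm \<mu> k \<noteq> 0" "i < n" "j < n"
  shows "mfun \<mu> (opoly \<mu> i * opoly \<mu> j) = (if i = j then sqnorm \<mu> i else 0)"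
proof (cases i j rule: linorder_cases)
  case less
  have "mfun \<mu> (opoly \<mu> j * opoly \<mu> i) = 0"
    by (rule opoly_orthogonal) (use assms less in \<open>auto simp: coeff_opoly_gt\<close>)
  then show ?thesis using less by (simp add: mult.commute)
next
  case greater
  have "mfun \<mu> (opoly \<mu> i * opoly \<mu> j) = 0"
    by (rule opoly_orthogonal) (use assms greater in \<open>auto simp: coeff_opoly_gt\<close>)
  then show ?thesis using greater by simp
qed (simp add: sqnorm_def)

lemma sqnorm_delay_pos:
  assumes "moment_finite b z (2 * j)"
  shows "sqnorm (delay_moment b z) j > 0"
  unfolding sqnorm_def by (rule mfun_delay_moment_square_pos) (use assms opoly_nonzero in auto)

text \<open>Both factors of the squared Vandermonde product are expanded over permutations in an
  arbitrary monic family, which makes the integrand a signed sum of products in separate variables.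
  Variables are numbered from 1 and polynomials from 0, hence i - 1.\<close>

lemma delay_weight_eq:
  assumes x: "x \<in> space (Pi\<^sub>M {1..n} (\<lambda>_. lborel))"
    and Q: "\<And>j. coeff (Q j) j = 1" "\<And>i j. i > j \<Longrightarrow> coeff (Q j) i = 0"
  shows "indicator (positive_orthant n) x *\<^sub>R delay_weight n z x =
    (\<Sum>p | p permutes {0..<n}. \<Sum>q | q permutes {0..<n}. signof p * signof q *
      (\<Prod>i\<in>{1..n}. poly (Q (p (i - 1)) * Q (q (i - 1))) (x i) * delay_kernel (3 * n) z (x i)))"
proof -
  have "x \<in> extensional {1..n}" using x by (auto simp: space_PiM PiE_def)
  then have ind: "indicator (positive_orthant n) x = (\<Prod>i\<in>{1..n}. indicator {0<..} (x i) :: real)"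
    by (auto simp: positive_orthant_def indicator_def PiE_def Pi_def)
  have K: "indicator {0<..} (x i) * (x i powi (- (3 * int n)) * exp (- 1 / x i + z * x i)) = delay_kernel (3 * n) z (x i)" for i
    by (simp add: delay_kernel_def)
  have sh: "(\<Prod>i\<in>{1..n}. g i) = (\<Prod>i = 0..<n. g (Suc i))" for g :: "nat \<Rightarrow> real"
    by (rule prod.reindex_bij_witness[of _ Suc "\<lambda>i. i - 1"]) auto
  have V: "(\<Prod>k\<in>{1..n}. \<Prod>j\<in>{1..<k}. \<bar>x k - x j\<bar> ^ 2)
      = (\<Sum>p | p permutes {0..<n}. signof p * (\<Prod>i = 0..<n. poly (Q (p i)) (x (Suc i))))\<^sup>2"
  proof -
    have "(\<Prod>j\<in>{1..<Suc k}. \<bar>x (Suc k) - x j\<bar> ^ 2) = (\<Prod>j<k. x (Suc k) - x (Suc j))\<^sup>2" for k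
    proof -
      have "(\<Prod>j\<in>{1..<Suc k}. \<bar>x (Suc k) - x j\<bar> ^ 2) = (\<Prod>j<k. \<bar>x (Suc k) - x (Suc j)\<bar> ^ 2)"
        by (rule prod.reindex_bij_witness[of _ Suc "\<lambda>i. i - 1"]) auto
      then show ?thesis by (simp add: prod_power_distrib)
    qed
    then have "(\<Prod>k\<in>{1..n}. \<Prod>j\<in>{1..<k}. \<bar>x k - x j\<bar> ^ 2) = (\<Prod>k = 0..<n. (\<Prod>j<k. x (Suc k) - x (Suc j))\<^sup>2)"
      unfolding sh by (simp only:)
    also have "\<dots> = (\<Prod>k<n. \<Prod>j<k. x (Suc k) - x (Suc j))\<^sup>2"
      by (simp only: atLeast0LessThan prod_power_distrib)
    finally show ?thesis
      by (simp only: vandermonde_monic[where n = n and x = "\<lambda>i. x (Suc i)" and Q = Q, OF Q])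
  qed
  have "indicator (positive_orthant n) x *\<^sub>R delay_weight n z x
      = (\<Prod>i\<in>{1..n}. delay_kernel (3 * n) z (x i)) *
        (\<Sum>p | p permutes {0..<n}. signof p * (\<Prod>i = 0..<n. poly (Q (p i)) (x (Suc i))))\<^sup>2"
    unfolding delay_weight_def V ind K[symmetric] prod.distrib by (simp add: mult.assoc)
  also have "\<dots> = (\<Sum>p | p permutes {0..<n}. \<Sum>q | q permutes {0..<n}.
      (\<Prod>i\<in>{1..n}. delay_kernel (3 * n) z (x i)) *
      ((signof p * (\<Prod>i = 0..<n. poly (Q (p i)) (x (Suc i)))) *
       (signof q * (\<Prod>i = 0..<n. poly (Q (q i)) (x (Suc i))))))"
    unfolding power2_eq_square by (subst sum_product) (simp only: sum_distrib_left)
  also have "\<dots> = (\<Sum>p | p permutes {0..<n}. \<Sum>q | q permutes {0..<n}. signof p * signof q *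
      (\<Prod>i\<in>{1..n}. poly (Q (p (i - 1)) * Q (q (i - 1))) (x i) * delay_kernel (3 * n) z (x i)))"
    unfolding prod.distrib poly_mult sh diff_Suc_1
    by (intro sum.cong refl) (simp only: mult_ac)
  finally show ?thesis .
qed

text \<open>For the orthogonal family each pair of permutations integrates to a product of pairings
  that vanishes unless the two agree; n! equal terms remain. The degrees involved are at most 2 n -
  2, so the moments for b = 3 n are finite at z = 0 too.\<close>

theorem delay_integral_eq:
  assumes z: "z \<le> 0"
  shows "delay_integral n z = fact n * (\<Prod>j<n. sqnorm (delay_moment (3 * n) z) j)"
proof -
  let ?\<mu> = "delay_moment (3 * n) z"
  let ?Q = "opoly ?\<mu>"
  let ?K = "delay_kernel (3 * n) z"
  let ?P = "{p. p permutes {0..<n}}"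
  have pos: "sqnorm ?\<mu> j > 0" if "j < n" for j
    by (rule sqnorm_delay_pos) (use z that in auto)
  interpret product_sigma_finite "\<lambda>_::nat. lborel :: real measure" ..
  have deg: "moment_finite (3 * n) z (degree (?Q i * ?Q j))" if "i < n" "j < n" for i j
    using z that by (auto simp: degree_mult_eq opoly_nonzero)
  have pn: "p (i - 1) < n" if "p \<in> ?P" "i \<in> {1..n}" for p i
    using that permutes_in_image[of p "{0..<n}" "i - 1"] by auto
  have int1: "integrable lborel (\<lambda>y. poly (?Q (p (i - 1)) * ?Q (q (i - 1))) y * ?K y)"
    if "p \<in> ?P" "q \<in> ?P" "i \<in> {1..n}" for p q i
    using that by (intro mfun_delay_moment(2) deg pn)
  have "delay_integral n z = (\<integral>x. (\<Sum>p\<in>?P. \<Sum>q\<in>?P. signof p * signof q *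
      (\<Prod>i\<in>{1..n}. poly (?Q (p (i - 1)) * ?Q (q (i - 1))) (x i) * ?K (x i))) \<partial>Pi\<^sub>M {1..n} (\<lambda>_. lborel))"
    unfolding delay_integral_def set_lebesgue_integral_def
    by (intro Bochner_Integration.integral_cong refl delay_weight_eq) (auto simp: coeff_opoly_gt)
  also have "\<dots> = (\<Sum>p\<in>?P. \<Sum>q\<in>?P. signof p * signof q *
      (\<integral>x. (\<Prod>i\<in>{1..n}. poly (?Q (p (i - 1)) * ?Q (q (i - 1))) (x i) * ?K (x i)) \<partial>Pi\<^sub>M {1..n} (\<lambda>_. lborel)))"
  proof -
    have I: "integrable (Pi\<^sub>M {1..n} (\<lambda>_. lborel)) (\<lambda>x. signof p * signof q *
      (\<Prod>i\<in>{1..n}. poly (?Q (p (i - 1)) * ?Q (q (i - 1))) (x i) * ?K (x i)))" if "p \<in> ?P" "q \<in> ?P" for p q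
      using that by (intro integrable_mult_right product_integrable_prod int1) auto
    have swap: "(\<integral>x. (\<Sum>p\<in>?P. \<Sum>q\<in>?P. c p q * F p q x) \<partial>M) = (\<Sum>p\<in>?P. \<Sum>q\<in>?P. c p q * (\<integral>x. F p q x \<partial>M))"
      if F: "\<And>p q. p \<in> ?P \<Longrightarrow> q \<in> ?P \<Longrightarrow> integrable M (\<lambda>x. c p q * F p q x)"
      for M :: "(nat \<Rightarrow> real) measure" and c :: "(nat \<Rightarrow> nat) \<Rightarrow> (nat \<Rightarrow> nat) \<Rightarrow> real" and F
    proof -
      have "(\<integral>x. (\<Sum>p\<in>?P. \<Sum>q\<in>?P. c p q * F p q x) \<partial>M) = (\<Sum>p\<in>?P. \<integral>x. (\<Sum>q\<in>?P. c p q * F p q x) \<partial>M)"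
        by (rule Bochner_Integration.integral_sum) (intro Bochner_Integration.integrable_sum F)
      also have "\<dots> = (\<Sum>p\<in>?P. \<Sum>q\<in>?P. \<integral>x. c p q * F p q x \<partial>M)"
        by (rule sum.cong[OF refl], rule Bochner_Integration.integral_sum) (rule F)
      finally show ?thesis by (simp only: integral_mult_right_zero)
    qed
    show ?thesis by (rule swap) (rule I)
  qed
  also have "\<dots> = (\<Sum>p\<in>?P. \<Sum>q\<in>?P. signof p * signof q *
      (\<Prod>i\<in>{1..n}. mfun ?\<mu> (?Q (p (i - 1)) * ?Q (q (i - 1)))))"
  proof (intro sum.cong refl arg_cong2[where f = "(*)"])
    fix p q assume pq: "p \<in> ?P" "q \<in> ?P"
    have "(\<integral>x. (\<Prod>i\<in>{1..n}. poly (?Q (p (i - 1)) * ?Q (q (i - 1))) (x i) * ?K (x i)) \<partial>Pi\<^sub>M {1..n} (\<lambda>_. lborel))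
      = (\<Prod>i\<in>{1..n}. \<integral>y. poly (?Q (p (i - 1)) * ?Q (q (i - 1))) y * ?K y \<partial>lborel)"
      by (rule product_integral_prod) (use int1 pq in auto)
    also have "\<dots> = (\<Prod>i\<in>{1..n}. mfun ?\<mu> (?Q (p (i - 1)) * ?Q (q (i - 1))))"
      by (intro prod.cong refl mfun_delay_moment(1)[symmetric] deg pn pq)
    finally show "(\<integral>x. (\<Prod>i\<in>{1..n}. poly (?Q (p (i - 1)) * ?Q (q (i - 1))) (x i) * ?K (x i)) \<partial>Pi\<^sub>M {1..n} (\<lambda>_. lborel))
      = (\<Prod>i\<in>{1..n}. mfun ?\<mu> (?Q (p (i - 1)) * ?Q (q (i - 1))))" .
  qed
  also have "\<dots> = (\<Sum>p\<in>?P. \<Sum>q\<in>?P. if q = p then (\<Prod>j<n. sqnorm ?\<mu> j) else 0)"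
  proof (intro sum.cong refl)
    fix p q assume pq: "p \<in> ?P" "q \<in> ?P"
    have m: "mfun ?\<mu> (?Q (p (i - 1)) * ?Q (q (i - 1))) = (if p (i - 1) = q (i - 1) then sqnorm ?\<mu> (p (i - 1)) else 0)"
      if "i \<in> {1..n}" for i
      using pos pn[OF pq(1) that] pn[OF pq(2) that] by (intro mfun_opoly_mult[where n = n]) (auto simp: less_le)
    show "signof p * signof q * (\<Prod>i\<in>{1..n}. mfun ?\<mu> (?Q (p (i - 1)) * ?Q (q (i - 1))))
       = (if q = p then (\<Prod>j<n. sqnorm ?\<mu> j) else 0)"
    proof (cases "q = p")
      case True
      have "(\<Prod>i\<in>{1..n}. mfun ?\<mu> (?Q (p (i - 1)) * ?Q (q (i - 1)))) = (\<Prod>i\<in>{1..n}. sqnorm ?\<mu> (p (i - 1)))"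
        by (intro prod.cong refl) (use m True in simp)
      also have "\<dots> = (\<Prod>i = 0..<n. sqnorm ?\<mu> (p i))"
        by (rule prod.reindex_bij_witness[of _ Suc "\<lambda>i. i - 1"]) auto
      also have "\<dots> = (\<Prod>j = 0..<n. sqnorm ?\<mu> j)"
        using prod.permute[of p "{0..<n}" "sqnorm ?\<mu>"] pq by (simp add: o_def)
      finally have "(\<Prod>i\<in>{1..n}. mfun ?\<mu> (?Q (p (i - 1)) * ?Q (q (i - 1)))) = (\<Prod>j<n. sqnorm ?\<mu> j)"
        by (simp add: atLeast0LessThan)
      moreover have "signof p * signof p = (1 :: real)"
        by (simp flip: of_int_mult)
      ultimately show ?thesis using True by simp
    next
      case False
      \<comment> \<open>One place where the permutations differ is enough, since it contributes a
        zero factor.\<close>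
      then obtain j where j: "p j \<noteq> q j" by (metis ext)
      then have "j \<in> {0..<n}" using pq by (metis mem_Collect_eq permutes_not_in)
      then have "Suc j \<in> {1..n}" "mfun ?\<mu> (?Q (p (Suc j - 1)) * ?Q (q (Suc j - 1))) = 0"
        using m[of "Suc j"] j by auto
      then have "(\<Prod>i\<in>{1..n}. mfun ?\<mu> (?Q (p (i - 1)) * ?Q (q (i - 1)))) = 0"
        by (intro prod_zero) blast+
      then show ?thesis using False by simp
    qed
  qed
  also have "\<dots> = (\<Sum>p\<in>?P. (\<Prod>j<n. sqnorm ?\<mu> j))"
    by (intro sum.cong refl) (simp add: sum.delta finite_permutations)
  also have "\<dots> = fact n * (\<Prod>j<n. sqnorm ?\<mu> j)"
    using card_permutations[of "{0..<n}" n] by simp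
  finally show ?thesis .
qed

section \<open>The third-order equation\<close>

text \<open>The series is hidden and only its constant term is tied to the actual value at 0; this
  is what allows values at the origin to be found as one-sided limits.\<close>

definition smooth_ext :: "nat \<Rightarrow> (real \<Rightarrow> real) \<Rightarrow> bool" where
  "smooth_ext r f \<longleftrightarrow> (\<exists>A. smooth_exp r f A \<and> fps_nth A 0 = f 0)"

lemma smooth_ext_const: "smooth_ext r (\<lambda>_. c)"
  unfolding smooth_ext_def using smooth_exp_const[of r c] by (intro exI[of _ "fps_const c"]) simp

lemma smooth_ext_mult: "smooth_ext r f \<Longrightarrow> smooth_ext r g \<Longrightarrow> smooth_ext r (\<lambda>z. f z * g z)"
  unfolding smooth_ext_def using smooth_exp_mult by fastforce

lemma smooth_ext_diff: "smooth_ext r f \<Longrightarrow> smooth_ext r g \<Longrightarrow> smooth_ext r (\<lambda>z. f z - g z)"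
  unfolding smooth_ext_def using smooth_exp_diff by fastforce

lemma smooth_ext_sum:
  "finite I \<Longrightarrow> (\<And>i. i \<in> I \<Longrightarrow> smooth_ext r (f i)) \<Longrightarrow> smooth_ext r (\<lambda>z. \<Sum>i\<in>I. f i z)"
proof (induction I rule: finite_induct)
  case empty show ?case using smooth_ext_const[of r 0] by simp
next
  case (insert i I)
  then have "smooth_ext r (f i)" "smooth_ext r (\<lambda>z. \<Sum>i\<in>I. f i z)" by auto
  then have "smooth_ext r (\<lambda>z. f i z + (\<Sum>i\<in>I. f i z))"
    unfolding smooth_ext_def using smooth_exp_add by fastforce
  then show ?case using insert by simp
qed

lemma smooth_ext_divide:
  assumes "smooth_ext r f" "smooth_ext r g" "\<And>z. z \<le> 0 \<Longrightarrow> g z \<noteq> 0"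
  shows "smooth_ext r (\<lambda>z. f z / g z)"
proof -
  obtain A B where A: "smooth_exp r f A" "fps_nth A 0 = f 0" and B: "smooth_exp r g B" "fps_nth B 0 = g 0"
    using assms(1,2) unfolding smooth_ext_def by blast
  have "smooth_exp r (\<lambda>z. f z / g z) (A * inverse B)"
    by (rule smooth_exp_divide[OF A(1) B(1)]) (use assms(3) B(2) in auto)
  moreover have "fps_nth (A * inverse B) 0 = f 0 / g 0" using A B by (simp add: divide_inverse)
  ultimately show ?thesis unfolding smooth_ext_def by blast
qed

lemma smooth_ext_tendsto: "smooth_ext r f \<Longrightarrow> (f \<longlongrightarrow> f 0) (at_left 0)"
  unfolding smooth_ext_def using smooth_exp_tendsto by fastforce

lemma smooth_ext_delay_moment: "m + r + 2 \<le> b \<Longrightarrow> smooth_ext r (\<lambda>z. delay_moment b z m)"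
  unfolding smooth_ext_def using smooth_exp_delay_moment by fastforce

section \<open>Regularity of norms and Jacobi coefficients up to the origin\<close>

lemma smooth_ext_mfun:
  assumes "d + r + 2 \<le> b" "\<And>z i. i > d \<Longrightarrow> coeff (P z) i = 0" "\<And>i. smooth_ext r (\<lambda>z. coeff (P z) i)"
  shows "smooth_ext r (\<lambda>z. mfun (delay_moment b z) (P z))"
proof -
  have "mfun (delay_moment b z) (P z) = (\<Sum>i\<le>d. coeff (P z) i * delay_moment b z i)" for z
    by (rule mfun_altdef) (rule assms(2))
  then show ?thesis
    by (simp, intro smooth_ext_sum smooth_ext_mult smooth_ext_delay_moment assms(3)) (use assms(1) in auto)
qed

lemma smooth_ext_coeff_mult:
  assumes "\<And>i. smooth_ext r (\<lambda>z. coeff (P z) i)" "\<And>i. smooth_ext r (\<lambda>z. coeff (Q z) i)"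
  shows "smooth_ext r (\<lambda>z. coeff (P z * Q z) i)"
  unfolding coeff_mult by (intro smooth_ext_sum smooth_ext_mult assms) simp

lemma smooth_ext_coeff_pCons:
  assumes "\<And>i. smooth_ext r (\<lambda>z. coeff (P z) i)"
  shows "smooth_ext r (\<lambda>z. coeff (pCons 0 (P z)) i)"
  using assms smooth_ext_const[of r 0] by (cases i) simp_all

lemma sqnorm_delay_pos_nonpos:
  assumes "2 * j + 2 \<le> b" "z \<le> 0"
  shows "sqnorm (delay_moment b z) j > 0"
  by (rule sqnorm_delay_pos) (use assms in auto)

lemma smooth_ext_sqnorm_aux:
  assumes "2 * j + r + 2 \<le> b" "\<And>i. smooth_ext r (\<lambda>z. coeff (opoly (delay_moment b z) j) i)"
  shows "smooth_ext r (\<lambda>z. sqnorm (delay_moment b z) j)"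
  unfolding sqnorm_def
proof (rule smooth_ext_mfun[where d = "2 * j"])
  show "coeff (opoly (delay_moment b z) j * opoly (delay_moment b z) j) i = 0" if "i > 2 * j" for z i
    by (rule coeff_eq_0) (use that in \<open>simp add: degree_mult_eq opoly_nonzero\<close>)
qed (intro smooth_ext_coeff_mult assms)+

lemma smooth_ext_jac_b_aux:
  assumes "2 * j + r + 3 \<le> b" "\<And>i. smooth_ext r (\<lambda>z. coeff (opoly (delay_moment b z) j) i)"
  shows "smooth_ext r (\<lambda>z. jac_b (delay_moment b z) j)"
  unfolding jac_b_def
proof (rule smooth_ext_divide)
  show "smooth_ext r (\<lambda>z. mfun (delay_moment b z) (pCons 0 (opoly (delay_moment b z) j * opoly (delay_moment b z) j)))"
  proof (rule smooth_ext_mfun[where d = "2 * j + 1"])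
    show "coeff (pCons 0 (opoly (delay_moment b z) j * opoly (delay_moment b z) j)) i = 0" if "i > 2 * j + 1" for z i
      by (rule coeff_eq_0) (use that in \<open>simp add: degree_mult_eq opoly_nonzero\<close>)
  qed (use assms in \<open>intro smooth_ext_coeff_mult smooth_ext_coeff_pCons | simp\<close>)+
  show "smooth_ext r (\<lambda>z. sqnorm (delay_moment b z) j)"
    by (rule smooth_ext_sqnorm_aux) (use assms in auto)
  show "sqnorm (delay_moment b z) j \<noteq> 0" if "z \<le> 0" for z
    using sqnorm_delay_pos_nonpos[of j b z] assms that by simp
qed

text \<open>Polynomial j is built from moments of index at most 2 j - 1, and r derivatives push this
  to 2 j - 1 + r, which must not exceed b - 2. Norms and \<open>jac_b\<close> reach one and two
  indices further, which explains their bounds.\<close>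

lemma smooth_ext_coeff_opoly:
  "2 * j + r + 1 \<le> b \<Longrightarrow> smooth_ext r (\<lambda>z. coeff (opoly (delay_moment b z) j) i)"
proof (induction j arbitrary: i r rule: less_induct)
  case (less j)
  show ?case
  proof (cases j)
    case 0 then show ?thesis by (simp add: smooth_ext_const)
  next
    case (Suc m)
    have m: "smooth_ext r (\<lambda>z. coeff (opoly (delay_moment b z) m) i)" for i
      using less Suc by simp
    have m1: "smooth_ext r (\<lambda>z. coeff (opoly (delay_moment b z) (m - 1)) i)" for i
      using less.IH[of "m - 1" r i] less.prems Suc by simp
    have b: "smooth_ext r (\<lambda>z. jac_b (delay_moment b z) m)"
      by (rule smooth_ext_jac_b_aux) (use less.prems Suc m in auto)
    have a: "smooth_ext r (\<lambda>z. jac_a (delay_moment b z) m)"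
    proof (cases m)
      case 0 then show ?thesis by (simp add: jac_a_def smooth_ext_const)
    next
      case (Suc l)
      have "smooth_ext r (\<lambda>z. sqnorm (delay_moment b z) m / sqnorm (delay_moment b z) l)"
      proof (intro smooth_ext_divide smooth_ext_sqnorm_aux m)
        show "smooth_ext r (\<lambda>z. coeff (opoly (delay_moment b z) l) i)" for i using m1 Suc by simp
        show "sqnorm (delay_moment b z) l \<noteq> 0" if "z \<le> 0" for z
          using sqnorm_delay_pos_nonpos[of l b z] less.prems that Suc \<open>j = Suc m\<close> by simp
      qed (use less.prems Suc \<open>j = Suc m\<close> in auto)
      then show ?thesis using Suc by (simp add: jac_a_def)
    qed
    have e: "coeff (opoly (delay_moment b z) j) i = coeff (pCons 0 (opoly (delay_moment b z) m)) i
       - jac_b (delay_moment b z) m * coeff (opoly (delay_moment b z) m) i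
       - jac_a (delay_moment b z) m * coeff (opoly (delay_moment b z) (m - 1)) i" for z
      unfolding Suc opoly_Suc by simp
    show ?thesis unfolding e
      by (intro smooth_ext_diff smooth_ext_mult smooth_ext_coeff_pCons m m1 a b)
  qed
qed

lemma smooth_ext_sqnorm: "2 * j + r + 2 \<le> b \<Longrightarrow> smooth_ext r (\<lambda>z. sqnorm (delay_moment b z) j)"
  by (intro smooth_ext_sqnorm_aux smooth_ext_coeff_opoly) auto

lemma smooth_ext_jac_b: "2 * j + r + 3 \<le> b \<Longrightarrow> smooth_ext r (\<lambda>z. jac_b (delay_moment b z) j)"
  by (intro smooth_ext_jac_b_aux smooth_ext_coeff_opoly) auto

lemma smooth_ext_jac_a: "2 * j + r + 2 \<le> b \<Longrightarrow> smooth_ext r (\<lambda>z. jac_a (delay_moment b z) j)"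
proof (cases j)
  case (Suc l)
  assume a: "2 * j + r + 2 \<le> b"
  have "smooth_ext r (\<lambda>z. sqnorm (delay_moment b z) j / sqnorm (delay_moment b z) l)"
    by (intro smooth_ext_divide smooth_ext_sqnorm) (use a Suc sqnorm_delay_pos_nonpos[of l b] in \<open>auto simp: less_le\<close>)
  then show ?thesis using Suc by (simp add: jac_a_def)
qed (simp add: jac_a_def smooth_ext_const)

lemma smooth_ext_sub_coeff: "2 * j + r + 1 \<le> b \<Longrightarrow> smooth_ext r (\<lambda>z. sub_coeff (delay_moment b z) j)"
  unfolding sub_coeff_def by (intro smooth_ext_sum smooth_ext_jac_b) auto

interpretation toda: toda_moments "delay_moment b" for b
proof
  show "((\<lambda>z. delay_moment b z m) has_real_derivative delay_moment b z (Suc m)) (at z)" if "z < 0" for z m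
    using that by (rule delay_moment_deriv)
  show "sqnorm (delay_moment b z) n \<noteq> 0" if "z < 0" for z n
    using sqnorm_delay_pos[of z n b] that by simp
qed


lemma delay_string_equation:
  assumes "z < 0"
  shows "2 * (real j * jac_b (delay_moment b z) j + sub_coeff (delay_moment b z) j) + 1
     + (2 - real b) * jac_b (delay_moment b z) j
     + z * (jac_a (delay_moment b z) (Suc j) + (jac_b (delay_moment b z) j)\<^sup>2 + jac_a (delay_moment b z) j) = 0"
  by (rule string_equation) (use delay_moment_pearson[OF assms] toda.sqnorm_nonzero[OF assms] in auto)

section \<open>Values at the origin, first integral and third-order equation\<close>

lemma tendsto_at_left_0_unique:
  fixes f :: "real \<Rightarrow> real"
  assumes "(f \<longlongrightarrow> l) (at_left 0)" "\<And>z. z < 0 \<Longrightarrow> f z = c"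
  shows "l = c"
proof -
  have "((\<lambda>_. c) \<longlongrightarrow> l) (at_left (0::real))"
    using assms(1) by (rule Lim_transform_eventually) (rule eventually_mono[OF eventually_neg], use assms(2) in auto)
  then show ?thesis using tendsto_unique[of "at_left (0::real)" "\<lambda>_. c" l c] by simp
qed

text \<open>In the limit z = 0 the string equation says that (b - 2 j) times
  \<open>sub_coeff\<close> grows by 1 when j does. For b = 3 n and j = n this is the first cumulant,
  equal to 1 for every n.\<close>

lemma sub_coeff_delay_0:
  "2 * j + 2 \<le> b \<Longrightarrow> (real b - 2 * real j) * sub_coeff (delay_moment b 0) j = real j"
proof (induction j)
  case 0 show ?case by (simp add: sub_coeff_def)
next
  case (Suc j)
  let ?\<mu> = "delay_moment b"
  let ?F = "\<lambda>z. 2 * (real j * jac_b (?\<mu> z) j + sub_coeff (?\<mu> z) j) + 1 + (2 - real b) * jac_b (?\<mu> z) j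
     + z * (jac_a (?\<mu> z) (Suc j) + (jac_b (?\<mu> z) j)\<^sup>2 + jac_a (?\<mu> z) j)"
  have t: "((\<lambda>z. jac_b (?\<mu> z) j) \<longlongrightarrow> jac_b (?\<mu> 0) j) (at_left 0)"
    "((\<lambda>z. sub_coeff (?\<mu> z) j) \<longlongrightarrow> sub_coeff (?\<mu> 0) j) (at_left 0)"
    "((\<lambda>z. jac_a (?\<mu> z) j) \<longlongrightarrow> jac_a (?\<mu> 0) j) (at_left 0)"
    "((\<lambda>z. jac_a (?\<mu> z) (Suc j)) \<longlongrightarrow> jac_a (?\<mu> 0) (Suc j)) (at_left 0)"
    using Suc.prems by (auto intro!: smooth_ext_tendsto[of 0] smooth_ext_jac_b smooth_ext_sub_coeff smooth_ext_jac_a)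
  have "(?F \<longlongrightarrow> 2 * (real j * jac_b (?\<mu> 0) j + sub_coeff (?\<mu> 0) j) + 1 + (2 - real b) * jac_b (?\<mu> 0) j
     + 0 * (jac_a (?\<mu> 0) (Suc j) + (jac_b (?\<mu> 0) j)\<^sup>2 + jac_a (?\<mu> 0) j)) (at_left 0)"
    by (intro tendsto_intros t)
  from tendsto_at_left_0_unique[OF this delay_string_equation]
  have "2 * (real j * jac_b (?\<mu> 0) j + sub_coeff (?\<mu> 0) j) + 1 + (2 - real b) * jac_b (?\<mu> 0) j = 0" by simp
  with Suc show ?case by (simp add: toda.jac_b_eq algebra_simps)
qed

text \<open>The derivative of the string equation at \<open>z = 0\<close>.\<close>

lemma jac_a_delay_0_rec:
  assumes "2 * j + 5 \<le> b"
  shows "(real b - 2 * real j - 3) * jac_a (delay_moment b 0) (Suc j)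
    = (real b - 2 * real j + 1) * jac_a (delay_moment b 0) j + (jac_b (delay_moment b 0) j)\<^sup>2"
proof -
  let ?a = "\<lambda>i z. jac_a (delay_moment b z) i" and ?b = "\<lambda>i z. jac_b (delay_moment b z) i"
  let ?s = "\<lambda>z. sub_coeff (delay_moment b z) j"
  let ?D = "\<lambda>z. 2 * (real j * (?a (Suc j) z - ?a j z) + ?a j z) + (2 - real b) * (?a (Suc j) z - ?a j z)
     + (?a (Suc j) z + (?b j z)\<^sup>2 + ?a j z)
     + z * (?a (Suc j) z * (?b (Suc j) z - ?b j z) + 2 * ?b j z * (?a (Suc j) z - ?a j z) + ?a j z * (?b j z - ?b (j - 1) z))"
  have D0: "?D z = 0" if "z < 0" for z
  proof -
    let ?F = "\<lambda>z. 2 * (real j * ?b j z + ?s z) + 1 + (2 - real b) * ?b j z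
       + z * (?a (Suc j) z + (?b j z)\<^sup>2 + ?a j z)"
    note d = toda.deriv_jac_a[OF that, where b = b] toda.deriv_jac_b[OF that, where b = b]
      toda.deriv_sub_coeff[OF that, where b = b]
    have "(?F has_real_derivative ?D z) (at z)"
      by (rule derivative_eq_intros d refl | simp add: algebra_simps)+
    moreover have "(?F has_real_derivative 0) (at z)"
      using DERIV_cong_neg[of ?F "\<lambda>_. 0" z 0] delay_string_equation that by simp
    ultimately show ?thesis by (rule DERIV_unique)
  qed
  have t: "((\<lambda>z. ?b i z) \<longlongrightarrow> ?b i 0) (at_left 0)" if "i \<le> Suc j" for i
    using that assms by (auto intro!: smooth_ext_tendsto[of 0] smooth_ext_jac_b)
  have ta: "((\<lambda>z. ?a i z) \<longlongrightarrow> ?a i 0) (at_left 0)" if "i \<le> Suc j" for i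
    using that assms by (auto intro!: smooth_ext_tendsto[of 0] smooth_ext_jac_a)
  have "(?D \<longlongrightarrow> 2 * (real j * (?a (Suc j) 0 - ?a j 0) + ?a j 0) + (2 - real b) * (?a (Suc j) 0 - ?a j 0)
     + (?a (Suc j) 0 + (?b j 0)\<^sup>2 + ?a j 0)
     + 0 * (?a (Suc j) 0 * (?b (Suc j) 0 - ?b j 0) + 2 * ?b j 0 * (?a (Suc j) 0 - ?a j 0) + ?a j 0 * (?b j 0 - ?b (j - 1) 0))) (at_left 0)"
    by (intro tendsto_intros t ta) auto
  from tendsto_at_left_0_unique[OF this D0] show ?thesis by (simp add: algebra_simps)
qed

text \<open>The closed form is the solution of the first-order recursion
  \<open>jac_a_delay_0_rec\<close> starting from 0. At b = 3 n, j = n it becomes 2 / (n^2 - 1), the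
  second cumulant.\<close>

lemma jac_a_delay_0:
  "2 * j + 3 \<le> b \<Longrightarrow> jac_a (delay_moment b 0) j
     = real j * (real b - real j) / ((real b - 2 * real j)\<^sup>2 * ((real b - 2 * real j)\<^sup>2 - 1))"
proof (induction j)
  case 0 show ?case by (simp add: jac_a_def)
next
  case (Suc j)
  \<comment> \<open>In this variable all denominators are products of t + 1, t, t - 1, t - 2, t - 3,
    nonzero because the range of j gives t \<ge> 5.\<close>
  define t where "t = real b - 2 * real j"
  have "real (2 * Suc j + 3) \<le> real b" using Suc.prems by (simp only: of_nat_le_iff)
  then have t5: "t \<ge> 5" by (simp add: t_def)
  have bt: "real b = t + 2 * real j" by (simp add: t_def)
  have s: "t * sub_coeff (delay_moment b 0) j = real j" "(t - 2) * sub_coeff (delay_moment b 0) (Suc j) = real j + 1"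
    using sub_coeff_delay_0[of j b] sub_coeff_delay_0[of "Suc j" b] Suc.prems by (simp_all add: t_def algebra_simps)
  have "jac_b (delay_moment b 0) j = (real j + 1) / (t - 2) - real j / t"
    using s t5 by (simp add: toda.jac_b_eq field_simps)
  also have "\<dots> = real b / (t * (t - 2))" using t5 by (simp add: bt field_simps)
  finally have B: "jac_b (delay_moment b 0) j = real b / (t * (t - 2))" .
  have nz: "t \<noteq> 0" "t - 1 \<noteq> 0" "t - 2 \<noteq> 0" "t - 3 \<noteq> 0" "t + 1 \<noteq> 0" using t5 by auto
  have sq: "t\<^sup>2 - 1 = (t - 1) * (t + 1)" "(t - 2)\<^sup>2 - 1 = (t - 3) * (t - 1)"
    by (simp_all add: power2_eq_square algebra_simps)
  have IH: "(t + 1) * jac_a (delay_moment b 0) j = real j * (t + real j) / (t\<^sup>2 * (t - 1))"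
    using Suc nz by (simp add: t_def[symmetric] sq) (simp add: bt field_simps)
  have "(t - 3) * jac_a (delay_moment b 0) (Suc j) = (t + 1) * jac_a (delay_moment b 0) j + (real b / (t * (t - 2)))\<^sup>2"
    using jac_a_delay_0_rec[of j b] Suc.prems B by (simp add: t_def)
  also have "\<dots> = real j * (t + real j) / (t\<^sup>2 * (t - 1)) + (real b / (t * (t - 2)))\<^sup>2" unfolding IH ..
  also have "\<dots> = (real j + 1) * (t + real j - 1) / ((t - 2)\<^sup>2 * (t - 1))"
    unfolding bt using nz by (simp add: divide_simps) (simp add: power2_eq_square algebra_simps)
  finally have "jac_a (delay_moment b 0) (Suc j) = (real j + 1) * (t + real j - 1) / ((t - 2)\<^sup>2 * (t - 1)) / (t - 3)"
    using nz(4) by (metis nonzero_mult_div_cancel_left)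
  also have "\<dots> = (real j + 1) * (t + real j - 1) / ((t - 2)\<^sup>2 * ((t - 2)\<^sup>2 - 1))"
    unfolding sq by (simp add: mult_ac)
  also have "t - 2 = real b - 2 * real (Suc j)" by (simp add: t_def)
  also have "t + real j - 1 = real b - real (Suc j)" by (simp add: t_def)
  finally show ?case by simp
qed

lemma constant_on_negatives:
  fixes f :: "real \<Rightarrow> real"
  assumes "\<And>z. z < 0 \<Longrightarrow> (f has_real_derivative 0) (at z)" "(f \<longlongrightarrow> l) (at_left 0)" "z < 0"
  shows "f z = l"
proof -
  have "\<exists>c. \<forall>x\<in>{..<0}. f x = c"
    by (rule has_field_derivative_zero_constant) (use assms(1) in \<open>auto intro: has_field_derivative_at_within\<close>)
  then obtain c where "\<And>x. x < 0 \<Longrightarrow> f x = c" by auto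
  then show ?thesis using tendsto_at_left_0_unique[OF assms(2)] assms(3) by simp
qed

text \<open>The difference of two consecutive string equations says that the two sides differ by a
  constant, which is read off at \<open>z = 0\<close>.\<close>

lemma delay_first_integral:
  assumes z: "z < 0" and b: "2 * n + 3 \<le> b" and n: "n > 0"
  shows "z\<^sup>2 * jac_a (delay_moment b z) n * (jac_b (delay_moment b z) n + jac_b (delay_moment b z) (n - 1))
    = (real b - 2 * real n) * (z * jac_a (delay_moment b z) n - sub_coeff (delay_moment b z) n) + real n"
proof -
  let ?a = "\<lambda>i z. jac_a (delay_moment b z) i" and ?b = "\<lambda>i z. jac_b (delay_moment b z) i"
  let ?s = "\<lambda>z. sub_coeff (delay_moment b z) n"
  let ?k = "real b - 2 * real n"
  let ?Y = "\<lambda>z. z\<^sup>2 * ?a n z * (?b n z + ?b (n - 1) z) - ?k * (z * ?a n z - ?s z)"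
  obtain m where m: "n = Suc m" using n by (cases n) auto
  have "(?Y has_real_derivative 0) (at z)" if z: "z < 0" for z
  proof -
    let ?B = "?b n z + ?b m z" and ?D = "?b n z - ?b m z"
    note d = toda.deriv_jac_a[OF z, where b = b] toda.deriv_jac_b[OF z, where b = b]
      toda.deriv_sub_coeff[OF z, where b = b]
    have i1: "2 * (real n * ?b n z + ?s z) + 1 + (2 - real b) * ?b n z + z * (?a (Suc n) z + (?b n z)\<^sup>2 + ?a n z) = 0"
      by (rule delay_string_equation[OF z])
    have "2 * (real m * ?b m z + sub_coeff (delay_moment b z) m) + 1 + (2 - real b) * ?b m z
       + z * (?a n z + (?b m z)\<^sup>2 + ?a m z) = 0"
      using delay_string_equation[OF z, of m b] by (simp add: m)
    then have i2: "2 * ((real n - 1) * ?b m z + ?s z - ?b m z) + 1 + (2 - real b) * ?b m z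
       + z * (?a n z + (?b m z)\<^sup>2 + ?a m z) = 0"
      by (simp add: m sub_coeff_def)
    have "z * (?a (Suc n) z - ?a m z + ?B * ?D) + 2 * ?B - ?k * ?D
       = (2 * (real n * ?b n z + ?s z) + 1 + (2 - real b) * ?b n z + z * (?a (Suc n) z + (?b n z)\<^sup>2 + ?a n z))
        - (2 * ((real n - 1) * ?b m z + ?s z - ?b m z) + 1 + (2 - real b) * ?b m z
       + z * (?a n z + (?b m z)\<^sup>2 + ?a m z))"
      by (simp add: algebra_simps power2_eq_square)
    also have "\<dots> = 0" unfolding i1 i2 by simp
    finally have key: "z * (?a (Suc n) z - ?a m z + ?B * ?D) + 2 * ?B - ?k * ?D = 0" .
    \<comment> \<open>z times \<open>jac_a\<close> is the integrating factor that turns the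
      difference of the string equations into an exact derivative.\<close>
    have "((\<lambda>z. z\<^sup>2 * ?a n z * (?b n z + ?b m z) - ?k * (z * ?a n z - ?s z)) has_real_derivative
        z * ?a n z * (z * (?a (Suc n) z - ?a m z + ?B * ?D) + 2 * ?B - ?k * ?D)) (at z)"
      by (rule derivative_eq_intros d refl | simp add: algebra_simps power2_eq_square m)+
    then show ?thesis unfolding key by (simp add: m)
  qed
  moreover have "(?Y \<longlongrightarrow> real n) (at_left 0)"
  proof -
    have tb: "((\<lambda>z. ?b i z) \<longlongrightarrow> ?b i 0) (at_left 0)" if "i \<le> n" for i
      using that b by (auto intro!: smooth_ext_tendsto[of 0] smooth_ext_jac_b)
    have ta: "((\<lambda>z. ?a n z) \<longlongrightarrow> ?a n 0) (at_left 0)"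
      using b by (auto intro!: smooth_ext_tendsto[of 0] smooth_ext_jac_a)
    have ts: "(?s \<longlongrightarrow> ?s 0) (at_left 0)"
      using b by (auto intro!: smooth_ext_tendsto[of 0] smooth_ext_sub_coeff)
    have "(?Y \<longlongrightarrow> 0\<^sup>2 * ?a n 0 * (?b n 0 + ?b (n - 1) 0) - ?k * (0 * ?a n 0 - ?s 0)) (at_left 0)"
      by (intro tendsto_intros ta tb ts) auto
    then show ?thesis using sub_coeff_delay_0[of n b] b by simp
  qed
  ultimately have "?Y z = real n" using z by (rule constant_on_negatives)
  then show ?thesis by simp
qed

text \<open>With \<open>a = \<sigma>'\<close> one has \<open>a' = a D\<close> and \<open>a'' = a D\<^sup>2 + a D'\<close>. The left-hand side is
  \<open>2 z\<^sup>3 a\<^sup>2\<close> times the sum of two consecutive string equations.\<close>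

theorem delay_third_order_equation:
  assumes z: "z < 0" and b: "2 * n + 3 \<le> b" and n: "n > 0"
  defines "\<sigma> \<equiv> sub_coeff (delay_moment b z) n" and "a \<equiv> jac_a (delay_moment b z) n"
    and "D \<equiv> jac_b (delay_moment b z) n - jac_b (delay_moment b z) (n - 1)"
    and "D' \<equiv> jac_a (delay_moment b z) (Suc n) - 2 * jac_a (delay_moment b z) n + jac_a (delay_moment b z) (n - 1)"
    and "k \<equiv> real b - 2 * real n"
  shows "2 * z ^ 4 * a * (a * D * D + a * D') - z ^ 4 * (a * D)\<^sup>2 + 4 * z ^ 3 * a * (a * D)
    + 8 * z ^ 3 * a\<^sup>2 * (z * a + \<sigma>) + 4 * z ^ 3 * a\<^sup>2 + (real n - k * \<sigma>)\<^sup>2 - k\<^sup>2 * z\<^sup>2 * a\<^sup>2 = 0"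
proof -
  obtain m where m: "n = Suc m" using n by (cases n) auto
  define p where "p = jac_b (delay_moment b z) n"
  define q where "q = jac_b (delay_moment b z) m"
  define a1 where "a1 = jac_a (delay_moment b z) (Suc n)"
  define a0 where "a0 = jac_a (delay_moment b z) m"
  have D: "D = p - q" and D': "D' = a1 - 2 * a + a0"
    by (simp_all add: D_def D'_def p_def q_def a1_def a0_def a_def m)
  have i1: "2 * (real n * p + \<sigma>) + 1 + (2 - real b) * p + z * (a1 + p\<^sup>2 + a) = 0"
    using delay_string_equation[OF z, of n b] by (simp add: \<sigma>_def p_def a1_def a_def)
  have "2 * (real m * q + sub_coeff (delay_moment b z) m) + 1 + (2 - real b) * q + z * (a + q\<^sup>2 + a0) = 0"
    using delay_string_equation[OF z, of m b] by (simp add: q_def a0_def a_def m)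
  then have i2: "2 * ((real n - 1) * q + \<sigma> - q) + 1 + (2 - real b) * q + z * (a + q\<^sup>2 + a0) = 0"
    by (simp add: m \<sigma>_def q_def sub_coeff_def)
  \<comment> \<open>This eliminates p + q. In the sum of the string equations p^2 + q^2 is half of
    (p + q)^2 + (p - q)^2: the second square is D^2, and the first is supplied by squaring this
    relation.\<close>
  have fi: "real n - k * \<sigma> = z\<^sup>2 * a * (p + q) - k * z * a"
    using delay_first_integral[OF z b n]
    by (simp add: p_def q_def a_def \<sigma>_def k_def m algebra_simps)
  have "2 * z ^ 4 * a * (a * D * D + a * D') - z ^ 4 * (a * D)\<^sup>2 + 4 * z ^ 3 * a * (a * D)
    + 8 * z ^ 3 * a\<^sup>2 * (z * a + \<sigma>) + 4 * z ^ 3 * a\<^sup>2 + (real n - k * \<sigma>)\<^sup>2 - k\<^sup>2 * z\<^sup>2 * a\<^sup>2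
    = 2 * z ^ 3 * a\<^sup>2 * ((2 * (real n * p + \<sigma>) + 1 + (2 - real b) * p + z * (a1 + p\<^sup>2 + a))
       + (2 * ((real n - 1) * q + \<sigma> - q) + 1 + (2 - real b) * q + z * (a + q\<^sup>2 + a0)))"
    unfolding fi unfolding D D' k_def by (simp add: power2_eq_square power3_eq_cube power4_eq_xxxx algebra_simps)
  then show ?thesis unfolding i1 i2 by simp
qed

section \<open>Cumulants\<close>

lemma smooth_ext_ln:
  assumes "smooth_ext r f" "\<And>z. z \<le> 0 \<Longrightarrow> f z > 0"
  shows "smooth_ext r (\<lambda>z. ln (f z))"
proof -
  obtain A where A: "smooth_exp r f A" "fps_nth A 0 = f 0"
    using assms(1) unfolding smooth_ext_def by blast
  have "smooth_exp r (\<lambda>z. ln (f z)) (fps_integral (fps_deriv A * inverse A) (ln (fps_nth A 0)))"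
    by (rule smooth_exp_ln[OF A(1)]) (use assms(2) A(2) in auto)
  then show ?thesis unfolding smooth_ext_def using A(2) by (auto intro!: exI simp del: smooth_exp.simps)
qed

text \<open>Once the coefficients below i vanish, dividing by z^i leaves c i as the limit at
  0.\<close>

lemma poly_smallo_coeff_0:
  fixes c :: "nat \<Rightarrow> real"
  assumes "(\<lambda>z. \<Sum>i\<le>n. c i * z ^ i) \<in> o[at_left 0](\<lambda>z. z ^ n)" "i \<le> n"
  shows "c i = 0"
  using assms(2)
proof (induction i rule: less_induct)
  case (less i)
  let ?f = "\<lambda>z. \<Sum>i\<le>n. c i * z ^ i"
  have ev: "\<forall>\<^sub>F z in at_left 0. -1 < z \<and> z < (0::real)"
    by (simp add: eventually_at_left_field) (auto intro!: exI[of _ "-1"])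
  have "(\<lambda>z::real. z ^ n) \<in> O[at_left 0](\<lambda>z. z ^ i)"
    by (rule bigoI[of _ 1], rule eventually_mono[OF ev])
       (use less.prems in \<open>auto simp: power_abs intro!: power_decreasing\<close>)
  with assms(1) have "?f \<in> o[at_left 0](\<lambda>z. z ^ i)" by (rule landau_o.small_big_trans)
  then have "((\<lambda>z. ?f z / z ^ i) \<longlongrightarrow> 0) (at_left 0)" by (rule smalloD_tendsto)
  moreover have "((\<lambda>z. ?f z / z ^ i) \<longlongrightarrow> c i) (at_left 0)"
  proof (rule Lim_transform_eventually)
    have "((\<lambda>z. \<Sum>j\<in>{i..n}. c j * z ^ (j - i)) \<longlongrightarrow> (\<Sum>j\<in>{i..n}. c j * 0 ^ (j - i))) (at_left 0)"
      by (intro tendsto_intros)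
    also have "(\<Sum>j\<in>{i..n}. c j * 0 ^ (j - i)) = (\<Sum>j\<in>{i..n}. if j = i then c i else 0)"
      by (intro sum.cong) auto
    also have "\<dots> = c i" using less.prems by simp
    finally show "((\<lambda>z. \<Sum>j\<in>{i..n}. c j * z ^ (j - i)) \<longlongrightarrow> c i) (at_left 0)" .
    show "\<forall>\<^sub>F z in at_left 0. (\<Sum>j\<in>{i..n}. c j * z ^ (j - i)) = ?f z / z ^ i"
    proof (rule eventually_mono[OF ev])
      fix z :: real assume z: "-1 < z \<and> z < 0"
      have "?f z = (\<Sum>j\<in>{i..n}. c j * z ^ j)"
        by (rule sum.mono_neutral_right) (use less in auto)
      also have "\<dots> = (\<Sum>j\<in>{i..n}. c j * z ^ (j - i)) * z ^ i"
        unfolding sum_distrib_right by (intro sum.cong) (auto simp: mult.assoc simp flip: power_add)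
      finally show "(\<Sum>j\<in>{i..n}. c j * z ^ (j - i)) = ?f z / z ^ i" using z by simp
    qed
  qed
  ultimately show ?case using tendsto_unique[of "at_left (0::real)"] by fastforce
qed

text \<open>The definite description needs uniqueness: the difference of two expansions is a
  polynomial of degree at most n that is o(z^n), hence zero.\<close>

lemma delay_cumulant_eq:
  assumes A: "smooth_exp n (\<lambda>z. ln (delay_mgf n z)) A" "fps_nth A 0 = 0" and l: "1 \<le> l" "l \<le> n"
  shows "delay_cumulant n l = fact l * fps_nth A l"
proof -
  have split: "(\<Sum>i\<le>n. c i * z ^ i) = c 0 + (\<Sum>i=1..n. c i * z ^ i)" for c :: "nat \<Rightarrow> real" and z
    by (subst atMost_atLeast0, subst sum.atLeast_Suc_atMost) auto
  let ?K = "\<lambda>l. fact l * fps_nth A l"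
  have K: "log_mgf_expansion n ?K"
    using smooth_exp_taylor[OF A(1)] A(2) unfolding log_mgf_expansion_def split by simp
  have U: "K l = ?K l" if K': "log_mgf_expansion n K" for K
  proof -
    define c where "c i = (if i = 0 then 0 else K i / fact i - ?K i / fact i)" for i
    have "(\<lambda>z. (ln (delay_mgf n z) - (\<Sum>l=1..n. ?K l / fact l * z ^ l))
       - (ln (delay_mgf n z) - (\<Sum>l=1..n. K l / fact l * z ^ l))) \<in> o[at_left 0](\<lambda>z. z ^ n)"
      using K K' unfolding log_mgf_expansion_def by (rule sum_in_smallo(2))
    moreover have "(ln (delay_mgf n z) - (\<Sum>l=1..n. ?K l / fact l * z ^ l))
       - (ln (delay_mgf n z) - (\<Sum>l=1..n. K l / fact l * z ^ l)) = (\<Sum>i\<le>n. c i * z ^ i)" for z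
      unfolding split by (simp add: c_def left_diff_distrib sum_subtractf)
    ultimately have "(\<lambda>z. \<Sum>i\<le>n. c i * z ^ i) \<in> o[at_left 0](\<lambda>z. z ^ n)" by simp
    from poly_smallo_coeff_0[OF this l(2)] show ?thesis using l(1) by (simp add: c_def field_simps)
  qed
  show ?thesis unfolding delay_cumulant_def
    by (rule the_equality) (use K U in blast)+
qed

lemma ln_delay_mgf:
  assumes "z \<le> 0"
  shows "ln (delay_mgf n z)
    = (\<Sum>j<n. ln (sqnorm (delay_moment (3 * n) z) j) - ln (sqnorm (delay_moment (3 * n) 0) j))"
proof -
  have p: "sqnorm (delay_moment (3 * n) y) j > 0" if "j < n" "y \<le> 0" for y j
    using that by (intro sqnorm_delay_pos_nonpos) auto
  have "delay_mgf n z = (\<Prod>j<n. sqnorm (delay_moment (3 * n) z) j) / (\<Prod>j<n. sqnorm (delay_moment (3 * n) 0) j)"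
    using assms by (simp add: delay_mgf_def delay_integral_eq)
  moreover have "(\<Prod>j<n. sqnorm (delay_moment (3 * n) y) j) > 0" if "y \<le> 0" for y
    by (intro prod_pos) (use p that in auto)
  ultimately have "ln (delay_mgf n z)
     = ln (\<Prod>j<n. sqnorm (delay_moment (3 * n) z) j) - ln (\<Prod>j<n. sqnorm (delay_moment (3 * n) 0) j)"
    using assms by (simp only: ln_divide_pos order.refl)
  moreover have "ln (\<Prod>j<n. sqnorm (delay_moment (3 * n) y) j) = (\<Sum>j<n. ln (sqnorm (delay_moment (3 * n) y) j))" if "y \<le> 0" for y
    by (rule ln_prod) (use p[OF _ that] in \<open>force+\<close>)
  ultimately show ?thesis using assms by (simp only: sum_subtractf order.refl)
qed

text \<open>For the last norm, j = n - 1, the requirement 2 j + n + 2 \<le> 3 n is an equality: the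
  available order is precisely the one used in the definition of the cumulants.\<close>

lemma smooth_ext_ln_delay_mgf: "smooth_ext n (\<lambda>z. ln (delay_mgf n z))"
proof -
  have "smooth_ext n (\<lambda>z. \<Sum>j<n. ln (sqnorm (delay_moment (3 * n) z) j) - ln (sqnorm (delay_moment (3 * n) 0) j))"
    by (intro smooth_ext_sum smooth_ext_diff smooth_ext_ln smooth_ext_const smooth_ext_sqnorm sqnorm_delay_pos_nonpos)
       auto
  then obtain A where "smooth_exp n (\<lambda>z. \<Sum>j<n. ln (sqnorm (delay_moment (3 * n) z) j) - ln (sqnorm (delay_moment (3 * n) 0) j)) A"
      "fps_nth A 0 = 0"
    unfolding smooth_ext_def by auto
  moreover have "ln (delay_mgf n 0) = 0" by (subst ln_delay_mgf) auto
  ultimately show ?thesis unfolding smooth_ext_def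
    by (auto intro!: exI[of _ A] smooth_exp_cong[OF _ ln_delay_mgf[symmetric]] simp del: smooth_exp.simps)
qed

lemma deriv_ln_delay_mgf:
  assumes "z < 0"
  shows "((\<lambda>z. ln (delay_mgf n z)) has_real_derivative sub_coeff (delay_moment (3 * n) z) n) (at z)"
proof -
  have p: "sqnorm (delay_moment (3 * n) z) j > 0" for j
    using assms by (intro sqnorm_delay_pos) auto
  have "((\<lambda>z. ln (sqnorm (delay_moment (3 * n) z) j) - ln (sqnorm (delay_moment (3 * n) 0) j))
      has_real_derivative jac_b (delay_moment (3 * n) z) j) (at z)" for j
    using p[of j] by (auto intro!: derivative_eq_intros toda.deriv_sqnorm assms)
  then have "((\<lambda>z. \<Sum>j<n. ln (sqnorm (delay_moment (3 * n) z) j) - ln (sqnorm (delay_moment (3 * n) 0) j))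
      has_real_derivative (\<Sum>j<n. jac_b (delay_moment (3 * n) z) j)) (at z)"
    by (intro DERIV_sum)
  then show ?thesis unfolding sub_coeff_def[symmetric]
    using DERIV_cong_neg[OF ln_delay_mgf assms] by simp
qed

text \<open>The equation of \<open>delay_third_order_equation\<close> for series; with b = 3 n its
  constant k = b - 2 n is n itself, so a single parameter N is left.\<close>

definition third_order :: "real \<Rightarrow> real fps \<Rightarrow> real fps" where
  "third_order N s = (let s1 = fps_deriv s; s2 = fps_deriv s1; s3 = fps_deriv s2 in
     fps_const 2 * fps_X ^ 4 * s1 * s3 - fps_X ^ 4 * s2 ^ 2 + fps_const 4 * fps_X ^ 3 * s1 * s2
     + fps_const 8 * fps_X ^ 3 * s1 ^ 2 * (fps_X * s1 + s) + fps_const 4 * fps_X ^ 3 * s1 ^ 2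
     + (fps_const N - fps_const N * s) ^ 2 - fps_const (N ^ 2) * fps_X ^ 2 * s1 ^ 2)"

text \<open>Differentiating the logarithm gives \<sigma> to order n - 1, and its three derivatives
  to orders n - 2, n - 3 and n - 4; hence the range i + 4 \<le> n.\<close>

theorem delay_cumulant_third_order:
  assumes n: "n \<ge> 4"
  obtains s where "\<And>l. 1 \<le> l \<Longrightarrow> l \<le> n \<Longrightarrow> delay_cumulant n l = fact (l - 1) * fps_nth s (l - 1)"
    and "fps_nth s 0 = 1" and "fps_nth s 1 = 2 / ((real n)\<^sup>2 - 1)"
    and "\<And>i. i + 4 \<le> n \<Longrightarrow> fps_nth (third_order (real n) s) i = 0"
proof -
  let ?\<mu> = "delay_moment (3 * n)"
  obtain A where A: "smooth_exp n (\<lambda>z. ln (delay_mgf n z)) A" "fps_nth A 0 = ln (delay_mgf n 0)"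
    using smooth_ext_ln_delay_mgf[of n] unfolding smooth_ext_def by blast
  have A0: "fps_nth A 0 = 0" unfolding A(2) by (subst ln_delay_mgf) auto
  define s where "s = fps_deriv A"
  obtain m where m: "n = m + 4" using n by (metis add.commute le_Suc_ex)
  let ?a = "\<lambda>z. jac_a (?\<mu> z) n"
  let ?D = "\<lambda>z. jac_b (?\<mu> z) n - jac_b (?\<mu> z) (n - 1)"
  let ?D' = "\<lambda>z. jac_a (?\<mu> z) (Suc n) - 2 * jac_a (?\<mu> z) n + jac_a (?\<mu> z) (n - 1)"
  let ?s = "\<lambda>z. sub_coeff (?\<mu> z) n"
  have "smooth_exp (Suc (m + 3)) (\<lambda>z. ln (delay_mgf n z)) A" by (rule smooth_exp_mono[OF A(1)]) (simp add: m)
  then have s: "smooth_exp (m + 3) ?s s"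
    unfolding s_def by (rule smooth_exp_deriv) (rule deriv_ln_delay_mgf)
  then have "smooth_exp (Suc (m + 2)) ?s s" by (rule smooth_exp_mono) simp
  then have s1: "smooth_exp (m + 2) ?a (fps_deriv s)"
    by (rule smooth_exp_deriv) (rule toda.deriv_sub_coeff)
  then have "smooth_exp (Suc (m + 1)) ?a (fps_deriv s)" by (rule smooth_exp_mono) simp
  then have s2: "smooth_exp (m + 1) (\<lambda>z. ?a z * ?D z) (fps_deriv (fps_deriv s))"
    by (rule smooth_exp_deriv) (rule toda.deriv_jac_a)
  then have "smooth_exp (Suc m) (\<lambda>z. ?a z * ?D z) (fps_deriv (fps_deriv s))" by (rule smooth_exp_mono) simp
  then have s3: "smooth_exp m (\<lambda>z. ?a z * ?D z * ?D z + ?a z * ?D' z) (fps_deriv (fps_deriv (fps_deriv s)))"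
  proof (rule smooth_exp_deriv)
    fix z :: real assume z: "z < 0"
    show "((\<lambda>z. ?a z * ?D z) has_real_derivative ?a z * ?D z * ?D z + ?a z * ?D' z) (at z)"
      using m by (auto intro!: derivative_eq_intros toda.deriv_jac_a[OF z] toda.deriv_jac_b[OF z] simp: algebra_simps)
  qed
  note sm = smooth_exp_mono[OF s, of m] smooth_exp_mono[OF s1, of m] smooth_exp_mono[OF s2, of m] s3
  let ?E = "\<lambda>z. 2 * z ^ 4 * ?a z * (?a z * ?D z * ?D z + ?a z * ?D' z) - z ^ 4 * (?a z * ?D z)\<^sup>2
    + 4 * z ^ 3 * ?a z * (?a z * ?D z) + 8 * z ^ 3 * (?a z)\<^sup>2 * (z * ?a z + ?s z) + 4 * z ^ 3 * (?a z)\<^sup>2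
    + (real n - real n * ?s z)\<^sup>2 - (real n)\<^sup>2 * z\<^sup>2 * (?a z)\<^sup>2"
  have "smooth_exp m ?E (third_order (real n) s)"
    unfolding third_order_def Let_def
    by (intro smooth_exp_add smooth_exp_diff smooth_exp_mult smooth_exp_power smooth_exp_const smooth_exp_X sm) auto
  moreover have "?E z = 0" if "z < 0" for z
    using delay_third_order_equation[OF that, of n "3 * n"] n by simp
  ultimately have "smooth_exp m (\<lambda>_. 0) (third_order (real n) s)" by (rule smooth_exp_cong)
  then have "fps_nth (third_order (real n) s) i = fps_nth (fps_const 0) i" if "i \<le> m" for i
    using smooth_exp_unique[OF _ smooth_exp_const[of m 0] that] by blast
  then have 4: "fps_nth (third_order (real n) s) i = 0" if "i + 4 \<le> n" for i
    using that m by simp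
  have "smooth_ext 0 ?s" "smooth_ext 0 ?a" using n by (auto intro!: smooth_ext_sub_coeff smooth_ext_jac_a)
  then have "(?s \<longlongrightarrow> ?s 0) (at_left 0)" "(?a \<longlongrightarrow> ?a 0) (at_left 0)" by (auto dest: smooth_ext_tendsto)
  then have "fps_nth s 0 = ?s 0" "fps_nth (fps_deriv s) 0 = ?a 0"
    using s[THEN smooth_exp_tendsto] s1[THEN smooth_exp_tendsto] tendsto_unique[of "at_left (0::real)"] by auto
  moreover have "real n * ?s 0 = real n" using sub_coeff_delay_0[of n "3 * n"] n by simp
  then have "?s 0 = 1" using n by simp
  moreover have "?a 0 = 2 / ((real n)\<^sup>2 - 1)"
    using jac_a_delay_0[of n "3 * n"] n by (simp add: power2_eq_square)
  ultimately have 2: "fps_nth s 0 = 1" "fps_nth s 1 = 2 / ((real n)\<^sup>2 - 1)" by simp_all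
  have "delay_cumulant n l = fact (l - 1) * fps_nth s (l - 1)" if "1 \<le> l" "l \<le> n" for l
    using delay_cumulant_eq[OF A(1) A0 that] that(1) by (cases l) (simp_all add: s_def)
  then show ?thesis using that 2 4 by blast
qed

section \<open>Scaling limit\<close>

text \<open>The coefficient of degree j in u^2 (8 u + 8 g + 4), where u = X g'. The sum starts at 2
  because u has no constant term, and the conditional 4 is the constant of the last factor.\<close>

definition cubic_coeff :: "nat \<Rightarrow> (nat \<Rightarrow> real) \<Rightarrow> real" where
  "cubic_coeff j g = (\<Sum>i\<in>{2..j}. (\<Sum>a\<in>{1..<i}. real a * g a * (real (i - a) * g (i - a))) *
      (8 * (real (j - i) + 1) * g (j - i) + (if i = j then 4 else 0)))"

text \<open>The weight of g_a g_b in e (2 u w - v^2 + 4 u v) + (1 - g)^2 - u^2, with u, v, w as in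
  \<open>cumulant_equation\<close> and a, b positive. It is not symmetric, and sums run over ordered
  pairs.\<close>

definition pair_weight :: "real \<Rightarrow> nat \<Rightarrow> nat \<Rightarrow> real" where
  "pair_weight e a b = 1 - real a * real b + e * (real a * real b) *
     (2 * (real b - 1) * (real b - 2) - (real a - 1) * (real b - 1) + 4 * (real b - 1))"

definition lower_terms :: "real \<Rightarrow> nat \<Rightarrow> (nat \<Rightarrow> real) \<Rightarrow> real" where
  "lower_terms e j g = (\<Sum>a\<in>{2..<j}. pair_weight e a (Suc j - a) * g a * g (Suc j - a)) + cubic_coeff j g"

text \<open>With \<open>e = 1\<close>, \<open>c = N\<^sup>2\<close> this is the third-order equation; after rescaling the variable by
  \<open>N\<^sup>2\<close> and dividing by \<open>N\<^sup>2\<close> it becomes the case \<open>e = 1 / N\<^sup>2\<close>, \<open>c = 1\<close>.\<close>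

definition cumulant_equation :: "real \<Rightarrow> real \<Rightarrow> real fps \<Rightarrow> real fps" where
  "cumulant_equation e c g = (let u = fps_X * fps_deriv g; v = fps_X ^ 2 * fps_deriv (fps_deriv g);
       w = fps_X ^ 3 * fps_deriv (fps_deriv (fps_deriv g)) in
     fps_const e * (2 * u * w - v * v + 4 * u * v) + fps_X * (u * u * (8 * u + 8 * g + 4))
     + fps_const c * ((1 - g) * (1 - g) - u * u))"

lemma third_order_eq: "third_order N s = cumulant_equation 1 (N\<^sup>2) s"
proof -
  have "fps_const N - fps_const N * s = fps_const N * (1 - s)" by (simp add: algebra_simps)
  then have "(fps_const N - fps_const N * s)\<^sup>2 = fps_const (N\<^sup>2) * (1 - s)\<^sup>2"
    by (simp add: power_mult_distrib fps_const_power)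
  moreover have nums: "fps_const 2 = (2 :: real fps)" "fps_const 4 = (4 :: real fps)" "fps_const 8 = (8 :: real fps)"
    by (simp_all add: numeral_fps_const)
  ultimately show ?thesis
    unfolding third_order_def cumulant_equation_def Let_def nums
    by (simp add: power2_eq_square power3_eq_cube power4_eq_xxxx algebra_simps)
qed

section \<open>Coefficients of the rescaled equation and convergence\<close>

lemma fps_nth_X_power_deriv:
  "fps_nth (fps_X * fps_deriv g) j = real j * fps_nth g j"
  "fps_nth (fps_X ^ 2 * fps_deriv (fps_deriv g)) j = real j * (real j - 1) * fps_nth g j"
  "fps_nth (fps_X ^ 3 * fps_deriv (fps_deriv (fps_deriv g))) j = real j * (real j - 1) * (real j - 2) * fps_nth g j"
  for g :: "real fps"
proof -
  show "fps_nth (fps_X * fps_deriv g) j = real j * fps_nth g j" by (cases j) auto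
  show "fps_nth (fps_X ^ 2 * fps_deriv (fps_deriv g)) j = real j * (real j - 1) * fps_nth g j"
    by (cases j; cases "j - 1") (auto simp: power2_eq_square mult.assoc)
  show "fps_nth (fps_X ^ 3 * fps_deriv (fps_deriv (fps_deriv g))) j = real j * (real j - 1) * (real j - 2) * fps_nth g j"
    by (cases j; cases "j - 1"; cases "j - 2") (auto simp: power3_eq_cube mult.assoc)
qed

lemma fps_nth_cubic:
  fixes g :: "real fps"
  defines "u \<equiv> fps_X * fps_deriv g"
  shows "fps_nth (u * u * (8 * u + 8 * g + 4)) j = cubic_coeff j (fps_nth g)"
proof -
  have u: "fps_nth u i = real i * fps_nth g i" for i unfolding u_def by (rule fps_nth_X_power_deriv)
  have uu: "fps_nth (u * u) i = (\<Sum>a\<in>{1..<i}. real a * fps_nth g a * (real (i - a) * fps_nth g (i - a)))" for i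
    unfolding fps_mult_nth u by (rule sum.mono_neutral_right) auto
  have 4: "fps_nth (4 :: real fps) i = (if i = 0 then 4 else 0)" for i
    by (simp add: numeral_fps_const)
  have h: "fps_nth (8 * u + 8 * g + 4) (j - i) = 8 * (real (j - i) + 1) * fps_nth g (j - i) + (if i = j then 4 else 0)" if "i \<le> j" for i
    using that by (simp add: u 4 numeral_fps_const algebra_simps)
  have "fps_nth (u * u * (8 * u + 8 * g + 4)) j
      = (\<Sum>i=0..j. fps_nth (u * u) i * fps_nth (8 * u + 8 * g + 4) (j - i))"
    by (rule fps_mult_nth)
  also have "\<dots> = (\<Sum>i\<in>{2..j}. fps_nth (u * u) i * fps_nth (8 * u + 8 * g + 4) (j - i))"
    by (rule sum.mono_neutral_right) (auto simp: uu not_le less_2_cases_iff)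
  also have "\<dots> = cubic_coeff j (fps_nth g)"
    unfolding cubic_coeff_def
  proof (intro sum.cong refl)
    fix i assume "i \<in> {2..j}"
    then have "i \<le> j" by simp
    then show "fps_nth (u * u) i * fps_nth (8 * u + 8 * g + 4) (j - i)
      = (\<Sum>a = 1..<i. real a * fps_nth g a * (real (i - a) * fps_nth g (i - a))) *
        (8 * (real (j - i) + 1) * fps_nth g (j - i) + (if i = j then 4 else 0))"
      by (simp only: h uu)
  qed
  finally show ?thesis .
qed

text \<open>Since g has constant term 1, none of 1 - g, u, v, w has one, so the outer pairs a = 0
  and a = j + 1 drop out. The pairs a = 1 and a = j, distinct for j \<ge> 2, carry all occurrences
  of g_j and together form the last term.\<close>

lemma fps_nth_cumulant_equation:
  fixes g :: "real fps"
  assumes g0: "fps_nth g 0 = 1" and j: "j \<ge> 2" and c: "c \<noteq> 0"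
  shows "fps_nth (cumulant_equation e c g) (Suc j)
    = (\<Sum>a\<in>{2..<j}. c * pair_weight (e / c) a (Suc j - a) * fps_nth g a * fps_nth g (Suc j - a))
      + cubic_coeff j (fps_nth g) - 2 * (real j - 1) * (c - e * (real j)\<^sup>2) * fps_nth g 1 * fps_nth g j"
proof -
  let ?g = "fps_nth g"
  let ?u = "fps_X * fps_deriv g" and ?v = "fps_X ^ 2 * fps_deriv (fps_deriv g)"
    and ?w = "fps_X ^ 3 * fps_deriv (fps_deriv (fps_deriv g))"
  let ?t = "\<lambda>a. c * pair_weight (e / c) a (Suc j - a) * ?g a * ?g (Suc j - a)"
  have "fps_nth (cumulant_equation e c g) (Suc j) =
     e * (2 * fps_nth (?u * ?w) (Suc j) - fps_nth (?v * ?v) (Suc j) + 4 * fps_nth (?u * ?v) (Suc j))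
     + cubic_coeff j ?g + c * (fps_nth ((1 - g) * (1 - g)) (Suc j) - fps_nth (?u * ?u) (Suc j))"
    unfolding cumulant_equation_def Let_def fps_nth_cubic[symmetric]
    by (simp add: mult.assoc numeral_fps_const)
  also have "e * (2 * fps_nth (?u * ?w) (Suc j) - fps_nth (?v * ?v) (Suc j) + 4 * fps_nth (?u * ?v) (Suc j))
     + cubic_coeff j ?g + c * (fps_nth ((1 - g) * (1 - g)) (Suc j) - fps_nth (?u * ?u) (Suc j))
     = (\<Sum>a=0..Suc j. e * (2 * (fps_nth ?u a * fps_nth ?w (Suc j - a)) - fps_nth ?v a * fps_nth ?v (Suc j - a)
          + 4 * (fps_nth ?u a * fps_nth ?v (Suc j - a)))
          + c * (fps_nth (1 - g) a * fps_nth (1 - g) (Suc j - a) - fps_nth ?u a * fps_nth ?u (Suc j - a)))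
       + cubic_coeff j ?g"
    unfolding fps_mult_nth[of _ _ "Suc j"] by (simp only: sum.distrib sum_subtractf sum_distrib_left[symmetric])
  also have "(\<Sum>a=0..Suc j. e * (2 * (fps_nth ?u a * fps_nth ?w (Suc j - a)) - fps_nth ?v a * fps_nth ?v (Suc j - a)
          + 4 * (fps_nth ?u a * fps_nth ?v (Suc j - a)))
          + c * (fps_nth (1 - g) a * fps_nth (1 - g) (Suc j - a) - fps_nth ?u a * fps_nth ?u (Suc j - a)))
     = (\<Sum>a=0..Suc j. if a = 0 \<or> a = Suc j then 0 else ?t a)"
  proof (rule sum.cong[OF refl])
    fix a assume a: "a \<in> {0..Suc j}"
    show "e * (2 * (fps_nth ?u a * fps_nth ?w (Suc j - a)) - fps_nth ?v a * fps_nth ?v (Suc j - a)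
          + 4 * (fps_nth ?u a * fps_nth ?v (Suc j - a)))
          + c * (fps_nth (1 - g) a * fps_nth (1 - g) (Suc j - a) - fps_nth ?u a * fps_nth ?u (Suc j - a))
       = (if a = 0 \<or> a = Suc j then 0 else ?t a)"
    proof (cases "a = 0 \<or> a = Suc j")
      case True
      then show ?thesis by (auto simp: fps_nth_X_power_deriv g0)
    next
      case False
      define b where "b = Suc j - a"
      have "fps_nth (1 - g) a = - ?g a" "fps_nth (1 - g) b = - ?g b" using False a by (auto simp: b_def)
      then show ?thesis using False c unfolding b_def[symmetric] fps_nth_X_power_deriv pair_weight_def
        by (simp add: field_simps)
    qed
  qed
  also have "\<dots> = (\<Sum>a\<in>insert 1 (insert j {2..<j}). ?t a)"
    by (rule sum.mono_neutral_cong_right) (use j in auto)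
  also have "\<dots> = ?t 1 + (?t j + (\<Sum>a\<in>{2..<j}. ?t a))"
    using j by (subst sum.insert, simp, simp, subst sum.insert) auto
  also have "?t 1 + (?t j + (\<Sum>a\<in>{2..<j}. ?t a))
      = (\<Sum>a\<in>{2..<j}. ?t a) - 2 * (real j - 1) * (c - e * (real j)\<^sup>2) * ?g 1 * ?g j"
  proof -
    have "c * pair_weight (e / c) 1 j + c * pair_weight (e / c) j 1 = - 2 * (real j - 1) * (c - e * (real j)\<^sup>2)"
      using c by (simp add: pair_weight_def field_simps power2_eq_square)
    then have "(c * pair_weight (e / c) 1 j + c * pair_weight (e / c) j 1) * (?g 1 * ?g j)
       = (- 2 * (real j - 1) * (c - e * (real j)\<^sup>2)) * (?g 1 * ?g j)" by simp
    then show ?thesis by (simp add: algebra_simps)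
  qed
  finally show ?thesis by simp
qed

text \<open>Weighted homogeneity: the indices in each summand add up to j.\<close>

lemma cubic_coeff_scale: "cubic_coeff j (\<lambda>a. g a * x ^ a) = cubic_coeff j g * x ^ j"
proof -
  have "(\<Sum>a = 1..<i. real a * (g a * x ^ a) * (real (i - a) * (g (i - a) * x ^ (i - a)))) *
         (8 * (real (j - i) + 1) * (g (j - i) * x ^ (j - i)) + (if i = j then 4 else 0))
     = (\<Sum>a = 1..<i. real a * g a * (real (i - a) * g (i - a))) *
         (8 * (real (j - i) + 1) * g (j - i) + (if i = j then 4 else 0)) * x ^ j" if i: "i \<in> {2..j}" for i
  proof -
    have "(\<Sum>a\<in>{1..<i}. real a * (g a * x ^ a) * (real (i - a) * (g (i - a) * x ^ (i - a))))
       = (\<Sum>a\<in>{1..<i}. real a * g a * (real (i - a) * g (i - a))) * x ^ i"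
      unfolding sum_distrib_right
    proof (intro sum.cong refl)
      fix a assume "a \<in> {1..<i}"
      then have "x ^ i = x ^ a * x ^ (i - a)" by (simp flip: power_add)
      then show "real a * (g a * x ^ a) * (real (i - a) * (g (i - a) * x ^ (i - a)))
        = real a * g a * (real (i - a) * g (i - a)) * x ^ i" by (simp add: mult_ac)
    qed
    moreover have "8 * (real (j - i) + 1) * (g (j - i) * x ^ (j - i)) + (if i = j then 4 else 0)
       = (8 * (real (j - i) + 1) * g (j - i) + (if i = j then 4 else 0)) * x ^ (j - i)"
      by (simp add: algebra_simps)
    moreover have "x ^ j = x ^ i * x ^ (j - i)" using i by (simp flip: power_add)
    ultimately show ?thesis
      by (simp only: mult_ac)
  qed
  then show ?thesis
    unfolding cubic_coeff_def by (subst sum_distrib_right) (rule sum.cong[OF refl], blast)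
qed

lemma tendsto_lower_terms:
  assumes "\<And>i. i < j \<Longrightarrow> (\<lambda>n. g n i) \<longlonglongrightarrow> L i" "e \<longlonglongrightarrow> 0"
  shows "(\<lambda>n. lower_terms (e n) j (g n)) \<longlonglongrightarrow> lower_terms 0 j L"
  unfolding lower_terms_def cubic_coeff_def pair_weight_def
  by (intro tendsto_intros assms) auto

text \<open>With g_i = n^(2 i) s_i, a quadratic term of degree j + 1 carries n^2 n^(-2 (j + 1)) and
  a cubic one n^(-2 j), so n^(-2 j) cancels and only corrections in 1 / n^2 are left. The bound on n
  is i + 4 \<le> n at i = j + 1.\<close>

lemma scaled_cumulant_recurrence:
  assumes n: "n \<ge> j + 5" and j: "j \<ge> 2"
  shows "2 * (real j - 1) * (1 - (real j)\<^sup>2 / (real n)\<^sup>2) * scaled_cumulant 2 n * scaled_cumulant (Suc j) n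
    = lower_terms (1 / (real n)\<^sup>2) j (\<lambda>i. scaled_cumulant (Suc i) n)"
    and "scaled_cumulant 1 n = 1" and "scaled_cumulant 2 n = 2 * (real n)\<^sup>2 / ((real n)\<^sup>2 - 1)"
proof -
  have "n \<ge> 4" using n by simp
  then obtain s where s: "\<And>l. 1 \<le> l \<Longrightarrow> l \<le> n \<Longrightarrow> delay_cumulant n l = fact (l - 1) * fps_nth s (l - 1)"
    and s0: "fps_nth s 0 = 1" and s1: "fps_nth s 1 = 2 / ((real n)\<^sup>2 - 1)"
    and E: "\<And>i. i + 4 \<le> n \<Longrightarrow> fps_nth (third_order (real n) s) i = 0"
    by (rule delay_cumulant_third_order) blast
  let ?N = "(real n)\<^sup>2"
  let ?g = "\<lambda>i. scaled_cumulant (Suc i) n"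
  have N: "?N > 0" using n by simp
  have g: "?g i = ?N ^ i * fps_nth s i" if "i < n" for i
    using s[of "Suc i"] that by (simp add: scaled_cumulant_def power_mult)
  show "scaled_cumulant 1 n = 1" using g[of 0] n s0 by simp
  show "scaled_cumulant 2 n = 2 * ?N / (?N - 1)" using g[of 1] n s1 by (simp add: numeral_2_eq_2)
  have sg: "fps_nth s i = ?g i * (1 / ?N) ^ i" if "i < n" for i
    using g[OF that] N by (simp add: power_one_over)
  have "0 = fps_nth (cumulant_equation 1 ?N s) (Suc j)"
    using E[of "Suc j"] n by (simp add: third_order_eq)
  also have "\<dots> = (\<Sum>a\<in>{2..<j}. ?N * pair_weight (1 / ?N) a (Suc j - a) * fps_nth s a * fps_nth s (Suc j - a))
      + cubic_coeff j (fps_nth s) - 2 * (real j - 1) * (?N - 1 * (real j)\<^sup>2) * fps_nth s 1 * fps_nth s j"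
    by (rule fps_nth_cumulant_equation) (use s0 j N in auto)
  also have "cubic_coeff j (fps_nth s) = cubic_coeff j (\<lambda>a. ?g a * (1 / ?N) ^ a)"
    unfolding cubic_coeff_def
    by (intro sum.cong refl arg_cong2[where f = "(*)"] arg_cong2[where f = "(+)"] sg) (use n in auto)
  also have "\<dots> = cubic_coeff j ?g * (1 / ?N) ^ j" by (rule cubic_coeff_scale)
  also have "(\<Sum>a\<in>{2..<j}. ?N * pair_weight (1 / ?N) a (Suc j - a) * fps_nth s a * fps_nth s (Suc j - a))
     = (\<Sum>a\<in>{2..<j}. pair_weight (1 / ?N) a (Suc j - a) * ?g a * ?g (Suc j - a)) * (1 / ?N) ^ j"
    unfolding sum_distrib_right
  proof (intro sum.cong refl)
    fix a assume a: "a \<in> {2..<j}"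
    have "(1 / ?N) ^ a * (1 / ?N) ^ (Suc j - a) = (1 / ?N) ^ Suc j" using a by (simp flip: power_add)
    also have "\<dots> = (1 / ?N) ^ j / ?N" by simp
    finally have e1: "?N * ((1 / ?N) ^ a * (1 / ?N) ^ (Suc j - a)) = (1 / ?N) ^ j" using N by simp
    have e2: "fps_nth s a = ?g a * (1 / ?N) ^ a" "fps_nth s (Suc j - a) = ?g (Suc j - a) * (1 / ?N) ^ (Suc j - a)"
      using a n by (intro sg; simp)+
    have "?N * pair_weight (1 / ?N) a (Suc j - a) * fps_nth s a * fps_nth s (Suc j - a)
      = pair_weight (1 / ?N) a (Suc j - a) * ?g a * ?g (Suc j - a) * (?N * ((1 / ?N) ^ a * (1 / ?N) ^ (Suc j - a)))"
      unfolding e2 by (simp only: mult_ac)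
    then show "?N * pair_weight (1 / ?N) a (Suc j - a) * fps_nth s a * fps_nth s (Suc j - a)
      = pair_weight (1 / ?N) a (Suc j - a) * ?g a * ?g (Suc j - a) * (1 / ?N) ^ j"
      unfolding e1 .
  qed
  also have "2 * (real j - 1) * (?N - 1 * (real j)\<^sup>2) * fps_nth s 1 * fps_nth s j
     = 2 * (real j - 1) * (1 - (real j)\<^sup>2 / ?N) * ?g 1 * ?g j * (1 / ?N) ^ j"
  proof -
    have e1: "fps_nth s 1 = ?g 1 * (1 / ?N)" "fps_nth s j = ?g j * (1 / ?N) ^ j" using sg[of 1] sg[of j] n by simp_all
    have e2: "?N - 1 * (real j)\<^sup>2 = ?N * (1 - (real j)\<^sup>2 / ?N)" using N by (simp add: field_simps)
    have e3: "?N * (1 / ?N) = 1" using N by simp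
    have "2 * (real j - 1) * (?N - 1 * (real j)\<^sup>2) * fps_nth s 1 * fps_nth s j
       = 2 * (real j - 1) * (1 - (real j)\<^sup>2 / ?N) * ?g 1 * ?g j * (1 / ?N) ^ j * (?N * (1 / ?N))"
      unfolding e1 e2 by (simp only: mult_ac)
    then show ?thesis unfolding e3 by (simp only: mult_1_right)
  qed
  finally have "(lower_terms (1 / ?N) j ?g - 2 * (real j - 1) * (1 - (real j)\<^sup>2 / ?N) * ?g 1 * ?g j) * (1 / ?N) ^ j = 0"
    unfolding lower_terms_def by (simp add: algebra_simps)
  then show "2 * (real j - 1) * (1 - (real j)\<^sup>2 / ?N) * scaled_cumulant 2 n * scaled_cumulant (Suc j) n
    = lower_terms (1 / ?N) j ?g"
  proof -
    assume *: "(lower_terms (1 / ?N) j ?g - 2 * (real j - 1) * (1 - (real j)\<^sup>2 / ?N) * ?g 1 * ?g j) * (1 / ?N) ^ j = 0"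
    have "(1 / ?N) ^ j \<noteq> 0" using N by simp
    with * have "lower_terms (1 / ?N) j ?g - 2 * (real j - 1) * (1 - (real j)\<^sup>2 / ?N) * ?g 1 * ?g j = 0"
      by (metis mult_eq_0_iff)
    moreover have "?g 1 = scaled_cumulant 2 n" by (simp add: numeral_2_eq_2)
    ultimately show ?thesis by simp
  qed
qed

text \<open>L stands for any solution of the limiting recursion. At j = 1 the factor j - 1 vanishes,
  so the second cumulant is an initial datum; its limit 2 is nonzero, which permits the division,
  and turns 2 (j - 1) into 4 (j - 1).\<close>

theorem scaled_cumulant_tendsto:
  assumes L0: "L 0 = 1" and L1: "L 1 = 2"
    and rec: "\<And>j. j \<ge> 2 \<Longrightarrow> 4 * (real j - 1) * L j = lower_terms 0 j L"
  shows "scaled_cumulant (Suc j) \<longlonglongrightarrow> L j"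
proof (induction j rule: less_induct)
  case (less j)
  have e: "(\<lambda>n. 1 / (real n)\<^sup>2) \<longlonglongrightarrow> 0" by real_asymp
  have p2: "scaled_cumulant 2 \<longlonglongrightarrow> 2"
  proof (rule Lim_transform_eventually)
    show "(\<lambda>n. 2 * (real n)\<^sup>2 / ((real n)\<^sup>2 - 1)) \<longlonglongrightarrow> 2" by real_asymp
    show "\<forall>\<^sub>F n in sequentially. 2 * (real n)\<^sup>2 / ((real n)\<^sup>2 - 1) = scaled_cumulant 2 n"
      using eventually_ge_at_top[of 7] by eventually_elim (subst scaled_cumulant_recurrence(3)[where j = 2], auto)
  qed
  consider "j = 0" | "j = 1" | "j \<ge> 2" by linarith
  then show ?case
  proof cases
    case 1
    have "scaled_cumulant 1 \<longlonglongrightarrow> 1"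
    proof (rule Lim_transform_eventually)
      show "(\<lambda>n. 1) \<longlonglongrightarrow> (1 :: real)" by simp
      show "\<forall>\<^sub>F n in sequentially. 1 = scaled_cumulant 1 n"
        using eventually_ge_at_top[of 7] by eventually_elim (subst scaled_cumulant_recurrence(2)[where j = 2], auto)
    qed
    then show ?thesis using 1 L0 by simp
  next
    case 2
    then show ?thesis using p2 L1 by (simp add: numeral_2_eq_2)
  next
    case j: 3
    let ?c = "\<lambda>n. 2 * (real j - 1) * (1 - (real j)\<^sup>2 * (1 / (real n)\<^sup>2)) * scaled_cumulant 2 n"
    have c: "?c \<longlonglongrightarrow> 2 * (real j - 1) * (1 - (real j)\<^sup>2 * 0) * 2"
      by (intro tendsto_intros e p2)
    have "(\<lambda>n. lower_terms (1 / (real n)\<^sup>2) j (\<lambda>i. scaled_cumulant (Suc i) n) / ?c n)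
        \<longlonglongrightarrow> lower_terms 0 j L / (2 * (real j - 1) * (1 - (real j)\<^sup>2 * 0) * 2)"
      using j by (intro tendsto_divide[OF tendsto_lower_terms[OF less e] c]) auto
    also have "lower_terms 0 j L / (2 * (real j - 1) * (1 - (real j)\<^sup>2 * 0) * 2) = L j"
      using rec[OF j] j by (simp add: field_simps)
    finally have "(\<lambda>n. lower_terms (1 / (real n)\<^sup>2) j (\<lambda>i. scaled_cumulant (Suc i) n) / ?c n) \<longlonglongrightarrow> L j" .
    moreover have "\<forall>\<^sub>F n in sequentially. ?c n \<noteq> 0"
      using tendsto_imp_eventually_ne[OF c, of 0] j by simp
    then have "\<forall>\<^sub>F n in sequentially. lower_terms (1 / (real n)\<^sup>2) j (\<lambda>i. scaled_cumulant (Suc i) n) / ?c n = scaled_cumulant (Suc j) n"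
      using eventually_ge_at_top[of "j + 5"]
    proof eventually_elim
      case (elim n)
      then show ?case using scaled_cumulant_recurrence(1)[of j n] j by (simp add: divide_eq_eq mult_ac)
    qed
    ultimately show ?thesis by (rule Lim_transform_eventually)
  qed
qed

section \<open>The limiting generating function\<close>

text \<open>Differentiating \<open>\<Sum>\<^sub>k W\<^sub>k P\<^sup>k = X\<close> and multiplying by \<open>\<phi>\<^sup>n\<close> leaves only the term \<open>k = n\<close> in degree
  \<open>n - 1\<close>.\<close>

lemma fps_lagrange_inversion:
  fixes \<phi> :: "'a :: field_char_0 fps"
  assumes \<phi>: "fps_nth \<phi> 0 \<noteq> 0" and n: "n \<ge> 1"
  shows "of_nat n * fps_nth (fps_inv (fps_X * inverse \<phi>)) n = fps_nth (\<phi> ^ n) (n - 1)"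
proof -
  define P where "P = fps_X * inverse \<phi>"
  define W where "W = fps_inv P"
  have P0: "fps_nth P 0 = 0" by (simp add: P_def)
  have P1: "fps_nth P 1 \<noteq> 0" using \<phi> by (simp add: P_def)
  have P\<phi>: "P * \<phi> = fps_X" using \<phi> by (simp add: P_def mult.assoc inverse_mult_eq_1)
  have WP: "W oo P = fps_X" unfolding W_def by (rule fps_inv[OF P0 P1])
  \<comment> \<open>Splitting off the tail keeps the composed sum finite. The tail contributes a
    multiple of P^n to the derivative, hence a multiple of X^n after multiplication by \<phi>^n,
    invisible in degree n - 1.\<close>
  define R where "R = fps_shift (Suc n) W"
  have W: "W = (\<Sum>k\<le>n. fps_const (fps_nth W k) * fps_X ^ k) + fps_X ^ Suc n * R"
  proof (rule fps_ext)
    fix i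
    have "fps_nth (\<Sum>k\<le>n. fps_const (fps_nth W k) * fps_X ^ k) i = (\<Sum>k\<le>n. if k = i then fps_nth W i else 0)"
      unfolding fps_sum_nth by (intro sum.cong refl) (simp add: fps_X_power_nth)
    also have "\<dots> = (if i \<le> n then fps_nth W i else 0)" by simp
    finally have 1: "fps_nth (\<Sum>k\<le>n. fps_const (fps_nth W k) * fps_X ^ k) i = (if i \<le> n then fps_nth W i else 0)" .
    have 2: "fps_nth (fps_X ^ Suc n * R) i = (if i < Suc n then 0 else fps_nth R (i - Suc n))"
      by (rule fps_X_power_mult_nth)
    show "fps_nth W i = fps_nth ((\<Sum>k\<le>n. fps_const (fps_nth W k) * fps_X ^ k) + fps_X ^ Suc n * R) i"
      unfolding fps_add_nth 1 2 by (simp add: R_def)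
  qed
  define S where "S = R oo P"
  have comp_pow: "(fps_X ^ k) oo P = P ^ k" for k
    using P0 by (simp flip: fps_compose_power)
  have "fps_X = (\<Sum>k\<le>n. fps_const (fps_nth W k) * P ^ k) + P ^ Suc n * S"
  proof -
    have "W oo P = (\<Sum>k\<le>n. fps_const (fps_nth W k) * P ^ k) + P ^ Suc n * S"
      by (subst W, subst fps_compose_add_distrib, subst fps_compose_sum_distrib,
          subst fps_compose_mult_distrib[OF P0])
         (simp only: fps_compose_mult_distrib[OF P0] fps_const_compose comp_pow S_def)
    then show ?thesis using WP by simp
  qed
  then have "fps_deriv fps_X = fps_deriv ((\<Sum>k\<le>n. fps_const (fps_nth W k) * P ^ k) + P ^ Suc n * S)"
    by (rule arg_cong)
  then have d: "1 = (\<Sum>k\<le>n. fps_const (fps_nth W k) * fps_deriv (P ^ k))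
      + P ^ n * (fps_const (of_nat (Suc n)) * fps_deriv P * S + P * fps_deriv S)" (is "_ = _ + P ^ n * ?Y")
  proof -
    have "fps_deriv (P ^ Suc n * S) = P ^ n * ?Y"
      unfolding fps_deriv_mult fps_deriv_power by (simp add: algebra_simps del: of_nat_Suc)
    moreover assume "fps_deriv fps_X = fps_deriv ((\<Sum>k\<le>n. fps_const (fps_nth W k) * P ^ k) + P ^ Suc n * S)"
    ultimately show ?thesis
      by (simp only: fps_deriv_fps_X fps_deriv_add fps_deriv_sum fps_deriv_mult_const_left)
  qed
  have Pn: "P ^ k * \<phi> ^ k = fps_X ^ k" for k
    by (simp add: P\<phi> flip: power_mult_distrib)
  have dP: "fps_deriv P * \<phi> = 1 - P * fps_deriv \<phi>"
  proof -
    have "fps_deriv (P * \<phi>) = 1" unfolding P\<phi> by simp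
    then show ?thesis by (simp add: algebra_simps)
  qed
  have key: "fps_nth (fps_deriv (P ^ k) * \<phi> ^ n) (n - 1) = (if k = n then of_nat n else 0)" if k: "k \<le> n" for k
  proof (cases "k = 0")
    case True then show ?thesis using n by simp
  next
    case False
    define m where "m = n - k"
    have nk: "n = (k - 1) + 1 + m" using k False by (simp add: m_def)
    have "fps_deriv (P ^ k) * \<phi> ^ n = fps_const (of_nat k) * ((P ^ (k - 1) * \<phi> ^ (k - 1)) * ((fps_deriv P * \<phi>) * \<phi> ^ m))"
      by (subst nk) (simp add: fps_deriv_power power_add mult_ac)
    also have "\<dots> = fps_const (of_nat k) * (fps_X ^ (k - 1) * (\<phi> ^ m - P * fps_deriv \<phi> * \<phi> ^ m))"
      unfolding Pn dP by (simp add: left_diff_distrib)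
    finally have "fps_nth (fps_deriv (P ^ k) * \<phi> ^ n) (n - 1)
       = of_nat k * fps_nth (fps_X ^ (k - 1) * (\<phi> ^ m - P * fps_deriv \<phi> * \<phi> ^ m)) (n - 1)"
      by simp
    also have "fps_nth (fps_X ^ (k - 1) * (\<phi> ^ m - P * fps_deriv \<phi> * \<phi> ^ m)) (n - 1)
       = fps_nth (\<phi> ^ m - P * fps_deriv \<phi> * \<phi> ^ m) m"
    proof -
      have "\<not> n - 1 < k - 1" "n - 1 - (k - 1) = m" using nk k False by auto
      then show ?thesis by (simp only: fps_X_power_mult_nth if_False)
    qed
    \<comment> \<open>For m > 0 the two terms cancel: m P \<phi>' \<phi>^m equals X times the
      derivative of \<phi>^m, whose coefficient of degree m is m times that of \<phi>^m.\<close>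
    also have "\<dots> = (if m = 0 then 1 else 0)"
    proof (cases m)
      case 0 then show ?thesis by (simp add: P0)
    next
      case (Suc l)
      have "fps_deriv (\<phi> ^ m) = fps_const (of_nat m) * fps_deriv \<phi> * \<phi> ^ l"
        unfolding fps_deriv_power Suc by (simp only: diff_Suc_1)
      moreover have "fps_const (of_nat m) * (P * fps_deriv \<phi> * \<phi> ^ m)
          = (P * \<phi>) * (fps_const (of_nat m) * fps_deriv \<phi> * \<phi> ^ l)"
        unfolding Suc power_Suc by (simp only: mult_ac)
      ultimately have "fps_const (of_nat m) * (P * fps_deriv \<phi> * \<phi> ^ m) = fps_X * fps_deriv (\<phi> ^ m)"
        unfolding P\<phi> by (simp only:)
      then have "of_nat m * fps_nth (P * fps_deriv \<phi> * \<phi> ^ m) m = fps_nth (fps_X * fps_deriv (\<phi> ^ m)) m"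
        by (metis fps_mult_left_const_nth)
      also have "\<dots> = of_nat m * fps_nth (\<phi> ^ m) m" by (simp add: Suc del: power_Suc)
      finally have "fps_nth (P * fps_deriv \<phi> * \<phi> ^ m) m = fps_nth (\<phi> ^ m) m"
        using Suc by (simp del: of_nat_Suc power_Suc)
      then show ?thesis using Suc by simp
    qed
    finally show ?thesis using nk k False by auto
  qed
  have "fps_nth (\<phi> ^ n) (n - 1) = fps_nth (1 * \<phi> ^ n) (n - 1)" by simp
  also have "1 * \<phi> ^ n = (\<Sum>k\<le>n. fps_const (fps_nth W k) * (fps_deriv (P ^ k) * \<phi> ^ n)) + fps_X ^ n * ?Y"
  proof -
    have "(A + P ^ n * Y) * \<phi> ^ n = A * \<phi> ^ n + (P ^ n * \<phi> ^ n) * Y" for A Y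
      by (simp only: distrib_right) (simp only: mult_ac)
    then show ?thesis
      by (subst d) (simp only: Pn sum_distrib_right mult.assoc)
  qed
  also have "fps_nth \<dots> (n - 1) = (\<Sum>k\<le>n. fps_nth W k * (if k = n then of_nat n else 0))"
    using n key by (auto simp: fps_sum_nth fps_X_power_mult_nth intro!: sum.cong)
  also have "\<dots> = of_nat n * fps_nth W n"
    by (simp add: if_distrib cong: if_cong)
  finally show ?thesis by (simp add: W_def P_def)
qed

section \<open>The series \<Omega> as a Lagrange inverse\<close>

lemma fps_nth_linear_power:
  "fps_nth ((1 + fps_const c * fps_X) ^ m) p = of_nat (m choose p) * c ^ p" for c :: "'a :: comm_ring_1"
proof (induction m arbitrary: p)
  case 0 show ?case by (cases p) simp_all
next
  case (Suc m)
  have "fps_nth ((1 + fps_const c * fps_X) ^ Suc m) p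
    = fps_nth ((1 + fps_const c * fps_X) ^ m) p + c * fps_nth (fps_X * (1 + fps_const c * fps_X) ^ m) p"
    by (simp add: distrib_right mult.assoc)
  then show ?case using Suc by (cases p) (simp_all add: algebra_simps)
qed

text \<open>The series \<phi> in W = X \<phi>(W). Putting \<Omega> = 1 + 4 W in the quartic equation
  gives \<Omega> - 1 = 4 W, 3 \<Omega> + 1 = 4 (1 + 3 W) and \<Omega> + 1 = 2 (1 + 2 W), and a
  common factor 16 cancels.\<close>

definition omega_kernel :: "real fps" where
  "omega_kernel = (1 + fps_const 4 * fps_X) ^ 2 * (1 + fps_const 2 * fps_X) ^ 2 * inverse (1 + fps_const 3 * fps_X)"

definition omega_root :: "real fps" where
  "omega_root = fps_inv (fps_X * inverse omega_kernel)"

lemma omega_kernel_0: "fps_nth omega_kernel 0 = 1"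
  by (simp add: omega_kernel_def power2_eq_square)

lemma omega_root_0: "fps_nth omega_root 0 = 0"
  by (simp add: omega_root_def fps_inv_def)

text \<open>The inner sum comes from the two binomial factors, as 4^p 2^(i-p) = 2^(i+p); the outer
  binomial and the power of - 3 come from the negative binomial series of (1 + 3 X)^(-k).\<close>

lemma fps_nth_omega_kernel_power:
  assumes k: "k \<ge> 1"
  shows "fps_nth (omega_kernel ^ k) (k - 1) = (\<Sum>i<k. real ((2 * k - i - 2) choose (k - 1)) *
        (\<Sum>p\<le>i. real ((2 * k) choose p) * real ((2 * k) choose (i - p)) * 2 ^ (i + p)) *
        (- 3) ^ (k - 1 - i))"
proof -
  have "omega_kernel ^ k = ((1 + fps_const 4 * fps_X) ^ (2 * k) * (1 + fps_const 2 * fps_X) ^ (2 * k))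
      * inverse ((1 - fps_const (- 3) * fps_X) ^ k)"
    by (simp add: omega_kernel_def power_mult_distrib power_mult fps_inverse_power flip: fps_const_neg)
  also have "inverse ((1 - fps_const (- 3) * fps_X) ^ k) = Abs_fps (\<lambda>m. real ((k + m - 1) choose m) * (- 3) ^ m)"
    by (rule one_minus_const_fps_X_neg_power') (use k in simp)
  finally have "fps_nth (omega_kernel ^ k) (k - 1) =
      (\<Sum>i = 0..k - 1. (\<Sum>p = 0..i. real ((2 * k) choose p) * 4 ^ p * (real ((2 * k) choose (i - p)) * 2 ^ (i - p))) *
        (real ((k + (k - 1 - i) - 1) choose (k - 1 - i)) * (- 3) ^ (k - 1 - i)))"
    by (simp only: fps_mult_nth fps_nth_linear_power fps_nth_Abs_fps)
  also have "\<dots> = (\<Sum>i<k. real ((2 * k - i - 2) choose (k - 1)) *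
        (\<Sum>p\<le>i. real ((2 * k) choose p) * real ((2 * k) choose (i - p)) * 2 ^ (i + p)) *
        (- 3) ^ (k - 1 - i))"
  proof (rule sum.cong)
    show "{0..k - 1} = {..<k}" using k by auto
    fix i assume "i \<in> {..<k}"
    then have i: "i < k" by simp
    have "k + (k - 1 - i) - 1 = 2 * k - i - 2" using i by simp
    moreover have "(2 * k - i - 2) choose (k - 1 - i) = (2 * k - i - 2) choose (k - 1)"
      using binomial_symmetric[of "k - 1" "2 * k - i - 2"] i by (simp add: algebra_simps)
    moreover have "(\<Sum>p = 0..i. real ((2 * k) choose p) * 4 ^ p * (real ((2 * k) choose (i - p)) * 2 ^ (i - p)))
       = (\<Sum>p\<le>i. real ((2 * k) choose p) * real ((2 * k) choose (i - p)) * 2 ^ (i + p))"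
    proof (rule sum.cong)
      fix p assume "p \<in> {..i}"
      then have "i + p = 2 * p + (i - p)" by simp
      then have "(2::real) ^ (i + p) = 2 ^ (2 * p) * 2 ^ (i - p)" by (metis power_add)
      also have "(2::real) ^ (2 * p) = 4 ^ p" by (simp add: power_mult)
      finally have "(2::real) ^ (i + p) = 4 ^ p * 2 ^ (i - p)" .
      then show "real ((2 * k) choose p) * 4 ^ p * (real ((2 * k) choose (i - p)) * 2 ^ (i - p))
        = real ((2 * k) choose p) * real ((2 * k) choose (i - p)) * 2 ^ (i + p)" by simp
    qed (simp add: atMost_atLeast0)
    ultimately show "(\<Sum>p = 0..i. real ((2 * k) choose p) * 4 ^ p * (real ((2 * k) choose (i - p)) * 2 ^ (i - p))) *
        (real ((k + (k - 1 - i) - 1) choose (k - 1 - i)) * (- 3) ^ (k - 1 - i))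
      = real ((2 * k - i - 2) choose (k - 1)) *
        (\<Sum>p\<le>i. real ((2 * k) choose p) * real ((2 * k) choose (i - p)) * 2 ^ (i + p)) * (- 3) ^ (k - 1 - i)"
      by (simp only: mult_ac)
  qed
  finally show ?thesis .
qed

lemma omega_series_eq: "omega_series = 1 + 4 * omega_root"
proof (rule fps_ext)
  fix k
  show "fps_nth omega_series k = fps_nth (1 + 4 * omega_root) k"
  proof (cases "k = 0")
    case True
    then show ?thesis by (simp add: omega_series_def omega_root_0 numeral_fps_const)
  next
    case False
    then have "real k * fps_nth omega_root k = fps_nth (omega_kernel ^ k) (k - 1)"
      unfolding omega_root_def by (intro fps_lagrange_inversion) (simp_all add: omega_kernel_0)
    moreover have "omega_coeff k = 4 / real k * fps_nth (omega_kernel ^ k) (k - 1)"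
      unfolding omega_coeff_def by (subst fps_nth_omega_kernel_power) (use False in auto)
    ultimately have "omega_coeff k = 4 / real k * (real k * fps_nth omega_root k)" by (simp only:)
    then have "omega_coeff k = 4 * fps_nth omega_root k" using False by simp
    then show ?thesis using False by (simp add: omega_series_def numeral_fps_const)
  qed
qed

lemma omega_root_equation:
  "omega_root * (1 + 3 * omega_root) = fps_X * (1 + 4 * omega_root) ^ 2 * (1 + 2 * omega_root) ^ 2"
proof -
  define P where "P = fps_X * inverse omega_kernel"
  have P0: "fps_nth P 0 = 0" by (simp add: P_def)
  have P1: "fps_nth P 1 \<noteq> 0" by (simp add: P_def omega_kernel_0)
  have W: "omega_root = fps_inv P" by (simp add: omega_root_def P_def)
  have PW: "P oo omega_root = fps_X" unfolding W by (rule fps_inv_right[OF P0 P1])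
  have "inverse omega_kernel * omega_kernel = 1"
    by (rule inverse_mult_eq_1) (simp add: omega_kernel_0)
  then have "P * omega_kernel = fps_X" by (simp add: P_def mult.assoc)
  then have "P * omega_kernel * (1 + fps_const 3 * fps_X) = fps_X * (1 + fps_const 3 * fps_X)" by simp
  moreover have "inverse (1 + fps_const 3 * fps_X) * (1 + fps_const 3 * fps_X) = (1 :: real fps)"
    by (rule inverse_mult_eq_1) simp
  then have "omega_kernel * (1 + fps_const 3 * fps_X) = (1 + fps_const 4 * fps_X) ^ 2 * (1 + fps_const 2 * fps_X) ^ 2"
    by (simp add: omega_kernel_def mult.assoc)
  ultimately have "P * ((1 + fps_const 4 * fps_X) ^ 2 * (1 + fps_const 2 * fps_X) ^ 2) = fps_X * (1 + fps_const 3 * fps_X)"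
    by (simp add: mult.assoc)
  then have "(P * ((1 + fps_const 4 * fps_X) ^ 2 * (1 + fps_const 2 * fps_X) ^ 2)) oo omega_root
     = (fps_X * (1 + fps_const 3 * fps_X)) oo omega_root" by simp
  then have "fps_X * ((1 + fps_const 4 * omega_root) ^ 2 * (1 + fps_const 2 * omega_root) ^ 2)
      = omega_root * (1 + fps_const 3 * omega_root)"
    using omega_root_0
    by (simp add: fps_compose_mult_distrib fps_compose_add_distrib PW power2_eq_square)
  then show ?thesis by (simp add: numeral_fps_const mult.assoc)
qed

lemma omega_series_equation:
  "(omega_series - 1) * (3 * omega_series + 1) = 4 * fps_X * omega_series ^ 2 * (omega_series + 1) ^ 2"
proof -
  have "(omega_series - 1) * (3 * omega_series + 1) = 16 * (omega_root * (1 + 3 * omega_root))"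
    unfolding omega_series_eq by (simp add: algebra_simps)
  also have "\<dots> = 16 * (fps_X * (1 + 4 * omega_root) ^ 2 * (1 + 2 * omega_root) ^ 2)"
    unfolding omega_root_equation ..
  also have "\<dots> = 4 * fps_X * omega_series ^ 2 * (omega_series + 1) ^ 2"
    unfolding omega_series_eq by (simp add: algebra_simps power2_eq_square)
  finally show ?thesis .
qed

section \<open>Algebraic and differential relations for the generating function\<close>

definition cumulant_gf :: "real fps" where
  "cumulant_gf = fps_const (3/2) - fps_const (3/2) * omega_series
          + 2 * fps_X * omega_series ^ 3 + 3 * fps_X * omega_series ^ 2
          + 2 * fps_X * omega_series"

lemma double_cumulant_gf:
  "2 * cumulant_gf = 3 - 3 * omega_series + 4 * fps_X * omega_series ^ 3 + 6 * fps_X * omega_series ^ 2 + 4 * fps_X * omega_series"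
proof -
  have "2 * fps_const (3/2 :: real) = 3" by (simp add: numeral_fps_const)
  moreover have "2 * cumulant_gf = 2 * fps_const (3/2) - 2 * fps_const (3/2) * omega_series
      + 4 * fps_X * omega_series ^ 3 + 6 * fps_X * omega_series ^ 2 + 4 * fps_X * omega_series"
    unfolding cumulant_gf_def by (simp add: algebra_simps)
  ultimately show ?thesis by (simp only:)
qed

lemma deriv_cumulant_gf: "fps_deriv cumulant_gf = omega_series"
proof -
  let ?O = omega_series and ?D = "fps_deriv omega_series" and ?X = "fps_X :: real fps"
  note R = omega_series_equation
  have num: "fps_deriv (numeral k) = (0 :: real fps)" for k by (simp add: numeral_fps_const)
  have dR: "?D * (6 * ?O - 2) = 4 * ?O ^ 2 * (?O + 1) ^ 2 + 8 * ?X * ?O * (?O + 1) * (2 * ?O + 1) * ?D"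
    using arg_cong[OF R, of fps_deriv] by (simp add: num power2_eq_square algebra_simps)
  have dF: "2 * fps_deriv cumulant_gf = - 3 * ?D + (4 * ?O ^ 3 + 6 * ?O ^ 2 + 4 * ?O) + ?X * (12 * ?O ^ 2 + 12 * ?O + 4) * ?D"
    using arg_cong[OF double_cumulant_gf, of fps_deriv] by (simp add: num power2_eq_square power3_eq_cube algebra_simps)
  \<comment> \<open>An ideal membership certificate: the claim times 4 \<Omega> (\<Omega> + 1) is a
    combination of the differentiated quartic and the quartic itself. The prefactor has constant
    term 8, so it can be cancelled.\<close>
  have "4 * ?O * (?O + 1) * ((- 3 * ?D + (4 * ?O ^ 3 + 6 * ?O ^ 2 + 4 * ?O) + ?X * (12 * ?O ^ 2 + 12 * ?O + 4) * ?D) - 2 * ?O)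
    = 2 * (2 * ?O + 1) * ((4 * ?O ^ 2 * (?O + 1) ^ 2 + 8 * ?X * ?O * (?O + 1) * (2 * ?O + 1) * ?D) - ?D * (6 * ?O - 2))
      + 4 * ?D * ((?O - 1) * (3 * ?O + 1) - 4 * ?X * ?O ^ 2 * (?O + 1) ^ 2)"
    by (simp add: algebra_simps power2_eq_square power3_eq_cube)
  also have "\<dots> = 0" unfolding dR[symmetric] R[symmetric] by simp
  finally have "4 * ?O * (?O + 1) * (2 * fps_deriv cumulant_gf - 2 * ?O) = 0" unfolding dF .
  moreover have "fps_nth (4 * ?O * (?O + 1)) 0 \<noteq> 0"
    by (simp add: omega_series_def numeral_fps_const)
  then have "4 * ?O * (?O + 1) \<noteq> 0" by fastforce
  ultimately have "2 * (fps_deriv cumulant_gf - ?O) = 0" by (simp add: right_diff_distrib)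
  then show ?thesis by simp
qed

text \<open>The first-order equation behind the recurrence once F' is replaced by \<Omega>; twice
  the difference of its sides is a multiple of the quartic.\<close>

lemma cumulant_gf_linear: "cumulant_gf * (2 + 4 * omega_series) = 4 * fps_X * omega_series + 6 * fps_X * omega_series ^ 2 + 1 - omega_series"
proof -
  let ?O = omega_series and ?X = "fps_X :: real fps"
  have "2 * (cumulant_gf * (2 + 4 * ?O) - (4 * ?X * ?O + 6 * ?X * ?O ^ 2 + 1 - ?O))
    = (2 * cumulant_gf) * (2 + 4 * ?O) - 2 * (4 * ?X * ?O + 6 * ?X * ?O ^ 2 + 1 - ?O)"
    by (simp add: algebra_simps)
  also have "\<dots> = - 4 * ((?O - 1) * (3 * ?O + 1) - 4 * ?X * ?O ^ 2 * (?O + 1) ^ 2)"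
    unfolding double_cumulant_gf by (simp add: algebra_simps power2_eq_square power3_eq_cube)
  also have "\<dots> = 0" unfolding omega_series_equation by simp
  finally have "2 * (cumulant_gf * (2 + 4 * ?O) - (4 * ?X * ?O + 6 * ?X * ?O ^ 2 + 1 - ?O)) = 0" .
  then show ?thesis unfolding mult_eq_0_iff by simp
qed

lemma cumulant_gf_ode:
  defines "F' \<equiv> fps_deriv cumulant_gf"
  shows "F' - 1 = 4 * fps_X * F' - 2 * cumulant_gf + 6 * fps_X * F' ^ 2 - 4 * cumulant_gf * F'"
  unfolding F'_def deriv_cumulant_gf using cumulant_gf_linear by (simp add: algebra_simps)

text \<open>For F = X g and F' = \<Omega> one has Y = X^2 g', so this is X^2 times the limiting
  equation for g. It combines the linear relation with (1 - \<Omega>)^2 = 4 Y \<Omega> (1 +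
  \<Omega>), itself a consequence of the quartic.\<close>

lemma cumulant_gf_cubic:
  defines "Y \<equiv> fps_X * omega_series - cumulant_gf"
  shows "4 * fps_X * Y ^ 2 * (2 * omega_series + 1) + (fps_X - cumulant_gf) ^ 2 - Y ^ 2 = 0"
proof -
  let ?O = omega_series and ?X = "fps_X :: real fps"
  have P: "(1 - ?O) ^ 2 = 4 * Y * ?O * (1 + ?O)"
  proof -
    have "2 * ((1 - ?O) ^ 2 - 4 * Y * ?O * (1 + ?O))
      = 2 * (1 - ?O) ^ 2 - 4 * ?O * (1 + ?O) * (2 * ?X * ?O - 2 * cumulant_gf)"
      unfolding Y_def by (simp add: algebra_simps)
    also have "\<dots> = - 2 * (2 * ?O + 1) * ((?O - 1) * (3 * ?O + 1) - 4 * ?X * ?O ^ 2 * (?O + 1) ^ 2)"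
      unfolding double_cumulant_gf by (simp add: algebra_simps power2_eq_square power3_eq_cube)
    also have "\<dots> = 0" unfolding omega_series_equation by simp
    finally have "2 * ((1 - ?O) ^ 2 - 4 * Y * ?O * (1 + ?O)) = 0" .
    then show ?thesis unfolding mult_eq_0_iff by simp
  qed
  have "4 * ?X * Y ^ 2 * (2 * ?O + 1) + (?X - cumulant_gf) ^ 2 - Y ^ 2
    = ?X * (?X * ((1 - ?O) ^ 2 - 4 * Y * ?O * (1 + ?O))
       - 2 * Y * (cumulant_gf * (2 + 4 * ?O) - (4 * ?X * ?O + 6 * ?X * ?O ^ 2 + 1 - ?O)))"
    unfolding Y_def by (simp add: algebra_simps power2_eq_square)
  also have "\<dots> = 0" unfolding P cumulant_gf_linear by simp
  finally show ?thesis .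
qed

lemma omega_series_0: "fps_nth omega_series 0 = 1"
  by (simp add: omega_series_def)

lemma omega_series_1: "fps_nth omega_series 1 = 4"
  by (simp add: omega_series_def omega_coeff_def)

lemma fps_nth_cumulant_gf:
  "fps_nth cumulant_gf 0 = 0" "fps_nth cumulant_gf 1 = 1" "fps_nth cumulant_gf 2 = 2"
proof -
  show "fps_nth cumulant_gf 0 = 0" by (simp add: cumulant_gf_def omega_series_0 mult.assoc numeral_fps_const)
  have "real (n + 1) * fps_nth cumulant_gf (n + 1) = fps_nth omega_series n" for n
    using arg_cong[OF deriv_cumulant_gf, of "\<lambda>f. fps_nth f n"] by simp
  from this[of 0] this[of 1] show "fps_nth cumulant_gf 1 = 1" "fps_nth cumulant_gf 2 = 2"
    using omega_series_1 by (simp_all add: omega_series_0 numeral_2_eq_2)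
qed

lemma cumulant_equation_limit: "cumulant_equation 0 1 (fps_shift 1 cumulant_gf) = 0"
proof -
  define g where "g = fps_shift 1 cumulant_gf"
  define u where "u = fps_X * fps_deriv g"
  have F: "cumulant_gf = fps_X * g"
    by (rule fps_ext) (simp add: g_def fps_nth_cumulant_gf(1))
  have O: "omega_series = g + u"
    using deriv_cumulant_gf unfolding F u_def by (simp add: add.commute)
  have Y: "fps_X * omega_series - cumulant_gf = fps_X * u" unfolding F O by (simp add: algebra_simps)
  have "fps_X ^ 2 * cumulant_equation 0 1 g
    = 4 * fps_X * (fps_X * u) ^ 2 * (2 * omega_series + 1) + (fps_X - cumulant_gf) ^ 2 - (fps_X * u) ^ 2"
    unfolding O unfolding F cumulant_equation_def Let_def u_def[symmetric]
    by (simp add: algebra_simps power2_eq_square)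
  also have "\<dots> = 0" using cumulant_gf_cubic unfolding Y .
  finally show ?thesis by (simp add: g_def)
qed

theorem scaled_cumulant_limit:
  assumes "l \<ge> 1"
  shows "scaled_cumulant l \<longlonglongrightarrow> fps_nth cumulant_gf l"
proof -
  let ?g = "fps_shift 1 cumulant_gf"
  have "scaled_cumulant (Suc (l - 1)) \<longlonglongrightarrow> fps_nth ?g (l - 1)"
  proof (rule scaled_cumulant_tendsto)
    show g0: "fps_nth ?g 0 = 1" using fps_nth_cumulant_gf(2) by simp
    show g1: "fps_nth ?g 1 = 2" using fps_nth_cumulant_gf(3) by (simp add: numeral_2_eq_2)
    fix j :: nat assume j: "j \<ge> 2"
    have "0 = fps_nth (cumulant_equation 0 1 ?g) (Suc j)" by (simp only: cumulant_equation_limit fps_zero_nth)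
    also have "\<dots> = lower_terms 0 j (fps_nth ?g) - 2 * (real j - 1) * fps_nth ?g 1 * fps_nth ?g j"
      by (subst fps_nth_cumulant_equation[OF g0 j]) (simp_all add: lower_terms_def)
    finally show "4 * (real j - 1) * fps_nth ?g j = lower_terms 0 j (fps_nth ?g)"
      unfolding g1 by simp
  qed
  then show ?thesis using assms by simp
qed

lemma limit_cumulant_eq: "l \<ge> 1 \<Longrightarrow> limit_cumulant l = fps_nth cumulant_gf l"
  unfolding limit_cumulant_def by (rule limI) (rule scaled_cumulant_limit)

text \<open>Truncated integrality, so that the fixed point equation for the root proves it one
  coefficient at a time.\<close>

definition int_upto :: "nat \<Rightarrow> real fps \<Rightarrow> bool" where
  "int_upto n f \<longleftrightarrow> (\<forall>i<n. fps_nth f i \<in> \<int>)"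

lemma int_upto_numeral: "int_upto n (numeral k)" "int_upto n 1"
  by (auto simp: int_upto_def numeral_fps_const)

lemma int_upto_add: "int_upto n f \<Longrightarrow> int_upto n g \<Longrightarrow> int_upto n (f + g)"
  by (auto simp: int_upto_def)

lemma int_upto_diff: "int_upto n f \<Longrightarrow> int_upto n g \<Longrightarrow> int_upto n (f - g)"
  by (auto simp: int_upto_def)

lemma int_upto_mult: "int_upto n f \<Longrightarrow> int_upto n g \<Longrightarrow> int_upto n (f * g)"
  by (auto simp: int_upto_def fps_mult_nth)

lemma int_upto_power: "int_upto n f \<Longrightarrow> int_upto n (f ^ k)"
  by (induction k) (auto intro: int_upto_mult int_upto_numeral)

lemma int_upto_X_mult: "int_upto n f \<Longrightarrow> int_upto (Suc n) (fps_X * f)"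
  by (auto simp: int_upto_def)

lemmas int_upto_intros = int_upto_numeral int_upto_add int_upto_diff int_upto_mult int_upto_power

text \<open>Each term of the fixed point equation gains one order: the first through its factor X,
  the square because W has no constant term, so its coefficients up to n involve only those of W
  below n.\<close>

lemma int_upto_omega_root: "int_upto n omega_root"
proof (induction n)
  case 0 show ?case by (simp add: int_upto_def)
next
  case (Suc n)
  have eq: "omega_root = fps_X * ((1 + 4 * omega_root) ^ 2 * (1 + 2 * omega_root) ^ 2) - 3 * (omega_root * omega_root)"
    using omega_root_equation by (simp add: algebra_simps)
  have sq: "int_upto (Suc n) (omega_root * omega_root)"
    unfolding int_upto_def fps_mult_nth
  proof (intro allI impI Ints_sum)
    fix i j assume i: "i < Suc n" and j: "j \<in> {0..i}"
    show "fps_nth omega_root j * fps_nth omega_root (i - j) \<in> \<int>"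
    proof (cases "j = 0 \<or> i - j = 0")
      case True then show ?thesis by (auto simp: omega_root_0)
    next
      case False
      then have "j < n" "i - j < n" using i j by auto
      then show ?thesis using Suc by (auto simp: int_upto_def)
    qed
  qed
  show ?case
    by (subst eq) (intro int_upto_intros int_upto_X_mult sq Suc)
qed

text \<open>The halves disappear because (3/2) (1 - \<Omega>) is - 6 W.\<close>

lemma cumulant_gf_in_Ints: "fps_nth cumulant_gf l \<in> \<int>"
proof -
  have W: "int_upto (Suc l) omega_root" by (rule int_upto_omega_root)
  have X: "int_upto (Suc l) fps_X" by (auto simp: int_upto_def)
  have O: "int_upto (Suc l) omega_series" unfolding omega_series_eq by (intro int_upto_intros W)
  have "2 * cumulant_gf = 2 * (2 * fps_X * omega_series ^ 3 + 3 * fps_X * omega_series ^ 2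
      + 2 * fps_X * omega_series - 6 * omega_root)"
    unfolding double_cumulant_gf omega_series_eq by (simp add: algebra_simps)
  then have eq: "cumulant_gf = 2 * fps_X * omega_series ^ 3 + 3 * fps_X * omega_series ^ 2
      + 2 * fps_X * omega_series - 6 * omega_root" unfolding mult_cancel_left by simp
  have "int_upto (Suc l) cumulant_gf" unfolding eq by (intro int_upto_intros O X W)
  then show ?thesis by (simp add: int_upto_def)
qed

lemma cumulant_gf_recurrence:
  defines "p \<equiv> fps_nth cumulant_gf"
  assumes l: "l \<ge> 1"
  shows "real (l + 1) * p (l + 1) = 2 * (2 * real l - 1) * p l
          + 2 * (\<Sum>i=0..l-1. (3 * real i + 1) * real (l - i) * p (i + 1) * p (l - i))"
proof -
  let ?F = cumulant_gf and ?F' = "fps_deriv cumulant_gf"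
  \<comment> \<open>G is (3 X F' - 2 F) / X, which is where the weights 3 i + 1 come from; the sum
    in the recurrence is then a coefficient of G times X F'.\<close>
  define G where "G = Abs_fps (\<lambda>i. (3 * real i + 1) * p (i + 1))"
  have XF': "fps_nth (fps_X * ?F') i = real i * p i" for i by (cases i) (simp_all add: p_def)
  have XG: "fps_X * G = 3 * (fps_X * ?F') - 2 * ?F"
  proof (rule fps_ext)
    fix i show "fps_nth (fps_X * G) i = fps_nth (3 * (fps_X * ?F') - 2 * ?F) i"
      by (cases i) (simp_all add: G_def p_def numeral_fps_const fps_nth_cumulant_gf(1) algebra_simps)
  qed
  have "fps_X * (G * (fps_X * ?F')) = fps_X * ((3 * (fps_X * ?F') - 2 * ?F) * ?F')"
    unfolding XG[symmetric] by (simp add: mult_ac)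
  then have GH: "G * (fps_X * ?F') = (3 * (fps_X * ?F') - 2 * ?F) * ?F'" unfolding mult_cancel_left by simp
  have "?F' = 1 + 4 * (fps_X * ?F') - 2 * ?F + 2 * ((3 * (fps_X * ?F') - 2 * ?F) * ?F')"
    using cumulant_gf_ode by (simp add: algebra_simps power2_eq_square)
  then have "fps_nth ?F' l = fps_nth (1 + 4 * (fps_X * ?F') - 2 * ?F + 2 * (G * (fps_X * ?F'))) l"
    unfolding GH by (rule arg_cong)
  also have "\<dots> = 4 * (real l * p l) - 2 * p l + 2 * fps_nth (G * (fps_X * ?F')) l"
    using l by (simp add: numeral_fps_const XF' p_def del: fps_mult_fps_X_deriv_shift)
  also have "fps_nth (G * (fps_X * ?F')) l = (\<Sum>i=0..l. (3 * real i + 1) * real (l - i) * p (i + 1) * p (l - i))"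
    unfolding fps_mult_nth[of G] XF' by (intro sum.cong) (auto simp: G_def)
  also have "\<dots> = (\<Sum>i=0..l-1. (3 * real i + 1) * real (l - i) * p (i + 1) * p (l - i))"
    by (rule sum.mono_neutral_right) (use l in \<open>auto simp: not_le\<close>)
  finally show ?thesis by (simp add: p_def algebra_simps)
qed

theorem theorem2p12:
  shows "(\<forall>l\<ge>1. convergent (scaled_cumulant l) \<and> limit_cumulant l \<in> \<int>)
    \<and> limit_cumulant 1 = 1
    \<and> (\<forall>l\<ge>1. real (l + 1) * limit_cumulant (l + 1) =
          2 * (2 * real l - 1) * limit_cumulant l
          + 2 * (\<Sum>i=0..l-1. (3 * real i + 1) * real (l - i)
                    * limit_cumulant (i + 1) * limit_cumulant (l - i)))
    \<and> limit_cumulant_gf =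
          fps_const (3/2) - fps_const (3/2) * omega_series
          + 2 * fps_X * omega_series ^ 3 + 3 * fps_X * omega_series ^ 2
          + 2 * fps_X * omega_series"
proof (intro conjI allI impI)
  fix l :: nat assume l: "l \<ge> 1"
  show "convergent (scaled_cumulant l)" using scaled_cumulant_limit[OF l] by (auto simp: convergent_def)
  show "limit_cumulant l \<in> \<int>" unfolding limit_cumulant_eq[OF l] by (rule cumulant_gf_in_Ints)
  have "(\<Sum>i=0..l-1. (3 * real i + 1) * real (l - i) * limit_cumulant (i + 1) * limit_cumulant (l - i))
    = (\<Sum>i=0..l-1. (3 * real i + 1) * real (l - i) * fps_nth cumulant_gf (i + 1) * fps_nth cumulant_gf (l - i))"
    using l by (intro sum.cong refl) (auto simp: limit_cumulant_eq)
  then show "real (l + 1) * limit_cumulant (l + 1) = 2 * (2 * real l - 1) * limit_cumulant l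
      + 2 * (\<Sum>i=0..l-1. (3 * real i + 1) * real (l - i) * limit_cumulant (i + 1) * limit_cumulant (l - i))"
    using cumulant_gf_recurrence[OF l] limit_cumulant_eq[OF l] limit_cumulant_eq[of "l + 1"] by simp
next
  show "limit_cumulant 1 = 1" using limit_cumulant_eq[of 1] fps_nth_cumulant_gf(2) by simp
next
  have "limit_cumulant_gf = cumulant_gf"
    by (rule fps_ext) (simp add: limit_cumulant_gf_def limit_cumulant_eq fps_nth_cumulant_gf(1))
  then show "limit_cumulant_gf = fps_const (3/2) - fps_const (3/2) * omega_series
          + 2 * fps_X * omega_series ^ 3 + 3 * fps_X * omega_series ^ 2
          + 2 * fps_X * omega_series" by (simp only: cumulant_gf_def)
qed

end
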